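(* Let $K$ be either (a) a generic closed curve in $\mathbb{R}P^2$ with no cusps, no inflection points and no antipodal pairs, or (b) a generic smooth immersed closed curve in $\mathbb{R}^2$ with no inflection points. Let $T_1,T_2$ be the numbers of double tangent geodesics (in case (b): double tangent lines) of $K$ of types 1 and 2, $C_1,C_2$ the numbers of crossings of types 1 and 2, and $N_1,N_2$ the numbers of normal-tangent pairs of types 1 and 2. Then $$4T_1-4C_1=N_1-N_2,\qquad 4T_2+4C_2=N_1-N_2 .$$
   Context: $\mathbb{R}P^2$ carries the metric inherited from its double cover, the round 2-sphere of radius one; a simple closed geodesic (projective line, called simply a geodesic) has length $\pi$. Every point has a dual geodesic, the set of points at distance $\pi/2$ from it. $K$ is a parametrized smoothly immersed closed curve; "points of $K$" are points of the parametrized curve. For $p$ on $K$: $\tau_p$ is the geodesic (in $\mathbb{R}^2$: line) tangent to $K$ at $p$; $\nu_p$ is the normal geodesic (line) to $K$ at $p$; $c_p\in\nu_p$ is the center of curvature (center of the osculating circle). In $\mathbb{R}P^2$, $a_p$ is the point of $\tau_p$ at distance $\pi/2$ from $p$, an ordered pair $(p,q)$ of points of $K$ is an antipodal pair if $q=a_p$, and $Y_p$ is the geodesic dual to $c_p$. In $\mathbb{R}P^2$, $p$ and $c_p$ divide $\nu_p$ into two segments; $\nu_p^+$ is the shorter and $\nu_p^-$ the longer. In $\mathbb{R}^2$, $\nu_p^+$ is the line segment from $p$ to $c_p$ and $\nu_p^-$ is the rest of the line $\nu_p$. Normal-tangent pairs: ordered pairs $(p,q)$ of points of $K$ with $\tau_q=\nu_p$;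 of type 1 if $q\in\nu_p^-$, of type 2 if $q\in\nu_p^+$. Double tangent geodesics (lines): geodesics (lines) tangent to $K$ at two points. Consider the segment between the two tangency points (in $\mathbb{R}P^2$, the one of the two segments having length less than $\pi/2$). The type is 1 if $K$ near the two points lies on the same side of this segment, 2 if on opposite sides. Crossings: at a crossing (transverse self-intersection) the two tangent geodesics (lines) define four angles, two of which, $\alpha$ and $\beta$ (opposite to each other), are less than $\pi/2$. Near the crossing $K$ consists of four segments emanating from it. The crossing is of type 1 if one of these segments lies in $\alpha$ and another in $\beta$; of type 2 if two lie in $\alpha$ or two lie in $\beta$. Generic (for curves without cusps): the attributes counted are stable under small smooth perturbation of $K$ (in particular self-intersections are double points and all types are well defined), and: $K$ has finitely many crossings, double tangents, inflection points, antipodal pairs and normal-tangent pairs; tangent geodesics at self-intersections are neither equal nor perpendicular; the tangent geodesic at an inflection point is everywhere else transverse to $K$; a geodesic is tangent to $K$ at at most two points; no crossings occur at inflection points; a geodesic normal to $K$ at one point is tangent to $K$ at at most one point and everywhere else transverse to $K$; the distance between the two points of tangency on a double tangent geodesic is not $\pi/2$; if $(p,q)$ is an antipodal pair, $\tau_q$ is neither $\tau_p$ nor $Y_p$; if $(p,q)$ is a normal-tangent pair, $q\neq c_p$. For curves in $\mathbb{R}^2$ the same conditions are required with lines in place of geodesics, omitting those about antipodal pairs and about distance $\pi/2$ (a plane curve is viewed as a curve in a small disk of $\mathbb{R}P^2$). *)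

theory Defs
  imports "HOL-Analysis.Analysis"
begin

section \<open>Smooth closed curves\<close>

text \<open>A closed curve is a 1-periodic function on the reals; its points (points of the
  parametrized curve, as opposed to their positions in the surface) are the parameters
  in \<open>[0,1)\<close>.\<close>

definition params :: "real set" where
  "params = {0..<1}"

primrec nderiv :: "nat \<Rightarrow> (real \<Rightarrow> 'a::real_normed_vector) \<Rightarrow> real \<Rightarrow> 'a" where
  "nderiv 0 f = f"
| "nderiv (Suc n) f = (\<lambda>t. vector_derivative (nderiv n f) (at t))"

definition smooth :: "(real \<Rightarrow> 'a::real_normed_vector) \<Rightarrow> bool" where
  "smooth f \<longleftrightarrow> (\<forall>n t. nderiv n f differentiable (at t))"

text \<open>The sets with \<open>k\<close> and \<open>\<delta> > 0\<close> varying form a neighbourhood basis of \<open>f\<close> in the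
  \<open>C\<^sup>\<infinity>\<close> topology on periodic maps.\<close>

definition C_close :: "nat \<Rightarrow> real \<Rightarrow> (real \<Rightarrow> 'a::real_normed_vector) \<Rightarrow> (real \<Rightarrow> 'a) \<Rightarrow> bool" where
  "C_close k \<delta> f g \<longleftrightarrow> (\<forall>i\<le>k. \<forall>t. norm (nderiv i g t - nderiv i f t) < \<delta>)"

definition same_count :: "'a set \<Rightarrow> 'a set \<Rightarrow> bool" where
  "same_count A B \<longleftrightarrow> finite A \<and> finite B \<and> card A = card B"

definition near_in :: "(real \<Rightarrow> 'p) \<Rightarrow> real \<Rightarrow> 'p set \<Rightarrow> bool" where
  "near_in K t A \<longleftrightarrow> (\<forall>\<^sub>F u in at t. K u \<in> A)"

text \<open>The four segments of \<open>K\<close> emanating from a crossing with parameters \<open>s\<close> and \<open>t\<close> are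
  indexed by the parameter and the direction in which it is left.\<close>

definition branches :: "real \<Rightarrow> real \<Rightarrow> (real \<times> real) set" where
  "branches s t = {s, t} \<times> {1, -1}"

definition branch_in :: "(real \<Rightarrow> 'p) \<Rightarrow> real \<times> real \<Rightarrow> 'p set \<Rightarrow> bool" where
  "branch_in K b A \<longleftrightarrow> (\<forall>\<^sub>F h in at_right 0. K (fst b + snd b * h) \<in> A)"

definition one_branch_in_each ::
  "(real \<Rightarrow> 'p) \<Rightarrow> real \<Rightarrow> real \<Rightarrow> 'p set \<Rightarrow> 'p set \<Rightarrow> bool" where
  "one_branch_in_each K s t A B \<longleftrightarrow>
     (\<exists>b\<in>branches s t. \<exists>b'\<in>branches s t. b \<noteq> b' \<and> branch_in K b A \<and> branch_in K b' B)"

definition two_branches_in ::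
  "(real \<Rightarrow> 'p) \<Rightarrow> real \<Rightarrow> real \<Rightarrow> 'p set \<Rightarrow> bool" where
  "two_branches_in K s t A \<longleftrightarrow>
     (\<exists>b\<in>branches s t. \<exists>b'\<in>branches s t. b \<noteq> b' \<and> branch_in K b A \<and> branch_in K b' A)"


section \<open>The projective plane\<close>

typedef rp2 = "{{x, - x} |x :: real^3. norm x = 1}"
  morphisms reps Abs_rp2
proof -
  have "norm (axis 1 1 :: real^3) = 1"
    by (simp add: norm_axis_1)
  then show ?thesis by blast
qed

definition rp2_proj :: "real^3 \<Rightarrow> rp2" where
  "rp2_proj x = Abs_rp2 {x, - x}"

lemma reps_rp2_proj: "norm x = 1 \<Longrightarrow> reps (rp2_proj x) = {x, - x}"
  unfolding rp2_proj_def by (rule Abs_rp2_inverse) blast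

text \<open>The quotient of the angular metric of the unit sphere.\<close>

definition rp2_dist :: "rp2 \<Rightarrow> rp2 \<Rightarrow> real" where
  "rp2_dist p q = Min {arccos (x \<bullet> y) |x y. x \<in> reps p \<and> y \<in> reps q}"

lemma rp2_dist_proj:
  assumes "norm x = 1" "norm y = 1"
  shows "rp2_dist (rp2_proj x) (rp2_proj y) = arccos \<bar>x \<bullet> y\<bar>"
proof -
  have b: "\<bar>x \<bullet> y\<bar> \<le> 1"
    using Cauchy_Schwarz_ineq2[of x y] assms by simp
  have "{arccos (u \<bullet> v) |u v. u \<in> {x, - x} \<and> v \<in> {y, - y}} = {arccos (x \<bullet> y), arccos (- (x \<bullet> y))}"
    by (auto, force+)
  then have "rp2_dist (rp2_proj x) (rp2_proj y) = min (arccos (x \<bullet> y)) (arccos (- (x \<bullet> y)))"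
    unfolding rp2_dist_def reps_rp2_proj[OF assms(1)] reps_rp2_proj[OF assms(2)] by simp
  also have "\<dots> = arccos \<bar>x \<bullet> y\<bar>"
    using b arccos_le_mono[of "x \<bullet> y" "- (x \<bullet> y)"] arccos_le_mono[of "- (x \<bullet> y)" "x \<bullet> y"]
    by (auto simp: min_def abs_if)
  finally show ?thesis .
qed

text \<open>The geodesic through \<open>[x]\<close> in the direction \<open>v\<close>, for orthonormal \<open>x\<close> and \<open>v\<close>.\<close>

definition rp2_geodesic :: "real^3 \<Rightarrow> real^3 \<Rightarrow> rp2 set" where
  "rp2_geodesic x v = {rp2_proj (cos r *\<^sub>R x + sin r *\<^sub>R v) |r. True}"

definition rp2_dual :: "rp2 \<Rightarrow> rp2 set" where
  "rp2_dual p = {q. rp2_dist p q = pi / 2}"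

text \<open>Image of the shorter great-circle arc from \<open>x\<close> to \<open>y\<close>, of length \<open>arccos (x \<bullet> y)\<close>.
  The two segments into which two points divide the geodesic through them arise from the
  two choices of the sign of one representative.\<close>

definition rp2_arc :: "real^3 \<Rightarrow> real^3 \<Rightarrow> rp2 set" where
  "rp2_arc x y = {rp2_proj (sgn (a *\<^sub>R x + b *\<^sub>R y)) |a b. 0 \<le> a \<and> 0 \<le> b \<and> a + b > 0}"

text \<open>The angle at \<open>[x]\<close> spanned by tangent vectors \<open>v\<close> and \<open>w\<close> at \<open>x\<close>: the geodesic rays of
  length \<open>\<pi>/2\<close> that start inside it. (Globally, two geodesics bound only two regions; it is
  the bound on the length that separates opposite angles.)\<close>

definition rp2_angle :: "real^3 \<Rightarrow> real^3 \<Rightarrow> real^3 \<Rightarrow> rp2 set" where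
  "rp2_angle x v w = {rp2_proj (cos r *\<^sub>R x + sin r *\<^sub>R sgn (a *\<^sub>R v + b *\<^sub>R w)) |r a b.
     0 < r \<and> r < pi / 2 \<and> 0 < a \<and> 0 < b}"

text \<open>The half, on the side of \<open>n\<close>, of the disk of radius \<open>\<pi>/2\<close> around \<open>[x]\<close>.\<close>

definition rp2_half_disk :: "real^3 \<Rightarrow> real^3 \<Rightarrow> rp2 set" where
  "rp2_half_disk x n = {rp2_proj y |y. norm y = 1 \<and> y \<bullet> x > 0 \<and> y \<bullet> n > 0}"


subsection \<open>Curves\<close>

definition is_lift :: "(real \<Rightarrow> rp2) \<Rightarrow> (real \<Rightarrow> real^3) \<Rightarrow> bool" where
  "is_lift K \<gamma> \<longleftrightarrow> smooth \<gamma> \<and>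
     (\<forall>t. norm (\<gamma> t) = 1 \<and> nderiv 1 \<gamma> t \<noteq> 0 \<and> K t = rp2_proj (\<gamma> t))"

text \<open>A smooth closed curve lifts to the sphere along the real line, with
  \<open>\<gamma> (t + 1) = \<plusminus> \<gamma> t\<close>; both signs are allowed.\<close>

definition rp2_closed_curve :: "(real \<Rightarrow> rp2) \<Rightarrow> bool" where
  "rp2_closed_curve K \<longleftrightarrow> (\<forall>t. K (t + 1) = K t) \<and> (\<exists>\<gamma>. is_lift K \<gamma>)"

text \<open>The lift is unique up to sign, and nothing defined from it below depends on the sign.\<close>

definition lift_of :: "(real \<Rightarrow> rp2) \<Rightarrow> real \<Rightarrow> real^3" where
  "lift_of K = (SOME \<gamma>. is_lift K \<gamma>)"

definition rp2_tvec :: "(real \<Rightarrow> rp2) \<Rightarrow> real \<Rightarrow> real^3" where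
  "rp2_tvec K t = sgn (nderiv 1 (lift_of K) t)"

definition rp2_tangent :: "(real \<Rightarrow> rp2) \<Rightarrow> real \<Rightarrow> rp2 set" where
  "rp2_tangent K t = rp2_geodesic (lift_of K t) (rp2_tvec K t)"

definition rp2_normal :: "(real \<Rightarrow> rp2) \<Rightarrow> real \<Rightarrow> rp2 set" where
  "rp2_normal K t = rp2_geodesic (lift_of K t) (cross3 (lift_of K t) (rp2_tvec K t))"

text \<open>The circle \<open>{z. z \<bullet> y = \<gamma> t \<bullet> y}\<close> on the sphere, with center \<open>y\<close>, osculates \<open>\<gamma>\<close> at \<open>t\<close> iff
  the first two derivatives of \<open>\<lambda>s. \<gamma> s \<bullet> y\<close> vanish at \<open>t\<close>.\<close>

definition rp2_center :: "(real \<Rightarrow> rp2) \<Rightarrow> real \<Rightarrow> rp2" where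
  "rp2_center K t = (THE c. \<exists>y\<in>reps c.
     nderiv 1 (lift_of K) t \<bullet> y = 0 \<and> nderiv 2 (lift_of K) t \<bullet> y = 0)"

definition rp2_antipode :: "(real \<Rightarrow> rp2) \<Rightarrow> real \<Rightarrow> rp2" where
  "rp2_antipode K t = (THE q. q \<in> rp2_tangent K t \<and> rp2_dist (K t) q = pi / 2)"

definition rp2_normal_plus :: "(real \<Rightarrow> rp2) \<Rightarrow> real \<Rightarrow> rp2 set" where
  "rp2_normal_plus K t = \<Union> {rp2_arc x c |x c.
     x \<in> reps (K t) \<and> c \<in> reps (rp2_center K t) \<and> arccos (x \<bullet> c) < pi / 2}"

definition rp2_normal_minus :: "(real \<Rightarrow> rp2) \<Rightarrow> real \<Rightarrow> rp2 set" where
  "rp2_normal_minus K t = \<Union> {rp2_arc x c |x c.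
     x \<in> reps (K t) \<and> c \<in> reps (rp2_center K t) \<and> arccos (x \<bullet> c) > pi / 2}"

text \<open>Vanishing geodesic curvature.\<close>

definition rp2_inflection :: "(real \<Rightarrow> rp2) \<Rightarrow> real \<Rightarrow> bool" where
  "rp2_inflection K t \<longleftrightarrow>
     nderiv 2 (lift_of K) t \<bullet> cross3 (lift_of K t) (nderiv 1 (lift_of K) t) = 0"

definition rp2_inflections :: "(real \<Rightarrow> rp2) \<Rightarrow> real set" where
  "rp2_inflections K = {t \<in> params. rp2_inflection K t}"

definition rp2_antipodal_pairs :: "(real \<Rightarrow> rp2) \<Rightarrow> (real \<times> real) set" where
  "rp2_antipodal_pairs K = {(p, q). p \<in> params \<and> q \<in> params \<and> K q = rp2_antipode K p}"


subsection \<open>Normal-tangent pairs, double tangents and crossings\<close>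

definition rp2_nt_pairs :: "(real \<Rightarrow> rp2) \<Rightarrow> (real \<times> real) set" where
  "rp2_nt_pairs K = {(p, q). p \<in> params \<and> q \<in> params \<and> rp2_tangent K q = rp2_normal K p}"

definition rp2_nt_pairs1 :: "(real \<Rightarrow> rp2) \<Rightarrow> (real \<times> real) set" where
  "rp2_nt_pairs1 K = {(p, q) \<in> rp2_nt_pairs K. K q \<in> rp2_normal_minus K p}"

definition rp2_nt_pairs2 :: "(real \<Rightarrow> rp2) \<Rightarrow> (real \<times> real) set" where
  "rp2_nt_pairs2 K = {(p, q) \<in> rp2_nt_pairs K. K q \<in> rp2_normal_plus K p}"

definition rp2_double_tangency :: "(real \<Rightarrow> rp2) \<Rightarrow> real \<Rightarrow> real \<Rightarrow> bool" where
  "rp2_double_tangency K s t \<longleftrightarrow>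
     s \<in> params \<and> t \<in> params \<and> s \<noteq> t \<and> rp2_tangent K s = rp2_tangent K t"

text \<open>\<open>K\<close> lies near \<open>s\<close> and \<open>t\<close> on the sides \<open>n\<close> and \<open>\<epsilon>n\<close> of the segment of length less than
  \<open>\<pi>/2\<close> between the tangency points. Only representatives \<open>x\<close>, \<open>y\<close> joined by a lift of this
  segment may be compared: the sides are exchanged along the other segment.\<close>

definition rp2_sides :: "(real \<Rightarrow> rp2) \<Rightarrow> real \<Rightarrow> real \<Rightarrow> real \<Rightarrow> bool" where
  "rp2_sides K s t \<epsilon> \<longleftrightarrow> (\<exists>x\<in>reps (K s). \<exists>y\<in>reps (K t). \<exists>n. arccos (x \<bullet> y) < pi / 2 \<and>
     norm n = 1 \<and> (\<forall>q\<in>rp2_tangent K s. \<forall>z\<in>reps q. z \<bullet> n = 0) \<and>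
     near_in K s (rp2_half_disk x n) \<and> near_in K t (rp2_half_disk y (\<epsilon> *\<^sub>R n)))"

definition rp2_double_tangents :: "(real \<Rightarrow> rp2) \<Rightarrow> rp2 set set" where
  "rp2_double_tangents K = {rp2_tangent K s |s t. rp2_double_tangency K s t}"

definition rp2_double_tangents1 :: "(real \<Rightarrow> rp2) \<Rightarrow> rp2 set set" where
  "rp2_double_tangents1 K =
     {rp2_tangent K s |s t. rp2_double_tangency K s t \<and> rp2_sides K s t 1}"

definition rp2_double_tangents2 :: "(real \<Rightarrow> rp2) \<Rightarrow> rp2 set set" where
  "rp2_double_tangents2 K =
     {rp2_tangent K s |s t. rp2_double_tangency K s t \<and> rp2_sides K s t (- 1)}"

definition rp2_self_intersection :: "(real \<Rightarrow> rp2) \<Rightarrow> real \<Rightarrow> real \<Rightarrow> bool" where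
  "rp2_self_intersection K s t \<longleftrightarrow> s \<in> params \<and> t \<in> params \<and> s \<noteq> t \<and> K s = K t"

definition rp2_crossing :: "(real \<Rightarrow> rp2) \<Rightarrow> real \<Rightarrow> real \<Rightarrow> bool" where
  "rp2_crossing K s t \<longleftrightarrow>
     rp2_self_intersection K s t \<and> rp2_tangent K s \<noteq> rp2_tangent K t"

text \<open>The lifts of \<open>s\<close> and \<open>t\<close> may be antipodal; the unit tangent at \<open>t\<close> nevertheless spans the
  tangent line of \<open>\<tau>\<^sub>t\<close> at the lift of \<open>s\<close>. The sign of \<open>w\<close> picks the two angles less than \<open>\<pi>/2\<close>.\<close>

definition rp2_acute_angles :: "(real \<Rightarrow> rp2) \<Rightarrow> real \<Rightarrow> real \<Rightarrow> (rp2 set \<times> rp2 set) set" where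
  "rp2_acute_angles K s t =
     {(rp2_angle (lift_of K s) v w, rp2_angle (lift_of K s) (- v) (- w)) |v w.
        v = rp2_tvec K s \<and> w \<in> {rp2_tvec K t, - rp2_tvec K t} \<and> arccos (v \<bullet> w) < pi / 2}"

definition rp2_crossing_type1 :: "(real \<Rightarrow> rp2) \<Rightarrow> real \<Rightarrow> real \<Rightarrow> bool" where
  "rp2_crossing_type1 K s t \<longleftrightarrow>
     (\<exists>(\<alpha>, \<beta>)\<in>rp2_acute_angles K s t. one_branch_in_each K s t \<alpha> \<beta>)"

definition rp2_crossing_type2 :: "(real \<Rightarrow> rp2) \<Rightarrow> real \<Rightarrow> real \<Rightarrow> bool" where
  "rp2_crossing_type2 K s t \<longleftrightarrow>
     (\<exists>(\<alpha>, \<beta>)\<in>rp2_acute_angles K s t. two_branches_in K s t \<alpha> \<or> two_branches_in K s t \<beta>)"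

definition rp2_crossings :: "(real \<Rightarrow> rp2) \<Rightarrow> rp2 set" where
  "rp2_crossings K = {K s |s t. rp2_crossing K s t}"

definition rp2_crossings1 :: "(real \<Rightarrow> rp2) \<Rightarrow> rp2 set" where
  "rp2_crossings1 K = {K s |s t. rp2_crossing K s t \<and> rp2_crossing_type1 K s t}"

definition rp2_crossings2 :: "(real \<Rightarrow> rp2) \<Rightarrow> rp2 set" where
  "rp2_crossings2 K = {K s |s t. rp2_crossing K s t \<and> rp2_crossing_type2 K s t}"


subsection \<open>Genericity\<close>

definition rp2_stable :: "(real \<Rightarrow> rp2) \<Rightarrow> bool" where
  "rp2_stable K \<longleftrightarrow> (\<exists>k. \<exists>\<delta>>0. \<forall>K' \<gamma> \<gamma>'.
     rp2_closed_curve K' \<and> is_lift K \<gamma> \<and> is_lift K' \<gamma>' \<and> C_close k \<delta> \<gamma> \<gamma>' \<longrightarrow>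
       same_count (rp2_inflections K) (rp2_inflections K') \<and>
       same_count (rp2_antipodal_pairs K) (rp2_antipodal_pairs K') \<and>
       same_count (rp2_crossings K) (rp2_crossings K') \<and>
       same_count (rp2_crossings1 K) (rp2_crossings1 K') \<and>
       same_count (rp2_crossings2 K) (rp2_crossings2 K') \<and>
       same_count (rp2_double_tangents K) (rp2_double_tangents K') \<and>
       same_count (rp2_double_tangents1 K) (rp2_double_tangents1 K') \<and>
       same_count (rp2_double_tangents2 K) (rp2_double_tangents2 K') \<and>
       same_count (rp2_nt_pairs K) (rp2_nt_pairs K') \<and>
       same_count (rp2_nt_pairs1 K) (rp2_nt_pairs1 K') \<and>
       same_count (rp2_nt_pairs2 K) (rp2_nt_pairs2 K'))"

definition rp2_types_well_defined :: "(real \<Rightarrow> rp2) \<Rightarrow> bool" where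
  "rp2_types_well_defined K \<longleftrightarrow>
     (\<forall>s t. rp2_crossing K s t \<longrightarrow> rp2_crossing_type1 K s t \<noteq> rp2_crossing_type2 K s t) \<and>
     (\<forall>s t. rp2_double_tangency K s t \<longrightarrow> rp2_sides K s t 1 \<noteq> rp2_sides K s t (- 1)) \<and>
     (\<forall>(p, q)\<in>rp2_nt_pairs K. (K q \<in> rp2_normal_minus K p) \<noteq> (K q \<in> rp2_normal_plus K p))"

definition rp2_transverse_at :: "(real \<Rightarrow> rp2) \<Rightarrow> real \<Rightarrow> rp2 set \<Rightarrow> bool" where
  "rp2_transverse_at K t G \<longleftrightarrow> (K t \<in> G \<longrightarrow> rp2_tangent K t \<noteq> G)"

text \<open>At a self-intersection the geodesic perpendicular to \<open>\<tau>\<^sub>s\<close> is \<open>\<nu>\<^sub>s\<close>, so perpendicularity of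
  \<open>\<tau>\<^sub>s\<close> and \<open>\<tau>\<^sub>t\<close> is \<open>\<tau>\<^sub>t = \<nu>\<^sub>s\<close>.\<close>

definition rp2_generic :: "(real \<Rightarrow> rp2) \<Rightarrow> bool" where
  "rp2_generic K \<longleftrightarrow>
     rp2_stable K \<and>
     (\<forall>s t u. rp2_self_intersection K s t \<and> rp2_self_intersection K s u \<longrightarrow> t = u) \<and>
     rp2_types_well_defined K \<and>
     finite (rp2_crossings K) \<and>
     finite (rp2_double_tangents K) \<and>
     finite (rp2_inflections K) \<and>
     finite (rp2_antipodal_pairs K) \<and>
     finite (rp2_nt_pairs K) \<and>
     (\<forall>s t. rp2_self_intersection K s t \<longrightarrow>
        rp2_tangent K t \<noteq> rp2_tangent K s \<and> rp2_tangent K t \<noteq> rp2_normal K s) \<and>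
     (\<forall>p\<in>rp2_inflections K. \<forall>t\<in>params - {p}. rp2_transverse_at K t (rp2_tangent K p)) \<and>
     (\<forall>s t u. rp2_double_tangency K s t \<and> rp2_double_tangency K s u \<longrightarrow> t = u) \<and>
     (\<forall>s t. rp2_crossing K s t \<longrightarrow> \<not> rp2_inflection K s \<and> \<not> rp2_inflection K t) \<and>
     (\<forall>(p, q)\<in>rp2_nt_pairs K. \<forall>t\<in>params - {q}. rp2_transverse_at K t (rp2_normal K p)) \<and>
     (\<forall>s t. rp2_double_tangency K s t \<longrightarrow> rp2_dist (K s) (K t) \<noteq> pi / 2) \<and>
     (\<forall>(p, q)\<in>rp2_antipodal_pairs K.
        rp2_tangent K q \<noteq> rp2_tangent K p \<and> rp2_tangent K q \<noteq> rp2_dual (rp2_center K p)) \<and>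
     (\<forall>(p, q)\<in>rp2_nt_pairs K. K q \<noteq> rp2_center K p)"


section \<open>The Euclidean plane\<close>

definition plane_closed_curve :: "(real \<Rightarrow> real^2) \<Rightarrow> bool" where
  "plane_closed_curve K \<longleftrightarrow> (\<forall>t. K (t + 1) = K t) \<and> smooth K \<and> (\<forall>t. nderiv 1 K t \<noteq> 0)"

definition plane_line :: "real^2 \<Rightarrow> real^2 \<Rightarrow> (real^2) set" where
  "plane_line x v = {x + r *\<^sub>R v |r. True}"

definition rot90 :: "real^2 \<Rightarrow> real^2" where
  "rot90 v = vector [- v $ 2, v $ 1]"

definition plane_angle :: "real^2 \<Rightarrow> real^2 \<Rightarrow> real^2 \<Rightarrow> (real^2) set" where
  "plane_angle x v w = {x + a *\<^sub>R v + b *\<^sub>R w |a b. 0 < a \<and> 0 < b}"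

definition plane_tvec :: "(real \<Rightarrow> real^2) \<Rightarrow> real \<Rightarrow> real^2" where
  "plane_tvec K t = sgn (nderiv 1 K t)"

definition plane_tangent :: "(real \<Rightarrow> real^2) \<Rightarrow> real \<Rightarrow> (real^2) set" where
  "plane_tangent K t = plane_line (K t) (plane_tvec K t)"

definition plane_normal :: "(real \<Rightarrow> real^2) \<Rightarrow> real \<Rightarrow> (real^2) set" where
  "plane_normal K t = plane_line (K t) (rot90 (plane_tvec K t))"

definition plane_inflection :: "(real \<Rightarrow> real^2) \<Rightarrow> real \<Rightarrow> bool" where
  "plane_inflection K t \<longleftrightarrow> nderiv 2 K t \<bullet> rot90 (nderiv 1 K t) = 0"

text \<open>The circle with center \<open>c\<close> through \<open>K t\<close> osculates \<open>K\<close> at \<open>t\<close> iff the first two derivatives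
  of \<open>\<lambda>s. (norm (K s - c))\<^sup>2 / 2\<close> vanish at \<open>t\<close>. There is exactly one such \<open>c\<close> if \<open>t\<close> is not an
  inflection point, and none otherwise.\<close>

definition plane_is_center :: "(real \<Rightarrow> real^2) \<Rightarrow> real \<Rightarrow> real^2 \<Rightarrow> bool" where
  "plane_is_center K t c \<longleftrightarrow>
     (K t - c) \<bullet> nderiv 1 K t = 0 \<and>
     (K t - c) \<bullet> nderiv 2 K t + nderiv 1 K t \<bullet> nderiv 1 K t = 0"

definition plane_normal_plus :: "(real \<Rightarrow> real^2) \<Rightarrow> real \<Rightarrow> (real^2) set" where
  "plane_normal_plus K t = {x. \<exists>c. plane_is_center K t c \<and> x \<in> closed_segment (K t) c}"

definition plane_normal_minus :: "(real \<Rightarrow> real^2) \<Rightarrow> real \<Rightarrow> (real^2) set" where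
  "plane_normal_minus K t =
     {x. \<exists>c. plane_is_center K t c \<and> x \<in> plane_normal K t - closed_segment (K t) c}"

definition plane_inflections :: "(real \<Rightarrow> real^2) \<Rightarrow> real set" where
  "plane_inflections K = {t \<in> params. plane_inflection K t}"

definition plane_nt_pairs :: "(real \<Rightarrow> real^2) \<Rightarrow> (real \<times> real) set" where
  "plane_nt_pairs K =
     {(p, q). p \<in> params \<and> q \<in> params \<and> plane_tangent K q = plane_normal K p}"

definition plane_nt_pairs1 :: "(real \<Rightarrow> real^2) \<Rightarrow> (real \<times> real) set" where
  "plane_nt_pairs1 K = {(p, q) \<in> plane_nt_pairs K. K q \<in> plane_normal_minus K p}"

definition plane_nt_pairs2 :: "(real \<Rightarrow> real^2) \<Rightarrow> (real \<times> real) set" where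
  "plane_nt_pairs2 K = {(p, q) \<in> plane_nt_pairs K. K q \<in> plane_normal_plus K p}"

definition plane_double_tangency :: "(real \<Rightarrow> real^2) \<Rightarrow> real \<Rightarrow> real \<Rightarrow> bool" where
  "plane_double_tangency K s t \<longleftrightarrow>
     s \<in> params \<and> t \<in> params \<and> s \<noteq> t \<and> plane_tangent K s = plane_tangent K t"

definition plane_sides :: "(real \<Rightarrow> real^2) \<Rightarrow> real \<Rightarrow> real \<Rightarrow> real \<Rightarrow> bool" where
  "plane_sides K s t \<epsilon> \<longleftrightarrow> (\<exists>n. norm n = 1 \<and> plane_tvec K s \<bullet> n = 0 \<and>
     near_in K s {z. (z - K s) \<bullet> n > 0} \<and> near_in K t {z. (z - K t) \<bullet> (\<epsilon> *\<^sub>R n) > 0})"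

definition plane_double_tangents :: "(real \<Rightarrow> real^2) \<Rightarrow> (real^2) set set" where
  "plane_double_tangents K = {plane_tangent K s |s t. plane_double_tangency K s t}"

definition plane_double_tangents1 :: "(real \<Rightarrow> real^2) \<Rightarrow> (real^2) set set" where
  "plane_double_tangents1 K =
     {plane_tangent K s |s t. plane_double_tangency K s t \<and> plane_sides K s t 1}"

definition plane_double_tangents2 :: "(real \<Rightarrow> real^2) \<Rightarrow> (real^2) set set" where
  "plane_double_tangents2 K =
     {plane_tangent K s |s t. plane_double_tangency K s t \<and> plane_sides K s t (- 1)}"

definition plane_self_intersection :: "(real \<Rightarrow> real^2) \<Rightarrow> real \<Rightarrow> real \<Rightarrow> bool" where
  "plane_self_intersection K s t \<longleftrightarrow> s \<in> params \<and> t \<in> params \<and> s \<noteq> t \<and> K s = K t"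

definition plane_crossing :: "(real \<Rightarrow> real^2) \<Rightarrow> real \<Rightarrow> real \<Rightarrow> bool" where
  "plane_crossing K s t \<longleftrightarrow>
     plane_self_intersection K s t \<and> plane_tangent K s \<noteq> plane_tangent K t"

definition plane_acute_angles ::
  "(real \<Rightarrow> real^2) \<Rightarrow> real \<Rightarrow> real \<Rightarrow> ((real^2) set \<times> (real^2) set) set" where
  "plane_acute_angles K s t =
     {(plane_angle (K s) v w, plane_angle (K s) (- v) (- w)) |v w.
        v = plane_tvec K s \<and> w \<in> {plane_tvec K t, - plane_tvec K t} \<and> arccos (v \<bullet> w) < pi / 2}"

definition plane_crossing_type1 :: "(real \<Rightarrow> real^2) \<Rightarrow> real \<Rightarrow> real \<Rightarrow> bool" where
  "plane_crossing_type1 K s t \<longleftrightarrow>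
     (\<exists>(\<alpha>, \<beta>)\<in>plane_acute_angles K s t. one_branch_in_each K s t \<alpha> \<beta>)"

definition plane_crossing_type2 :: "(real \<Rightarrow> real^2) \<Rightarrow> real \<Rightarrow> real \<Rightarrow> bool" where
  "plane_crossing_type2 K s t \<longleftrightarrow>
     (\<exists>(\<alpha>, \<beta>)\<in>plane_acute_angles K s t. two_branches_in K s t \<alpha> \<or> two_branches_in K s t \<beta>)"

definition plane_crossings :: "(real \<Rightarrow> real^2) \<Rightarrow> (real^2) set" where
  "plane_crossings K = {K s |s t. plane_crossing K s t}"

definition plane_crossings1 :: "(real \<Rightarrow> real^2) \<Rightarrow> (real^2) set" where
  "plane_crossings1 K = {K s |s t. plane_crossing K s t \<and> plane_crossing_type1 K s t}"

definition plane_crossings2 :: "(real \<Rightarrow> real^2) \<Rightarrow> (real^2) set" where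
  "plane_crossings2 K = {K s |s t. plane_crossing K s t \<and> plane_crossing_type2 K s t}"

definition plane_stable :: "(real \<Rightarrow> real^2) \<Rightarrow> bool" where
  "plane_stable K \<longleftrightarrow> (\<exists>k. \<exists>\<delta>>0. \<forall>K'. plane_closed_curve K' \<and> C_close k \<delta> K K' \<longrightarrow>
     same_count (plane_inflections K) (plane_inflections K') \<and>
     same_count (plane_crossings K) (plane_crossings K') \<and>
     same_count (plane_crossings1 K) (plane_crossings1 K') \<and>
     same_count (plane_crossings2 K) (plane_crossings2 K') \<and>
     same_count (plane_double_tangents K) (plane_double_tangents K') \<and>
     same_count (plane_double_tangents1 K) (plane_double_tangents1 K') \<and>
     same_count (plane_double_tangents2 K) (plane_double_tangents2 K') \<and>
     same_count (plane_nt_pairs K) (plane_nt_pairs K') \<and>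
     same_count (plane_nt_pairs1 K) (plane_nt_pairs1 K') \<and>
     same_count (plane_nt_pairs2 K) (plane_nt_pairs2 K'))"

definition plane_types_well_defined :: "(real \<Rightarrow> real^2) \<Rightarrow> bool" where
  "plane_types_well_defined K \<longleftrightarrow>
     (\<forall>s t. plane_crossing K s t \<longrightarrow> plane_crossing_type1 K s t \<noteq> plane_crossing_type2 K s t) \<and>
     (\<forall>s t. plane_double_tangency K s t \<longrightarrow> plane_sides K s t 1 \<noteq> plane_sides K s t (- 1)) \<and>
     (\<forall>(p, q)\<in>plane_nt_pairs K. (K q \<in> plane_normal_minus K p) \<noteq> (K q \<in> plane_normal_plus K p))"

definition plane_transverse_at :: "(real \<Rightarrow> real^2) \<Rightarrow> real \<Rightarrow> (real^2) set \<Rightarrow> bool" where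
  "plane_transverse_at K t L \<longleftrightarrow> (K t \<in> L \<longrightarrow> plane_tangent K t \<noteq> L)"

definition plane_generic :: "(real \<Rightarrow> real^2) \<Rightarrow> bool" where
  "plane_generic K \<longleftrightarrow>
     plane_stable K \<and>
     (\<forall>s t u. plane_self_intersection K s t \<and> plane_self_intersection K s u \<longrightarrow> t = u) \<and>
     plane_types_well_defined K \<and>
     finite (plane_crossings K) \<and>
     finite (plane_double_tangents K) \<and>
     finite (plane_inflections K) \<and>
     finite (plane_nt_pairs K) \<and>
     (\<forall>s t. plane_self_intersection K s t \<longrightarrow>
        plane_tangent K t \<noteq> plane_tangent K s \<and> plane_tangent K t \<noteq> plane_normal K s) \<and>
     (\<forall>p\<in>plane_inflections K. \<forall>t\<in>params - {p}. plane_transverse_at K t (plane_tangent K p)) \<and>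
     (\<forall>s t u. plane_double_tangency K s t \<and> plane_double_tangency K s u \<longrightarrow> t = u) \<and>
     (\<forall>s t. plane_crossing K s t \<longrightarrow> \<not> plane_inflection K s \<and> \<not> plane_inflection K t) \<and>
     (\<forall>(p, q)\<in>plane_nt_pairs K. \<forall>t\<in>params - {q}. plane_transverse_at K t (plane_normal K p)) \<and>
     (\<forall>(p, q)\<in>plane_nt_pairs K. \<not> plane_is_center K p (K q))"

end

(* Without inflection points K is locally convex. Let (p, q) run over the torus and consider the curve
   A = 0 of those pairs for which p lies on the tangent geodesic of q. On it vary the angle psi between
   the two tangent geodesics and the signed distance chi along the tangent geodesic from q to p. The sign
   changes of S = sin psi, D = sin chi and C = cos psi on A = 0 are the double tangents, the crossings
   and the normal-tangent pairs.

   Where D, S and C have prescribed signs, p + q or p - q is a monotone coordinate on the curve A = 0.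
   Counting zeros level by level, every arc that enters such a region leaves it again, so the signed
   number of boundary points is zero. The direction in which the curve crosses a boundary is determined
   by the signs: at a double tangent or a crossing by convexity, at a normal-tangent pair by its type.
   Adding the balances of the regions with C > 0 gives the first formula, those with C < 0 the second. *)

theory Submission
  imports Defs
begin

section \<open>Conservation law for zeros: they appear and disappear only at the boundary of a
  region\<close>

section \<open>Zeros along the levels of a torus\<close>

text \<open>The diagonal p = q also satisfies A = 0, and D and S vanish on it together, so it must
  be cut off before signs are counted. This is possible because the curvature does not vanish: for
  fixed q, A vanishes at p = q to exactly second order, so the other zeros keep a distance from the
  diagonal. A function G, positive precisely on them, then joins the sign conditions without
  creating boundary points. In the projective plane the same device splits the pairs by the sign of
  the inner product of their lifts; a change of that sign along A = 0 would be an antipodal pair.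
  The curve A = 0 is never parametrised. Both partial derivatives of A vanish only where D and S do,
  which off the diagonal would be a tangential self-intersection; so zeros can be followed from
  level to level. The coefficient 4 is a product of two doublings. A double tangent or crossing is
  seen by two ordered pairs, and each of these bounds two regions with the given sign of C. A
  normal-tangent pair is ordered and bounds one region on either side of C = 0, which is why the
  same difference stands in both formulas.\<close>

lemma bij_betw_frac_window:
  fixes c :: real
  assumes per: "\<And>x (n::int). P (x + of_int n) = P x"
  shows "bij_betw frac {x \<in> {c..<c + 1}. P x} {x \<in> {0..<1}. P x}"
proof (rule bij_betw_imageI)
  have P_frac: "P (frac x) = P x" for x
    using per[of x "- \<lfloor>x\<rfloor>"] by (simp add: frac_def)
  show "inj_on frac {x \<in> {c..<c + 1}. P x}"
  proof (rule inj_onI)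
    fix x y
    assume x: "x \<in> {x \<in> {c..<c + 1}. P x}" and y: "y \<in> {x \<in> {c..<c + 1}. P x}"
      and "frac x = frac y"
    then have e: "x - y = of_int (\<lfloor>x\<rfloor> - \<lfloor>y\<rfloor>)"
      by (simp add: frac_def)
    have "\<bar>x - y\<bar> < 1" using x y by auto
    with e have "\<bar>\<lfloor>x\<rfloor> - \<lfloor>y\<rfloor>\<bar> < 1" by linarith
    with e show "x = y" by simp
  qed
  show "frac ` {x \<in> {c..<c + 1}. P x} = {x \<in> {0..<1}. P x}"
  proof (intro equalityI subsetI)
    fix u assume u: "u \<in> {x \<in> {0..<1}. P x}"
    define x where "x = c + frac (u - c)"
    have x: "x = u + of_int (- \<lfloor>u - c\<rfloor>)"
      by (simp add: x_def frac_def)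
    have "x \<in> {c..<c + 1}"
      using frac_lt_1[of "u - c"] frac_ge_0[of "u - c"] by (simp add: x_def)
    moreover have "P x" using u unfolding x per by simp
    moreover have "frac x = u"
      using u unfolding x by (simp add: frac_def floor_eq_iff)
    ultimately show "u \<in> frac ` {x \<in> {c..<c + 1}. P x}"
      by (intro image_eqI[of _ _ x]) auto
  qed (use P_frac frac_lt_1 frac_ge_0 in auto)
qed

text \<open>Monotonicity in \<open>x\<close> and the intermediate value theorem suffice, so nothing
  beyond continuity is asked of the dependence on \<open>y\<close>. The bound \<open>R\<close> lets
  intervals around different zeros be kept disjoint; uniqueness within radius \<open>r\<close> makes
  the branch the only zero there.\<close>

lemma implicit_zero:
  fixes B Bx :: "real \<times> real \<Rightarrow> real"
  assumes B: "continuous_on UNIV B" and Bx: "continuous_on UNIV Bx"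
    and dB: "\<And>y x. ((\<lambda>x. B (y, x)) has_real_derivative Bx (y, x)) (at x)"
    and z: "B (y0, x0) = 0" "Bx (y0, x0) > 0" and R: "R > 0"
  obtains r \<xi> where "0 < r" "r \<le> R" "\<xi> y0 = x0" "(\<xi> \<longlongrightarrow> x0) (at y0)"
    "\<forall>\<^sub>F y in nhds y0. B (y, \<xi> y) = 0 \<and> \<bar>\<xi> y - x0\<bar> < r \<and>
       (\<forall>x. \<bar>x - x0\<bar> \<le> r \<longrightarrow> B (y, x) = 0 \<longrightarrow> x = \<xi> y)"
proof -
  have "open {z. Bx z > 0}"
    using Bx by (intro open_Collect_less continuous_intros)
  then obtain U V where UV: "open U" "open V" "y0 \<in> U" "x0 \<in> V" "U \<times> V \<subseteq> {z. Bx z > 0}"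
    using z(2) by (elim open_prod_elim[of _ "(y0, x0)"]) auto
  obtain r0 where r0: "r0 > 0" "cball x0 r0 \<subseteq> V"
    using open_contains_cball UV by metis
  define r where "r = min r0 R"
  have r: "0 < r" "r \<le> R" using r0 R by (auto simp: r_def)
  have rV: "x \<in> V" if "\<bar>x - x0\<bar> \<le> r" for x
    using that r0 by (force simp: r_def subset_iff dist_real_def)
  have mono: "B (y, x) < B (y, x')" if "y \<in> U" "\<bar>x - x0\<bar> \<le> r" "\<bar>x' - x0\<bar> \<le> r" "x < x'" for y x x'
  proof (rule DERIV_pos_imp_increasing[OF \<open>x < x'\<close>])
    fix u assume "x \<le> u" "u \<le> x'"
    then have "u \<in> V" by (intro rV) (use that in auto)
    then have "Bx (y, u) > 0" using UV(5) that by blast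
    then show "\<exists>D. ((\<lambda>x. B (y, x)) has_real_derivative D) (at u) \<and> 0 < D"
      using dB by blast
  qed
  have uniq: "x = x'" if "y \<in> U" "\<bar>x - x0\<bar> \<le> r" "\<bar>x' - x0\<bar> \<le> r" "B (y, x) = 0" "B (y, x') = 0" for y x x'
    using mono[of y x x'] mono[of y x' x] that by (cases x x' rule: linorder_cases) auto
  have evU: "\<forall>\<^sub>F y in nhds y0. y \<in> U"
    using UV by (intro eventually_nhds_in_open)
  \<comment> \<open>The radius \<open>r'\<close> stays free: \<open>r' = r\<close> gives existence
    of the branch, arbitrarily small \<open>r'\<close> its continuity.\<close>
  have ex: "\<forall>\<^sub>F y in nhds y0. \<exists>x. \<bar>x - x0\<bar> < r' \<and> B (y, x) = 0" if r': "0 < r'" "r' \<le> r" for r'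
  proof -
    have c: "continuous_on UNIV (\<lambda>y. B (y, x))" for x
      by (intro continuous_on_compose2[OF B] continuous_intros) auto
    have "open {y. B (y, x0 - r') < 0}" "open {y. B (y, x0 + r') > 0}"
      by (intro open_Collect_less c continuous_intros)+
    moreover have "B (y0, x0 - r') < 0" "B (y0, x0 + r') > 0"
      using mono[of y0 "x0 - r'" x0] mono[of y0 x0 "x0 + r'"] r' z(1) UV r by auto
    ultimately have "\<forall>\<^sub>F y in nhds y0. B (y, x0 - r') < 0" "\<forall>\<^sub>F y in nhds y0. B (y, x0 + r') > 0"
      by (auto dest: eventually_nhds_in_open)
    then show ?thesis
      using evU
    proof eventually_elim
      case (elim y)
      have "\<exists>x\<ge>x0 - r'. x \<le> x0 + r' \<and> B (y, x) = 0"
      proof (rule IVT')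
        show "continuous_on {x0 - r'..x0 + r'} (\<lambda>x. B (y, x))"
          using dB by (meson DERIV_isCont continuous_at_imp_continuous_on)
      qed (use elim r' in auto)
      then obtain x where x: "x \<ge> x0 - r'" "x \<le> x0 + r'" "B (y, x) = 0" by auto
      with elim have "x \<noteq> x0 - r'" "x \<noteq> x0 + r'" by auto
      with x show ?case by (intro exI[of _ x]) auto
    qed
  qed
  define \<xi> where "\<xi> y = (SOME x. \<bar>x - x0\<bar> < r \<and> B (y, x) = 0)" for y
  have \<xi>I: "\<bar>\<xi> y - x0\<bar> < r \<and> B (y, \<xi> y) = 0" if "\<exists>x. \<bar>x - x0\<bar> < r \<and> B (y, x) = 0" for y
    unfolding \<xi>_def using that by (rule someI_ex)
  show ?thesis
  proof (rule that)
    show "0 < r" "r \<le> R" by (fact r)+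
    have "\<bar>\<xi> y0 - x0\<bar> < r \<and> B (y0, \<xi> y0) = 0"
      by (rule \<xi>I) (use z r in \<open>auto intro!: exI[of _ x0]\<close>)
    then show "\<xi> y0 = x0" using uniq[of y0 "\<xi> y0" x0] UV z r by auto
    show "\<forall>\<^sub>F y in nhds y0. B (y, \<xi> y) = 0 \<and> \<bar>\<xi> y - x0\<bar> < r \<and>
       (\<forall>x. \<bar>x - x0\<bar> \<le> r \<longrightarrow> B (y, x) = 0 \<longrightarrow> x = \<xi> y)"
      using ex[OF r(1) order.refl] evU
    proof eventually_elim
      case (elim y)
      from \<xi>I[OF elim(1)] show ?case using uniq[OF elim(2)] by auto
    qed
    show "(\<xi> \<longlongrightarrow> x0) (at y0)"
    proof (rule tendstoI)
      fix e :: real assume "e > 0"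
      define r' where "r' = min e r"
      have r': "0 < r'" "r' \<le> r" "r' \<le> e" using r \<open>e > 0\<close> by (auto simp: r'_def)
      have "\<forall>\<^sub>F y in nhds y0. dist (\<xi> y) x0 < e"
        using ex[OF r'(1,2)] evU
      proof eventually_elim
        case (elim y)
        then obtain x where x: "\<bar>x - x0\<bar> < r'" "B (y, x) = 0" by auto
        then have "\<bar>\<xi> y - x0\<bar> < r \<and> B (y, \<xi> y) = 0"
          using r' by (intro \<xi>I exI[of _ x]) auto
        then have "x = \<xi> y" using uniq[OF elim(2), of x "\<xi> y"] x r' by auto
        then show ?case using x r' by (auto simp: dist_real_def)
      qed
      then show "\<forall>\<^sub>F y in at y0. dist (\<xi> y) x0 < e"
        by (simp add: eventually_at_filter eventually_mono)
    qed
  qed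
qed

text \<open>The branch \<open>\<xi>\<close> need not be differentiable. Subtracting
  \<open>gx / b\<close> times \<open>B\<close> from \<open>g\<close> leaves the values along the
  branch unchanged and removes the first-order dependence on \<open>x\<close>; the remaining
  derivative in \<open>y\<close> is the Jacobian determinant divided by \<open>b\<close>. The
  derivative of \<open>B\<close> bounds \<open>\<xi> y - x0\<close> linearly in
  \<open>y - y0\<close>, so the error is small compared with \<open>y - y0\<close> alone.\<close>

lemma sgn_along_implicit_zero:
  fixes B g :: "real \<times> real \<Rightarrow> real"
  assumes dB: "(B has_derivative (\<lambda>h. By * fst h + b * snd h)) (at (y0, x0))"
    and dg: "(g has_derivative (\<lambda>h. gy * fst h + gx * snd h)) (at (y0, x0))"
    and z: "B (y0, x0) = 0" "g (y0, x0) = 0"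
    and b: "b > 0" and d: "gy * b - gx * By \<noteq> 0"
    and \<xi>: "(\<xi> \<longlongrightarrow> x0) (at y0)" "\<forall>\<^sub>F y in at y0. B (y, \<xi> y) = 0"
  shows "\<forall>\<^sub>F y in at y0. sgn (g (y, \<xi> y)) = sgn (gy * b - gx * By) * sgn (y - y0)"
proof -
  define h where "h z = g z - (gx / b) * B z" for z
  define \<delta> where "\<delta> = (gy * b - gx * By) / b"
  have \<delta>: "\<delta> \<noteq> 0" "sgn \<delta> = sgn (gy * b - gx * By)"
    using b d by (auto simp: \<delta>_def sgn_divide)
  have dh: "(h has_derivative (\<lambda>v. \<delta> * fst v)) (at (y0, x0))"
    unfolding h_def
    by (rule has_derivative_eq_rhs, (rule derivative_intros dB dg)+)
       (use b in \<open>auto simp: \<delta>_def field_simps\<close>)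
  have nP: "norm (u, v) \<le> \<bar>u\<bar> + \<bar>v\<bar>" for u v :: real
    using norm_Pair_le[of u v] by simp
  \<comment> \<open>Slope bound for the branch: linearising \<open>B\<close> with error
    \<open>b / 2\<close> times the increments and absorbing the increment of \<open>\<xi>\<close> on
    the left leaves half of \<open>b\<close> there.\<close>
  define L where "L = (2 * \<bar>By\<bar> + b) / b"
  have L: "L \<ge> 0" using b by (auto simp: L_def)
  have pair: "((\<lambda>y. (y, \<xi> y)) \<longlongrightarrow> (y0, x0)) (at y0)"
    using \<xi>(1) by (intro tendsto_intros)
  have sgn_near: "sgn u = sgn m" if "m \<noteq> 0" "\<bar>u - m\<bar> \<le> \<bar>m\<bar> / 2" for u m :: real
    using that by (auto simp: sgn_if abs_if split: if_splits)
  have near: "\<forall>\<^sub>F y in at y0. \<bar>f (y, \<xi> y) - f (y0, x0) - (p * (y - y0) + q * (\<xi> y - x0))\<bar>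
      \<le> e * (\<bar>y - y0\<bar> + \<bar>\<xi> y - x0\<bar>)"
    if f: "(f has_derivative (\<lambda>h. p * fst h + q * snd h)) (at (y0, x0))" and "e > 0"
    for f :: "real \<times> real \<Rightarrow> real" and p q e
  proof -
    from f \<open>e > 0\<close> obtain d where d: "d > 0"
      "\<And>z. norm (z - (y0, x0)) < d \<Longrightarrow>
        norm (f z - f (y0, x0) - (p * fst (z - (y0, x0)) + q * snd (z - (y0, x0)))) \<le> e * norm (z - (y0, x0))"
      unfolding has_derivative_at_alt by blast
    from tendstoD[OF pair d(1)] show ?thesis
    proof eventually_elim
      case (elim y)
      then have "norm ((y, \<xi> y) - (y0, x0)) < d" by (simp add: dist_norm)
      from d(2)[OF this]
      have "\<bar>f (y, \<xi> y) - f (y0, x0) - (p * (y - y0) + q * (\<xi> y - x0))\<bar> \<le> e * norm (y - y0, \<xi> y - x0)"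
        by simp
      also have "\<dots> \<le> e * (\<bar>y - y0\<bar> + \<bar>\<xi> y - x0\<bar>)"
        using nP \<open>e > 0\<close> by (intro mult_left_mono) auto
      finally show ?case .
    qed
  qed
  \<comment> \<open>Chosen so that the whole error is at most half of the main term
    \<open>\<delta> * (y - y0)\<close>, which then decides the sign.\<close>
  define e where "e = \<bar>\<delta>\<bar> / (2 * (1 + L))"
  have e: "e > 0" "e * (1 + L) = \<bar>\<delta>\<bar> / 2" using \<delta> L by (auto simp: e_def field_simps)
  have dh': "(h has_derivative (\<lambda>v. \<delta> * fst v + 0 * snd v)) (at (y0, x0))"
    using dh by simp
  have "\<forall>\<^sub>F y in at y0. y \<noteq> y0" by (simp add: eventually_at_filter)
  with near[OF dB half_gt_zero[OF b]] near[OF dh' e(1)] \<xi>(2) show ?thesis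
  proof eventually_elim
    case (elim y)
    have "\<bar>By * (y - y0) + b * (\<xi> y - x0)\<bar> \<le> b / 2 * (\<bar>y - y0\<bar> + \<bar>\<xi> y - x0\<bar>)"
      using elim(1,3) z(1) by (metis abs_minus_cancel diff_0 diff_self)
    then have "\<bar>b * (\<xi> y - x0)\<bar> \<le> \<bar>By * (y - y0)\<bar> + b / 2 * (\<bar>y - y0\<bar> + \<bar>\<xi> y - x0\<bar>)"
      by linarith
    then have "b * \<bar>\<xi> y - x0\<bar> \<le> \<bar>By\<bar> * \<bar>y - y0\<bar> + b / 2 * (\<bar>y - y0\<bar> + \<bar>\<xi> y - x0\<bar>)"
      using b by (simp only: abs_mult abs_of_pos)
    then have "b * \<bar>\<xi> y - x0\<bar> \<le> (2 * \<bar>By\<bar> + b) * \<bar>y - y0\<bar>"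
      by (simp add: algebra_simps)
    then have "\<bar>\<xi> y - x0\<bar> \<le> L * \<bar>y - y0\<bar>"
      using b by (simp add: L_def field_simps)
    then have "e * (\<bar>y - y0\<bar> + \<bar>\<xi> y - x0\<bar>) \<le> e * ((1 + L) * \<bar>y - y0\<bar>)"
      using e by (intro mult_left_mono) (auto simp: algebra_simps)
    also have "\<dots> = \<bar>\<delta>\<bar> / 2 * \<bar>y - y0\<bar>" by (simp only: e(2) flip: mult.assoc)
    finally have *: "\<bar>h (y, \<xi> y) - \<delta> * (y - y0)\<bar> \<le> \<bar>\<delta> * (y - y0)\<bar> / 2"
      using elim z by (simp add: h_def abs_mult)
    have "\<delta> * (y - y0) \<noteq> 0" using elim \<delta> by simp
    then have "sgn (h (y, \<xi> y)) = sgn (\<delta> * (y - y0))"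
      using * by (rule sgn_near)
    then show ?case using elim \<delta> by (simp add: h_def sgn_mult)
  qed
qed

text \<open>\<open>B = 0\<close> is a curve on which \<open>y\<close> is a local coordinate wherever
  \<open>g \<ge> 0\<close>. At a boundary point \<open>d\<close> is the Jacobian determinant of
  \<open>g\<close> and \<open>B\<close>; divided by the positive \<open>Bx\<close> it is the
  derivative of \<open>g\<close> along the curve with respect to \<open>y\<close>. So a positive
  \<open>d\<close> means that the curve enters the region as \<open>y\<close> grows, a negative one
  that it leaves.\<close>

locale level_flow =
  fixes B g Bx d :: "real \<times> real \<Rightarrow> real"
  assumes per: "\<And>y x (m::int) (n::int). B (y + of_int m, x + of_int n) = B (y, x)"
      "\<And>y x (m::int) (n::int). g (y + of_int m, x + of_int n) = g (y, x)"
      "\<And>y x (m::int) (n::int). d (y + of_int m, x + of_int n) = d (y, x)"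
    and cont: "continuous_on UNIV B" "continuous_on UNIV g" "continuous_on UNIV Bx"
    and dB: "\<And>y x. ((\<lambda>x. B (y, x)) has_real_derivative Bx (y, x)) (at x)"
    and transversal: "\<And>z. B z = 0 \<Longrightarrow> g z \<ge> 0 \<Longrightarrow> Bx z > 0"
    and exits: "\<And>z. B z = 0 \<Longrightarrow> g z = 0 \<Longrightarrow> \<exists>By gy gx.
      (B has_derivative (\<lambda>h. By * fst h + Bx z * snd h)) (at z) \<and>
      (g has_derivative (\<lambda>h. gy * fst h + gx * snd h)) (at z) \<and>
      d z = gy * Bx z - gx * By \<and> d z \<noteq> 0"
begin

definition inner_count :: "real \<Rightarrow> nat" where
  "inner_count y = card {x \<in> {0..<1}. B (y, x) = 0 \<and> g (y, x) > 0}"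

definition ends :: "real \<Rightarrow> real set \<Rightarrow> (real \<times> real) set" where
  "ends s Y = {(y, x). y \<in> Y \<and> x \<in> {0..<1} \<and> B (y, x) = 0 \<and> g (y, x) = 0 \<and> sgn (d (y, x)) = s}"

lemma periodic_level:
  "B (y, x + of_int n) = B (y, x)" "g (y, x + of_int n) = g (y, x)" "d (y, x + of_int n) = d (y, x)"
  using per[of y 0 x n] by simp_all

lemma closed_region: "closed {z. B z = 0 \<and> g z \<ge> 0}"
  using cont by (intro closed_Collect_conj closed_Collect_eq closed_Collect_le continuous_intros)

lemma isolated_in_level:
  assumes "B (y, x) = 0" "g (y, x) \<ge> 0"
  shows "\<exists>e>0. \<forall>u. \<bar>u - x\<bar> < e \<longrightarrow> B (y, u) = 0 \<longrightarrow> u = x"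
proof -
  obtain r \<xi> where r: "0 < r" "\<xi> y = x"
    "\<forall>\<^sub>F y' in nhds y. B (y', \<xi> y') = 0 \<and> \<bar>\<xi> y' - x\<bar> < r \<and>
       (\<forall>u. \<bar>u - x\<bar> \<le> r \<longrightarrow> B (y', u) = 0 \<longrightarrow> u = \<xi> y')"
    by (rule implicit_zero[OF cont(1) cont(3) dB assms(1) transversal[OF assms] zero_less_one])
  from eventually_nhds_x_imp_x[OF r(3)] r(1,2) show ?thesis
    by (intro exI[of _ r]) auto
qed

lemma finite_level: "finite {x \<in> {a..b}. B (y, x) = 0 \<and> g (y, x) \<ge> 0}" (is "finite ?R")
proof (rule ccontr)
  assume "infinite ?R"
  moreover have "?R \<subseteq> {a..b}" by auto
  ultimately obtain x where x: "x \<in> {a..b}" "x islimpt ?R"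
    using compact_eq_Bolzano_Weierstrass[of "{a..b}"] by (meson compact_Icc)
  have "continuous_on UNIV (\<lambda>x. (y, x))" by (intro continuous_intros)
  then have "closed ((\<lambda>x. (y, x)) -` {z. B z = 0 \<and> g z \<ge> 0} \<inter> {a..b})"
    using closed_region by (intro closed_Int closed_vimage) auto
  moreover have "(\<lambda>x. (y, x)) -` {z. B z = 0 \<and> g z \<ge> 0} \<inter> {a..b} = ?R" by auto
  ultimately have "x \<in> ?R" using x(2) closed_limpt by metis
  then obtain e where e: "e > 0" "\<And>u. \<bar>u - x\<bar> < e \<Longrightarrow> B (y, u) = 0 \<Longrightarrow> u = x"
    using isolated_in_level[of y x] by blast
  obtain u where "u \<in> ?R" "u \<noteq> x" "dist u x < e"
    using x(2) e(1) unfolding islimpt_approachable by blast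
  with e(2)[of u] show False by (auto simp: dist_real_def)
qed

lemma finite_ends_level: "finite (ends s {y})"
proof (rule finite_subset)
  show "ends s {y} \<subseteq> Pair y ` {x \<in> {0..1}. B (y, x) = 0 \<and> g (y, x) \<ge> 0}"
    by (auto simp: ends_def)
qed (intro finite_imageI finite_level)

text \<open>The window \<open>[c, c + 1)\<close> is chosen so that no zero enters or leaves it near the level \<open>y\<^sub>0\<close>;
  every zero in it then moves along an implicit function.\<close>

lemma inner_count_jump:
  "\<forall>\<^sub>F y in at y0. inner_count y = inner_count y0 + card (ends (sgn (y - y0)) {y0}) \<and>
     (\<forall>s. ends s {y} = {})"
proof -
  \<comment> \<open>Only finitely many points have to be avoided, and by periodicity
    \<open>c + 1\<close> avoids them together with \<open>c\<close>.\<close>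
  have "infinite ({0..1} - {x \<in> {0..1::real}. B (y0, x) = 0 \<and> g (y0, x) \<ge> 0})"
    using finite_level[of 0 1 y0] by (simp add: infinite_Icc Diff_infinite_finite)
  then obtain c where "c \<in> {0..1} - {x \<in> {0..1::real}. B (y0, x) = 0 \<and> g (y0, x) \<ge> 0}"
    using infinite_imp_nonempty by blast
  then have c: "\<not> (B (y0, c) = 0 \<and> g (y0, c) \<ge> 0)" by auto
  then have c1: "\<not> (B (y0, c + 1) = 0 \<and> g (y0, c + 1) \<ge> 0)"
    using periodic_level[of y0 c 1] by simp
  define Z where "Z = {x \<in> {c..c + 1}. B (y0, x) = 0 \<and> g (y0, x) \<ge> 0}"
  have fZ: "finite Z" unfolding Z_def by (rule finite_level)
  have Zc: "x \<in> {c<..<c + 1}" if "x \<in> Z" for x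
    using that c c1 by (cases "x = c"; cases "x = c + 1") (auto simp: Z_def)
  \<comment> \<open>Half the distance to the nearest other zero or end of the window: open intervals
    of this radius around the zeros are disjoint and stay inside the window.\<close>
  define gap where "gap x = Min (insert (x - c) (insert (c + 1 - x) ((\<lambda>x'. \<bar>x - x'\<bar>) ` (Z - {x})))) / 2" for x
  have gap: "gap x > 0" "\<And>u. \<bar>u - x\<bar> < gap x \<Longrightarrow> u \<in> {c<..<c + 1}" if "x \<in> Z" for x
  proof -
    have "0 < Min (insert (x - c) (insert (c + 1 - x) ((\<lambda>x'. \<bar>x - x'\<bar>) ` (Z - {x}))))"
      using Zc[OF that] fZ by (subst Min_gr_iff) auto
    then show "gap x > 0" by (simp add: gap_def)
    have m: "Min (insert (x - c) (insert (c + 1 - x) ((\<lambda>x'. \<bar>x - x'\<bar>) ` (Z - {x})))) \<le> x - c"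
      "Min (insert (x - c) (insert (c + 1 - x) ((\<lambda>x'. \<bar>x - x'\<bar>) ` (Z - {x})))) \<le> c + 1 - x"
      by (rule Min_le; use fZ in simp)+
    show "u \<in> {c<..<c + 1}" if "\<bar>u - x\<bar> < gap x" for u
    proof -
      have "2 * gap x \<le> x - c \<and> 2 * gap x \<le> c + 1 - x"
        unfolding gap_def by (simp only: times_divide_eq_right nonzero_mult_div_cancel_left
          zero_neq_numeral not_False_eq_True m simp_thms)
      then have "2 * gap x \<le> x - c" "2 * gap x \<le> c + 1 - x" by blast+
      with that \<open>gap x > 0\<close> have "u > c" "u < c + 1" by linarith+
      then show ?thesis by simp
    qed
  qed
  have sep: "gap x \<le> \<bar>x - x'\<bar> / 2" if "x \<in> Z" "x' \<in> Z" "x \<noteq> x'" for x x'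
    unfolding gap_def using that fZ by (intro divide_right_mono Min_le) auto
  define tracks where "tracks x r \<xi> \<longleftrightarrow> 0 < r \<and> r \<le> gap x \<and> \<xi> y0 = x \<and> (\<xi> \<longlongrightarrow> x) (at y0) \<and>
    (\<forall>\<^sub>F y in nhds y0. B (y, \<xi> y) = 0 \<and> \<bar>\<xi> y - x\<bar> < r \<and>
       (\<forall>u. \<bar>u - x\<bar> \<le> r \<longrightarrow> B (y, u) = 0 \<longrightarrow> u = \<xi> y))" for x r \<xi>
  have "\<exists>r \<xi>. tracks x r \<xi>" if x: "x \<in> Z" for x
  proof -
    have "B (y0, x) = 0" "Bx (y0, x) > 0" using transversal x by (auto simp: Z_def)
    then show ?thesis
    proof (rule implicit_zero[OF cont(1) cont(3) dB _ _ gap(1)[OF x]])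
      fix r \<xi>
      assume "0 < r" "r \<le> gap x" "\<xi> y0 = x" "(\<xi> \<longlongrightarrow> x) (at y0)"
        "\<forall>\<^sub>F y in nhds y0. B (y, \<xi> y) = 0 \<and> \<bar>\<xi> y - x\<bar> < r \<and>
          (\<forall>u. \<bar>u - x\<bar> \<le> r \<longrightarrow> B (y, u) = 0 \<longrightarrow> u = \<xi> y)"
      then have "tracks x r \<xi>" unfolding tracks_def by (intro conjI)
      then show ?thesis by blast
    qed
  qed
  then obtain r \<xi> where tracks: "\<And>x. x \<in> Z \<Longrightarrow> tracks x (r x) (\<xi> x)"
    by metis
  note r = tracks[unfolded tracks_def, THEN conjunct1]
    tracks[unfolded tracks_def, THEN conjunct2, THEN conjunct1]
  note \<xi> = tracks[unfolded tracks_def, THEN conjunct2, THEN conjunct2, THEN conjunct1]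
    tracks[unfolded tracks_def, THEN conjunct2, THEN conjunct2, THEN conjunct2, THEN conjunct1]
    tracks[unfolded tracks_def, THEN conjunct2, THEN conjunct2, THEN conjunct2, THEN conjunct2]
  have \<xi>_ev: "\<forall>\<^sub>F y in at y0. \<forall>x\<in>Z. B (y, \<xi> x y) = 0 \<and> \<bar>\<xi> x y - x\<bar> < r x \<and>
       (\<forall>u. \<bar>u - x\<bar> \<le> r x \<longrightarrow> B (y, u) = 0 \<longrightarrow> u = \<xi> x y)"
  proof (rule eventually_ball_finite[OF fZ], rule ballI)
    fix x assume "x \<in> Z"
    from \<xi>(3)[OF this] show "\<forall>\<^sub>F y in at y0. B (y, \<xi> x y) = 0 \<and> \<bar>\<xi> x y - x\<bar> < r x \<and>
       (\<forall>u. \<bar>u - x\<bar> \<le> r x \<longrightarrow> B (y, u) = 0 \<longrightarrow> u = \<xi> x y)"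
      unfolding eventually_nhds_conv_at by (rule conjunct1)
  qed
  \<comment> \<open>Off the intervals the level \<open>y0\<close> has no zero in the region; by
    compactness neighbouring levels have none there either, so no zero is born away from the
    branches.\<close>
  define K where "K = {c..c + 1} - (\<Union>x\<in>Z. ball x (r x))"
  have "compact K" unfolding K_def by (intro compact_diff open_UN) auto
  moreover have "open (- {z. B z = 0 \<and> g z \<ge> 0})" using closed_region by (simp add: open_closed)
  moreover have "{y0} \<times> K \<subseteq> - {z. B z = 0 \<and> g z \<ge> 0}"
    using r(1) by (force simp: K_def Z_def)
  ultimately obtain Y where Y: "y0 \<in> Y" "open Y" "Y \<times> K \<subseteq> - {z. B z = 0 \<and> g z \<ge> 0}"
    using Elementary_Topology.tube_lemma[of K "- {z. B z = 0 \<and> g z \<ge> 0}" y0] by blast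
  have Y_ev: "\<forall>\<^sub>F y in at y0. \<forall>x\<in>K. \<not> (B (y, x) = 0 \<and> g (y, x) \<ge> 0)"
    unfolding eventually_at_topological using Y by blast
  \<comment> \<open>A branch that starts in the interior stays there; one that starts on the
    boundary is inside exactly on the side of \<open>y0\<close> given by the sign of
    \<open>d\<close>.\<close>
  have sgn_ev: "\<forall>\<^sub>F y in at y0. g (y, \<xi> x y) \<noteq> 0 \<and>
      (g (y, \<xi> x y) > 0 \<longleftrightarrow> g (y0, x) > 0 \<or> g (y0, x) = 0 \<and> sgn (d (y0, x)) = sgn (y - y0))"
    if x: "x \<in> Z" for x
  proof (cases "g (y0, x) = 0")
    case False
    then have "g (y0, x) > 0" using x by (auto simp: Z_def)
    moreover have "((\<lambda>y. g (y, \<xi> x y)) \<longlongrightarrow> g (y0, x)) (at y0)"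
    proof -
      have "isCont g (y0, x)" using cont(2) by (simp add: continuous_on_eq_continuous_at)
      moreover have "((\<lambda>y. (y, \<xi> x y)) \<longlongrightarrow> (y0, x)) (at y0)"
        using \<xi>(2)[OF x] by (intro tendsto_intros)
      ultimately show ?thesis by (rule isCont_tendsto_compose)
    qed
    ultimately have "\<forall>\<^sub>F y in at y0. g (y, \<xi> x y) > 0" by (metis order_tendstoD(1))
    then show ?thesis by eventually_elim (use \<open>g (y0, x) > 0\<close> in auto)
  next
    case True
    have B0: "B (y0, x) = 0" using x by (simp add: Z_def)
    from exits[OF this True] obtain By gy gx where
      e: "(B has_derivative (\<lambda>h. By * fst h + Bx (y0, x) * snd h)) (at (y0, x))"
      "(g has_derivative (\<lambda>h. gy * fst h + gx * snd h)) (at (y0, x))"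
      "d (y0, x) = gy * Bx (y0, x) - gx * By" "d (y0, x) \<noteq> 0" by blast
    have "\<forall>\<^sub>F y in at y0. sgn (g (y, \<xi> x y)) = sgn (d (y0, x)) * sgn (y - y0)"
      unfolding e(3)
    proof (rule sgn_along_implicit_zero[OF e(1,2) B0 True _ _ \<xi>(2)[OF x]])
      show "0 < Bx (y0, x)" using transversal B0 True by auto
      show "gy * Bx (y0, x) - gx * By \<noteq> 0" using e by simp
      show "\<forall>\<^sub>F y in at y0. B (y, \<xi> x y) = 0"
        using \<xi>_ev by eventually_elim (use x in auto)
    qed
    moreover have "\<forall>\<^sub>F y in at y0. y \<noteq> y0" by (simp add: eventually_at_filter)
    ultimately show ?thesis
      by eventually_elim (use True e(4) in \<open>auto simp: sgn_if split: if_splits\<close>)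
  qed
  then have sgn_ev: "\<forall>\<^sub>F y in at y0. \<forall>x\<in>Z. g (y, \<xi> x y) \<noteq> 0 \<and>
      (g (y, \<xi> x y) > 0 \<longleftrightarrow> g (y0, x) > 0 \<or> g (y0, x) = 0 \<and> sgn (d (y0, x)) = sgn (y - y0))"
    by (intro eventually_ball_finite[OF fZ] ballI)
  have card_window: "card {x \<in> {c..<c + 1}. P x} = card {x \<in> {0..<1}. P x}"
    if "\<And>x (n::int). P (x + of_int n) = P x" for P
    using bij_betw_frac_window[of P c, OF that] by (rule bij_betw_same_card)
  show ?thesis using \<xi>_ev Y_ev sgn_ev
  proof eventually_elim
    case (elim y)
    have zero_ex: "\<exists>x\<in>Z. u = \<xi> x y" if u: "u \<in> {c..<c + 1}" "B (y, u) = 0" "g (y, u) \<ge> 0" for u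
    proof -
      have "u \<notin> K" using elim(2) u by auto
      then obtain x where x: "x \<in> Z" "\<bar>u - x\<bar> < r x"
        using u by (auto simp: K_def dist_real_def abs_minus_commute)
      then show ?thesis using elim(1) u by (intro bexI[of _ x]) auto
    qed
    have inj: "inj_on (\<lambda>x. \<xi> x y) Z"
    proof (rule inj_onI, rule ccontr)
      fix x x' assume x: "x \<in> Z" "x' \<in> Z" "\<xi> x y = \<xi> x' y" "x \<noteq> x'"
      then have "\<bar>\<xi> x y - x\<bar> < r x" "\<bar>\<xi> x' y - x'\<bar> < r x'" using elim(1) by auto
      moreover have "r x \<le> \<bar>x - x'\<bar> / 2" "r x' \<le> \<bar>x - x'\<bar> / 2"
        using sep[of x x'] sep[of x' x] r(2) x by (force simp: abs_minus_commute)+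
      ultimately show False using x(3) by (simp add: abs_if split: if_splits)
    qed
    have in_window: "\<xi> x y \<in> {c..<c + 1}" if "x \<in> Z" for x
      using gap(2)[OF that, of "\<xi> x y"] elim(1) r(2) that by force
    have "ends s {y} = {}" for s
    proof (rule ccontr)
      assume "ends s {y} \<noteq> {}"
      then obtain x where x: "B (y, x) = 0" "g (y, x) = 0" by (auto simp: ends_def)
      define u where "u = c + frac (x - c)"
      have u: "u = x + of_int (- \<lfloor>x - c\<rfloor>)" by (simp add: u_def frac_def)
      have "u \<in> {c..<c + 1}" using frac_lt_1 frac_ge_0 by (simp add: u_def)
      moreover have "B (y, u) = 0" "g (y, u) = 0" using x unfolding u periodic_level by auto
      ultimately show False using zero_ex[of u] elim(3) by auto
    qed
    moreover have "inner_count y = inner_count y0 + card (ends (sgn (y - y0)) {y0})"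
    proof -
      have "inner_count y = card {x \<in> {c..<c + 1}. B (y, x) = 0 \<and> g (y, x) > 0}"
        unfolding inner_count_def by (rule card_window[symmetric]) (simp add: periodic_level)
      also have "{x \<in> {c..<c + 1}. B (y, x) = 0 \<and> g (y, x) > 0} = (\<lambda>x. \<xi> x y) ` {x \<in> Z. g (y, \<xi> x y) > 0}"
        using zero_ex in_window elim(1) by force
      also have "card \<dots> = card {x \<in> Z. g (y, \<xi> x y) > 0}"
        by (intro card_image inj_on_subset[OF inj]) auto
      also have "{x \<in> Z. g (y, \<xi> x y) > 0} =
          {x \<in> Z. g (y0, x) > 0} \<union> {x \<in> Z. g (y0, x) = 0 \<and> sgn (d (y0, x)) = sgn (y - y0)}"
        using elim(3) by auto
      also have "card \<dots> = card {x \<in> Z. g (y0, x) > 0} +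
          card {x \<in> Z. g (y0, x) = 0 \<and> sgn (d (y0, x)) = sgn (y - y0)}"
        using fZ by (intro card_Un_disjoint) auto
      also have "{x \<in> Z. g (y0, x) > 0} = {x \<in> {c..<c + 1}. B (y0, x) = 0 \<and> g (y0, x) > 0}"
        using Zc by (force simp: Z_def)
      also have "card \<dots> = inner_count y0"
        unfolding inner_count_def by (rule card_window) (simp add: periodic_level)
      also have "{x \<in> Z. g (y0, x) = 0 \<and> sgn (d (y0, x)) = sgn (y - y0)} =
          {x \<in> {c..<c + 1}. B (y0, x) = 0 \<and> g (y0, x) = 0 \<and> sgn (d (y0, x)) = sgn (y - y0)}"
        using Zc by (force simp: Z_def)
      also have "card \<dots> = card {x \<in> {0..<1}. B (y0, x) = 0 \<and> g (y0, x) = 0 \<and> sgn (d (y0, x)) = sgn (y - y0)}"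
        by (rule card_window) (simp add: periodic_level)
      also have "\<dots> = card (Pair y0 ` {x \<in> {0..<1}. B (y0, x) = 0 \<and> g (y0, x) = 0 \<and> sgn (d (y0, x)) = sgn (y - y0)})"
        by (intro card_image[symmetric] inj_onI) auto
      also have "Pair y0 ` {x \<in> {0..<1}. B (y0, x) = 0 \<and> g (y0, x) = 0 \<and> sgn (d (y0, x)) = sgn (y - y0)}
          = ends (sgn (y - y0)) {y0}"
        by (auto simp: ends_def)
      finally show ?thesis .
    qed
    ultimately show ?case by blast
  qed
qed

text \<open>Boundary points have \<open>g = 0\<close> and are not counted themselves. A zero
  entering at level \<open>y0\<close> is counted only strictly above \<open>y0\<close>, one leaving
  only strictly below; hence \<open>{a..<b}\<close> for the former and \<open>{a<..b}\<close> for
  the latter. Both sides are additive over adjoining intervals, so \<open>Bolzano\<close> reduces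
  the claim to short ones.\<close>

lemma inner_count_change:
  assumes "a \<le> b"
  shows "(\<forall>s. finite (ends s {a..b})) \<and>
    int (inner_count b) - int (inner_count a) = int (card (ends 1 {a..<b})) - int (card (ends (- 1) {a<..b}))"
  using assms
proof (induction rule: Bolzano)
  case (trans a b c)
  have U: "ends s {a..c} = ends s {a..b} \<union> ends s {b..c}" for s
    using trans by (auto simp: ends_def)
  have fin: "finite (ends s Y)" if "Y \<subseteq> {a..c}" for s Y
  proof (rule finite_subset)
    show "ends s Y \<subseteq> ends s {a..c}" using that by (auto simp: ends_def)
    show "finite (ends s {a..c})" unfolding U using trans by auto
  qed
  have "ends 1 {a..<c} = ends 1 {a..<b} \<union> ends 1 {b..<c}"
    "ends (- 1) {a<..c} = ends (- 1) {a<..b} \<union> ends (- 1) {b<..c}"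
    using trans by (auto simp: ends_def)
  moreover have "card (ends 1 {a..<b} \<union> ends 1 {b..<c}) = card (ends 1 {a..<b}) + card (ends 1 {b..<c})"
    "card (ends (- 1) {a<..b} \<union> ends (- 1) {b<..c}) = card (ends (- 1) {a<..b}) + card (ends (- 1) {b<..c})"
    using trans by (intro card_Un_disjoint fin; force simp: ends_def)+
  ultimately show ?case using trans fin by auto
next
  case (local y0)
  from inner_count_jump[of y0] obtain \<epsilon> where \<epsilon>: "\<epsilon> > 0"
    "\<And>y. y \<noteq> y0 \<Longrightarrow> \<bar>y - y0\<bar> < \<epsilon> \<Longrightarrow>
      inner_count y = inner_count y0 + card (ends (sgn (y - y0)) {y0}) \<and> (\<forall>s. ends s {y} = {})"
    unfolding eventually_at dist_real_def by blast
  show ?case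
  proof (intro exI[of _ \<epsilon>] conjI[OF \<epsilon>(1)] allI impI)
    fix a b assume ab: "a \<le> y0 \<and> y0 \<le> b \<and> b - a < \<epsilon>"
    have near: "ends s Y = (if y0 \<in> Y then ends s {y0} else {})" if "Y \<subseteq> {a..b}" for Y s
    proof -
      have "ends s {y} = {}" if "y \<in> Y" "y \<noteq> y0" for y
        using \<epsilon>(2)[of y] that \<open>Y \<subseteq> {a..b}\<close> ab by fastforce
      then show ?thesis by (auto simp: ends_def)
    qed
    have sub: "{a..<b} \<subseteq> {a..b}" "{a<..b} \<subseteq> {a..b}" by auto
    have "finite (ends s {a..b})" for s
      using near[of "{a..b}"] finite_ends_level by auto
    moreover have "int (inner_count b) - int (inner_count y0) = (if y0 < b then int (card (ends 1 {y0})) else 0)"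
      using \<epsilon>(2)[of b] ab by auto
    moreover have "int (inner_count a) - int (inner_count y0) = (if a < y0 then int (card (ends (- 1) {y0})) else 0)"
      using \<epsilon>(2)[of a] ab by auto
    moreover have "ends 1 {a..<b} = (if y0 < b then ends 1 {y0} else {})"
      "ends (- 1) {a<..b} = (if a < y0 then ends (- 1) {y0} else {})"
      using near[OF sub(1), of 1] near[OF sub(2), of "- 1"] ab by simp_all
    ultimately show "(\<forall>s. finite (ends s {a..b})) \<and> int (inner_count b) - int (inner_count a) =
        int (card (ends 1 {a..<b})) - int (card (ends (- 1) {a<..b}))"
      by auto
  qed
qed

text \<open>The inner count agrees on the levels 0 and 1, so over a period as many zeros enter as
  leave. Moving the ends at level 1 to level 0 puts both counts on the same half-open
  period.\<close>

lemma ends_balance: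
  "finite (ends s {0..<1})" "card (ends 1 {0..<1}) = card (ends (- 1) {0..<1})"
proof -
  have fin: "finite (ends s Y)" if "Y \<subseteq> {0..1}" for s Y
  proof (rule finite_subset)
    show "ends s Y \<subseteq> ends s {0..1}" using that by (auto simp: ends_def)
    show "finite (ends s {0..1})" using inner_count_change[of 0 1] by simp
  qed
  show "finite (ends s {0..<1})" by (rule fin) auto
  have shift: "B (1, x) = B (0, x)" "g (1, x) = g (0, x)" "d (1, x) = d (0, x)" for x
    using per[of 0 1 x 0] by simp_all
  have "inner_count 1 = inner_count 0" by (simp add: inner_count_def shift)
  then have "card (ends 1 {0..<1}) = card (ends (- 1) {0<..1})"
    using inner_count_change[of 0 1] by simp
  also have "\<dots> = card (ends (- 1) {0<..<1} \<union> ends (- 1) {1})"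
    by (rule arg_cong[of _ _ card]) (auto simp: ends_def)
  also have "\<dots> = card (ends (- 1) {0<..<1}) + card (ends (- 1) {1})"
    by (intro card_Un_disjoint fin) (auto simp: ends_def)
  also have "ends (- 1) {1} = apfst (\<lambda>_. 1) ` ends (- 1) {0}"
    by (force simp: ends_def shift image_iff)
  also have "card \<dots> = card (ends (- 1) {0})"
    by (intro card_image inj_onI) (auto simp: ends_def)
  also have "card (ends (- 1) {0<..<1}) + card (ends (- 1) {0}) = card (ends (- 1) {0<..<1} \<union> ends (- 1) {0})"
    by (intro card_Un_disjoint[symmetric] fin) (auto simp: ends_def)
  also have "ends (- 1) {0<..<1} \<union> ends (- 1) {0} = ends (- 1) {0..<1}"
    by (auto simp: ends_def)
  finally show "card (ends 1 {0..<1}) = card (ends (- 1) {0..<1})" .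
qed

end

section \<open>Flux through a region of the torus, and summation over the sign quadrants\<close>

section \<open>Balance of boundary points\<close>

definition periodic2 :: "(real \<times> real \<Rightarrow> 'a) \<Rightarrow> bool" where
  "periodic2 F \<longleftrightarrow> (\<forall>p q (m::int) (n::int). F (p + of_int m, q + of_int n) = F (p, q))"

lemma periodic2D: "periodic2 F \<Longrightarrow> F (p + of_int m, q + of_int n) = F (p, q)"
  by (simp add: periodic2_def)

text \<open>The levels are those of \<open>y = s1 * p + s2 * q\<close>. In the direction
  \<open>(Aq, - Ap)\<close> of the zero curve, \<open>y\<close> grows at the rate
  \<open>s1 * Aq - s2 * Ap\<close>, positive by \<open>transversal\<close>, and \<open>W\<close> is
  the rate of \<open>f\<close>. Passing from \<open>(y, x)\<close> to \<open>(p, q)\<close> is an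
  integer linear map of determinant 1 or -1, hence a bijection of the torus.\<close>

lemma torus_flux:
  fixes A f Ap Aq W :: "real \<times> real \<Rightarrow> real" and s1 s2 :: real
  assumes s: "s1 \<in> {1, -1}" "s2 \<in> {1, -1}"
    and per: "periodic2 A" "periodic2 f" "periodic2 W"
    and dA: "\<And>z. (A has_derivative (\<lambda>h. Ap z * fst h + Aq z * snd h)) (at z)"
    and cont: "continuous_on UNIV Ap" "continuous_on UNIV Aq" "continuous_on UNIV f"
    and transversal: "\<And>z. A z = 0 \<Longrightarrow> f z \<ge> 0 \<Longrightarrow> s1 * Aq z - s2 * Ap z > 0"
    and exits: "\<And>z. A z = 0 \<Longrightarrow> f z = 0 \<Longrightarrow> \<exists>fp fq.
      (f has_derivative (\<lambda>h. fp * fst h + fq * snd h)) (at z) \<and> W z = fp * Aq z - fq * Ap z \<and> W z \<noteq> 0"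
  defines "E \<equiv> {z \<in> params \<times> params. A z = 0 \<and> f z = 0}"
  shows "finite E" "(\<Sum>z\<in>E. sgn (W z)) = 0"
proof -
  define \<phi> :: "real \<times> real \<Rightarrow> real \<times> real" where "\<phi> = (\<lambda>(y, x). (s1 * (y - s2 * x), x))"
  \<comment> \<open>The factor \<open>s1\<close> compensates the determinant of the substitution:
    the Jacobian of \<open>f\<close> and \<open>B\<close> in the new coordinates is again
    \<open>W\<close>.\<close>
  define B where "B z = s1 * A (\<phi> z)" for z
  define Bx where "Bx z = s1 * Aq (\<phi> z) - s2 * Ap (\<phi> z)" for z
  have ss: "s1 * s1 = 1" "s2 * s2 = 1" "s1 \<noteq> 0" using s by auto
  have \<phi>_cont: "continuous_on UNIV \<phi>"
    unfolding \<phi>_def case_prod_unfold by (intro continuous_intros)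
  have \<phi>_deriv: "(\<phi> has_derivative (\<lambda>h. (s1 * (fst h - s2 * snd h), snd h))) (at z)" for z
    unfolding \<phi>_def case_prod_unfold by (auto intro!: derivative_eq_intros)
  have pull: "((\<lambda>z. F (\<phi> z)) has_derivative
      (\<lambda>h. (s1 * a) * fst h + (b - s1 * s2 * a) * snd h)) (at z)"
    if "(F has_derivative (\<lambda>h. a * fst h + b * snd h)) (at (\<phi> z))" for F :: "real \<times> real \<Rightarrow> real" and a b z
    using has_derivative_compose[OF \<phi>_deriv that]
    by (rule has_derivative_eq_rhs) (simp add: fun_eq_iff algebra_simps)
  have A_cont: "continuous_on UNIV A"
    using dA by (meson has_derivative_continuous continuous_at_imp_continuous_on)
  obtain k1 k2 :: int where k: "s1 = of_int k1" "s2 = of_int k2"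
    using s by (metis insertE of_int_1 of_int_minus singletonD)
  have shift: "F (\<phi> (y + of_int m, x + of_int n)) = F (\<phi> (y, x))" if "periodic2 F"
    for F :: "real \<times> real \<Rightarrow> real" and y x m n
  proof -
    have "\<phi> (y + of_int m, x + of_int n) =
        (fst (\<phi> (y, x)) + of_int (k1 * (m - k2 * n)), snd (\<phi> (y, x)) + of_int n)"
      unfolding \<phi>_def k by (simp add: algebra_simps)
    then show ?thesis by (simp only: periodic2D[OF that] prod.collapse)
  qed
  have dB: "(B has_derivative (\<lambda>h. Ap (\<phi> z) * fst h + Bx z * snd h)) (at z)" for z
  proof -
    have "((\<lambda>z. s1 * A (\<phi> z)) has_derivative
      (\<lambda>h. s1 * ((s1 * Ap (\<phi> z)) * fst h + (Aq (\<phi> z) - s1 * s2 * Ap (\<phi> z)) * snd h))) (at z)"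
      by (intro has_derivative_mult_right pull dA)
    then show ?thesis
      unfolding B_def
      by (rule has_derivative_eq_rhs)
         (use s in \<open>auto simp: fun_eq_iff Bx_def algebra_simps\<close>)
  qed
  interpret lf: level_flow B "\<lambda>z. f (\<phi> z)" Bx "\<lambda>z. W (\<phi> z)"
  proof
    show "continuous_on UNIV B"
      unfolding B_def by (intro continuous_intros continuous_on_compose2[OF A_cont \<phi>_cont]) auto
    show "continuous_on UNIV (\<lambda>z. f (\<phi> z))"
      by (intro continuous_on_compose2[OF cont(3) \<phi>_cont]) auto
    show "continuous_on UNIV Bx"
      unfolding Bx_def
      by (intro continuous_intros continuous_on_compose2[OF cont(1) \<phi>_cont] continuous_on_compose2[OF cont(2) \<phi>_cont]) auto
    show "((\<lambda>x. B (y, x)) has_real_derivative Bx (y, x)) (at x)" for y x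
    proof -
      have "(Pair y has_derivative (\<lambda>h. (0, h))) (at x)"
        by (auto intro!: derivative_eq_intros)
      from has_derivative_compose[OF this dB]
      show ?thesis
        unfolding has_field_derivative_def by (rule has_derivative_eq_rhs) (simp add: fun_eq_iff)
    qed
    show "Bx z > 0" if "B z = 0" "f (\<phi> z) \<ge> 0" for z
      using transversal[of "\<phi> z"] that ss by (simp add: B_def Bx_def)
    show "\<exists>By gy gx. (B has_derivative (\<lambda>h. By * fst h + Bx z * snd h)) (at z) \<and>
        ((\<lambda>z. f (\<phi> z)) has_derivative (\<lambda>h. gy * fst h + gx * snd h)) (at z) \<and>
        W (\<phi> z) = gy * Bx z - gx * By \<and> W (\<phi> z) \<noteq> 0" if z: "B z = 0" "f (\<phi> z) = 0" for z
    proof -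
      from exits[of "\<phi> z"] z ss obtain fp fq where
        f: "(f has_derivative (\<lambda>h. fp * fst h + fq * snd h)) (at (\<phi> z))"
          "W (\<phi> z) = fp * Aq (\<phi> z) - fq * Ap (\<phi> z)" "W (\<phi> z) \<noteq> 0"
        by (auto simp: B_def)
      have "W (\<phi> z) = (s1 * fp) * Bx z - (fq - s1 * s2 * fp) * Ap (\<phi> z)"
        using s by (auto simp: f(2) Bx_def algebra_simps)
      then show ?thesis using dB pull[OF f(1)] f(3) by blast
    qed
  qed (simp_all add: B_def shift per)
  \<comment> \<open>The substitution does not carry the unit square to itself; reducing the first
    coordinate modulo 1 repairs this and changes none of the periodic functions.\<close>
  have E_sgn: "bij_betw (\<lambda>(y, x). (frac (fst (\<phi> (y, x))), x)) (lf.ends t {0..<1}) {z \<in> E. sgn (W z) = t}" for t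
  proof (rule bij_betw_imageI)
    have frac_fst: "F (frac (fst (\<phi> (y, x))), x) = F (\<phi> (y, x))" if "periodic2 F"
      for F :: "real \<times> real \<Rightarrow> real" and y x
      using periodic2D[OF that, of "fst (\<phi> (y, x))" "- \<lfloor>fst (\<phi> (y, x))\<rfloor>" x 0]
      by (simp add: frac_def \<phi>_def)
    show "inj_on (\<lambda>(y, x). (frac (fst (\<phi> (y, x))), x)) (lf.ends t {0..<1})"
    proof (rule inj_onI, clarsimp)
      fix y y' x
      assume y: "(y, x) \<in> lf.ends t {0..<1}" "(y', x) \<in> lf.ends t {0..<1}"
        and e: "frac (fst (\<phi> (y, x))) = frac (fst (\<phi> (y', x)))"
      define n where "n = k1 * (\<lfloor>fst (\<phi> (y, x))\<rfloor> - \<lfloor>fst (\<phi> (y', x))\<rfloor>)"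
      have "s1 * (y - y') = of_int (\<lfloor>fst (\<phi> (y, x))\<rfloor> - \<lfloor>fst (\<phi> (y', x))\<rfloor>)"
        using e by (simp add: frac_def \<phi>_def algebra_simps)
      then have "s1 * (s1 * (y - y')) = of_int n" by (simp add: n_def k)
      then have n: "y - y' = of_int n" using ss by (simp flip: mult.assoc)
      moreover have "\<bar>y - y'\<bar> < 1" using y by (auto simp: lf.ends_def)
      ultimately have "\<bar>n\<bar> < 1" by linarith
      with n show "y = y'" by simp
    qed
    show "(\<lambda>(y, x). (frac (fst (\<phi> (y, x))), x)) ` lf.ends t {0..<1} = {z \<in> E. sgn (W z) = t}"
    proof (intro equalityI subsetI)
      fix z assume "z \<in> (\<lambda>(y, x). (frac (fst (\<phi> (y, x))), x)) ` lf.ends t {0..<1}"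
      then obtain y x where yx: "(y, x) \<in> lf.ends t {0..<1}" "z = (frac (fst (\<phi> (y, x))), x)" by auto
      then show "z \<in> {z \<in> E. sgn (W z) = t}"
        using ss frac_lt_1 by (auto simp: E_def lf.ends_def params_def frac_fst[OF per(1)]
            frac_fst[OF per(2)] frac_fst[OF per(3)] B_def)
    next
      fix z assume "z \<in> {z \<in> E. sgn (W z) = t}"
      then obtain p q where z: "z = (p, q)" "p \<in> {0..<1}" "q \<in> {0..<1}" "A (p, q) = 0" "f (p, q) = 0" "sgn (W (p, q)) = t"
        by (auto simp: E_def params_def)
      define y where "y = frac (s1 * p + s2 * q)"
      have "fst (\<phi> (y, q)) = s1 * s1 * p - of_int (k1 * \<lfloor>s1 * p + s2 * q\<rfloor>)"
        unfolding \<phi>_def y_def frac_def by (simp add: algebra_simps k)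
      then have p: "fst (\<phi> (y, q)) = p - of_int (k1 * \<lfloor>s1 * p + s2 * q\<rfloor>)"
        using ss by simp
      then have fp: "frac (fst (\<phi> (y, q))) = p"
        using z by (simp add: frac_unique_iff)
      moreover have "(y, q) \<in> lf.ends t {0..<1}"
        using z frac_lt_1[of "s1 * p + s2 * q"] frac_fst[OF per(1), of y q] frac_fst[OF per(2), of y q]
          frac_fst[OF per(3), of y q] unfolding fp by (auto simp: lf.ends_def B_def y_def)
      ultimately show "z \<in> (\<lambda>(y, x). (frac (fst (\<phi> (y, x))), x)) ` lf.ends t {0..<1}"
        using z by force
    qed
  qed
  have fin: "finite {z \<in> E. sgn (W z) = t}" for t
    using lf.ends_balance(1) E_sgn bij_betw_finite by blast
  have E: "E = {z \<in> E. sgn (W z) = 1} \<union> {z \<in> E. sgn (W z) = - 1}"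
    using exits by (auto simp: E_def sgn_if)
  show "finite E" by (subst E) (simp add: fin)
  have "(\<Sum>z\<in>E. sgn (W z)) = (\<Sum>z\<in>{z \<in> E. sgn (W z) = 1}. sgn (W z)) + (\<Sum>z\<in>{z \<in> E. sgn (W z) = - 1}. sgn (W z))"
    by (subst E, rule sum.union_disjoint) (auto simp: fin)
  also have "\<dots> = real (card {z \<in> E. sgn (W z) = 1}) - real (card {z \<in> E. sgn (W z) = - 1})"
    by simp
  also have "\<dots> = 0"
    using lf.ends_balance(2) bij_betw_same_card[OF E_sgn] by simp
  finally show "(\<Sum>z\<in>E. sgn (W z)) = 0" .
qed

lemma has_derivative_min1:
  fixes h k :: "'a::real_normed_vector \<Rightarrow> real"
  assumes "(h has_derivative h') (at z)" "continuous_on UNIV h" "continuous_on UNIV k" "h z < k z"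
  shows "((\<lambda>w. min (h w) (k w)) has_derivative h') (at z)"
proof (rule has_derivative_transform_within_open[OF assms(1)])
  show "open {w. h w < k w}" using assms by (intro open_Collect_less)
qed (use assms in auto)

lemma has_derivative_min2:
  fixes h k :: "'a::real_normed_vector \<Rightarrow> real"
  assumes "(h has_derivative h') (at z)" "continuous_on UNIV h" "continuous_on UNIV k" "h z < k z"
  shows "((\<lambda>w. min (k w) (h w)) has_derivative h') (at z)"
  using has_derivative_min1[OF assms] by (simp add: min.commute)

text \<open>Common form of the plane case and of the two sign families of the projective case.
  \<open>G > 0\<close> selects the part of the curve \<open>A = 0\<close> to be counted; as
  \<open>G\<close> never vanishes on that curve, it contributes no boundary points.
  \<open>VD\<close>, \<open>VS\<close>, \<open>VC\<close> are the derivatives of \<open>D\<close>,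
  \<open>S\<close>, \<open>C\<close> in the direction \<open>(Aq, - Ap)\<close>. Genericity speaks
  of one period only, so what comes from it is assumed there and extended by periodicity.\<close>

locale pair_system =
  fixes A D S C G Ap Aq VD VS VC :: "real \<times> real \<Rightarrow> real" and \<delta> :: real
  assumes per: "periodic2 A" "periodic2 D" "periodic2 S" "periodic2 C" "periodic2 G"
      "periodic2 VD" "periodic2 VS" "periodic2 VC"
    and cont: "continuous_on UNIV Ap" "continuous_on UNIV Aq" "continuous_on UNIV G"
    and dA: "\<And>z. (A has_derivative (\<lambda>h. Ap z * fst h + Aq z * snd h)) (at z)"
    and dD: "\<And>z. \<exists>dp dq. (D has_derivative (\<lambda>h. dp * fst h + dq * snd h)) (at z) \<and> VD z = dp * Aq z - dq * Ap z"
    and dS: "\<And>z. \<exists>dp dq. (S has_derivative (\<lambda>h. dp * fst h + dq * snd h)) (at z) \<and> VS z = dp * Aq z - dq * Ap z"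
    and dC: "\<And>z. \<exists>dp dq. (C has_derivative (\<lambda>h. dp * fst h + dq * snd h)) (at z) \<and> VC z = dp * Aq z - dq * Ap z"
    and \<delta>: "\<delta> \<in> {1, -1}"
    and G_params: "\<And>z. z \<in> params \<times> params \<Longrightarrow> A z = 0 \<Longrightarrow> G z \<noteq> 0"
    and sgn_A: "\<And>z. A z = 0 \<Longrightarrow> G z > 0 \<Longrightarrow> sgn (Ap z) = - sgn (S z)"
      "\<And>z. A z = 0 \<Longrightarrow> G z > 0 \<Longrightarrow> sgn (Aq z) = \<delta> * sgn (D z)"
    and sgn_VD: "\<And>z. A z = 0 \<Longrightarrow> G z > 0 \<Longrightarrow> D z = 0 \<Longrightarrow> sgn (VD z) = \<delta> * sgn (S z)"
    and sgn_VS: "\<And>z. A z = 0 \<Longrightarrow> G z > 0 \<Longrightarrow> S z = 0 \<Longrightarrow> sgn (VS z) = - \<delta> * sgn (C z) * sgn (D z)"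
    and VC_params: "\<And>z. z \<in> params \<times> params \<Longrightarrow> A z = 0 \<Longrightarrow> G z > 0 \<Longrightarrow> C z = 0 \<Longrightarrow> VC z \<noteq> 0"
    and DS_params: "\<And>z. z \<in> params \<times> params \<Longrightarrow> A z = 0 \<Longrightarrow> G z > 0 \<Longrightarrow> D z = 0 \<Longrightarrow> S z \<noteq> 0"
    and DC_params: "\<And>z. z \<in> params \<times> params \<Longrightarrow> A z = 0 \<Longrightarrow> G z > 0 \<Longrightarrow> D z = 0 \<Longrightarrow> C z \<noteq> 0"
    and SC: "\<And>z. A z = 0 \<Longrightarrow> G z > 0 \<Longrightarrow> S z = 0 \<Longrightarrow> C z \<noteq> 0"
begin

definition pairs :: "(real \<times> real \<Rightarrow> bool) \<Rightarrow> (real \<times> real) set" where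
  "pairs P = {z \<in> params \<times> params. A z = 0 \<and> G z > 0 \<and> P z}"

text \<open>The direction in which the curve crosses \<open>C = 0\<close>, up to a factor that is
  constant on each quadrant of signs. For curves it turns out to be 1 at type 1 and -1 at type
  2.\<close>

definition nt_sign :: "real \<times> real \<Rightarrow> real" where
  "nt_sign z = \<delta> * sgn (S z) * sgn (D z) * sgn (VC z)"

lemma params_representative:
  obtains z' where "z' \<in> params \<times> params" "A z' = A z" "D z' = D z" "S z' = S z" "C z' = C z"
    "G z' = G z" "VC z' = VC z"
proof
  let ?z = "(frac (fst z), frac (snd z))"
  show "?z \<in> params \<times> params" by (simp add: params_def frac_lt_1)
  have "F ?z = F z" if "periodic2 F" for F :: "real \<times> real \<Rightarrow> real"
    using periodic2D[OF that, of "fst z" "- \<lfloor>fst z\<rfloor>" "snd z" "- \<lfloor>snd z\<rfloor>"] by (simp add: frac_def)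
  with per show "A ?z = A z" "D ?z = D z" "S ?z = S z" "C ?z = C z" "G ?z = G z" "VC ?z = VC z" by blast+
qed

lemma G: "A z = 0 \<Longrightarrow> G z \<noteq> 0"
  using params_representative[of z] G_params by metis

lemma VC: "A z = 0 \<Longrightarrow> G z > 0 \<Longrightarrow> C z = 0 \<Longrightarrow> VC z \<noteq> 0"
  using params_representative[of z] VC_params by metis

lemma DS: "A z = 0 \<Longrightarrow> G z > 0 \<Longrightarrow> D z = 0 \<Longrightarrow> S z \<noteq> 0"
  using params_representative[of z] DS_params by metis

lemma DC: "A z = 0 \<Longrightarrow> G z > 0 \<Longrightarrow> D z = 0 \<Longrightarrow> C z \<noteq> 0"
  using params_representative[of z] DC_params by metis

lemma continuous_data: "continuous_on UNIV A" "continuous_on UNIV D" "continuous_on UNIV S" "continuous_on UNIV C"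
proof -
  show "continuous_on UNIV A"
    using dA by (meson has_derivative_continuous continuous_at_imp_continuous_on)
  show "continuous_on UNIV D" "continuous_on UNIV S" "continuous_on UNIV C"
    using dD dS dC by (meson has_derivative_continuous continuous_at_imp_continuous_on)+
qed

text \<open>The signs of \<open>D\<close> and \<open>S\<close> determine those of \<open>Aq\<close>
  and \<open>Ap\<close>: with \<open>s1 = \<delta> * \<sigma>\<close> and
  \<open>s2 = \<omega>\<close> the rate \<open>s1 * Aq - s2 * Ap\<close> becomes
  \<open>\<bar>Aq\<bar> + \<bar>Ap\<bar>\<close>. It is positive because \<open>D\<close> and
  \<open>S\<close> do not vanish together. Other signs require another coordinate, hence one balance
  per quadrant.\<close>

lemma quadrant_flux:
  assumes "\<sigma> \<in> {1, -1}" "\<omega> \<in> {1, -1}" "\<tau> \<in> {1, -1}"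
  defines "XD \<equiv> pairs (\<lambda>z. D z = 0 \<and> \<omega> * S z > 0 \<and> \<tau> * C z > 0)"
    and "ZS \<equiv> pairs (\<lambda>z. S z = 0 \<and> \<sigma> * D z > 0 \<and> \<tau> * C z > 0)"
    and "NC \<equiv> pairs (\<lambda>z. C z = 0 \<and> \<sigma> * D z > 0 \<and> \<omega> * S z > 0)"
  shows "finite XD \<and> finite ZS \<and> finite NC \<and>
    (\<Sum>z\<in>NC. nt_sign z) = real (card ZS) - \<tau> * real (card XD)"
proof -
  \<comment> \<open>The minimum turns the region into one inequality. At a boundary point on the
    curve exactly one of \<open>D\<close>, \<open>S\<close>, \<open>C\<close> vanishes, so there are
    no corners and \<open>f\<close> agrees nearby with a single signed entry.\<close>
  define f where "f z = min (\<sigma> * D z) (min (\<omega> * S z) (min (\<tau> * C z) (G z)))" for z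
  define W where "W z = (if D z = 0 then \<sigma> * VD z else if S z = 0 then \<omega> * VS z else \<tau> * VC z)" for z
  define E where "E = {z \<in> params \<times> params. A z = 0 \<and> f z = 0}"
  have nz: "\<sigma> \<noteq> 0" "\<omega> \<noteq> 0" "\<tau> \<noteq> 0" "\<delta> \<noteq> 0" using assms(1-3) \<delta> by auto
  note cont_all = continuous_data cont(3)
  have f_ge: "f z \<ge> 0 \<Longrightarrow> A z = 0 \<Longrightarrow> \<sigma> * D z \<ge> 0 \<and> \<omega> * S z \<ge> 0 \<and> \<tau> * C z \<ge> 0 \<and> G z > 0" for z
    using G[of z] by (auto simp: f_def)
  have f_0: "f z = 0 \<and> A z = 0 \<longleftrightarrow> A z = 0 \<and> G z > 0 \<and>
      (D z = 0 \<and> \<omega> * S z > 0 \<and> \<tau> * C z > 0 \<or> S z = 0 \<and> \<sigma> * D z > 0 \<and> \<tau> * C z > 0 \<or>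
       C z = 0 \<and> \<sigma> * D z > 0 \<and> \<omega> * S z > 0)" for z
  proof (intro iffI)
    assume z: "f z = 0 \<and> A z = 0"
    with f_ge[of z] have ge: "\<sigma> * D z \<ge> 0" "\<omega> * S z \<ge> 0" "\<tau> * C z \<ge> 0" "G z > 0" by auto
    with z have "D z = 0 \<or> S z = 0 \<or> C z = 0"
      using nz by (auto simp: f_def min_def split: if_splits)
    moreover have "\<sigma> * D z > 0 \<or> D z = 0" "\<omega> * S z > 0 \<or> S z = 0" "\<tau> * C z > 0 \<or> C z = 0"
      using ge nz by (auto simp: order_le_less)
    ultimately show "A z = 0 \<and> G z > 0 \<and>
      (D z = 0 \<and> \<omega> * S z > 0 \<and> \<tau> * C z > 0 \<or> S z = 0 \<and> \<sigma> * D z > 0 \<and> \<tau> * C z > 0 \<or>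
       C z = 0 \<and> \<sigma> * D z > 0 \<and> \<omega> * S z > 0)"
      using z ge(4) DS[of z] DC[of z] SC[of z] by blast
  qed (auto simp: f_def)
  have flux: "finite E" "(\<Sum>z\<in>E. sgn (W z)) = 0"
  proof -
    have cf: "continuous_on UNIV f"
      unfolding f_def by (intro continuous_intros cont_all)
    have s: "\<delta> * \<sigma> \<in> {1, -1}" using \<delta> assms(1) by auto
    have pf: "periodic2 f" using per by (auto simp: periodic2_def f_def)
    have pW: "periodic2 W" using per by (auto simp: periodic2_def W_def)
    have tr: "\<delta> * \<sigma> * Aq z - \<omega> * Ap z > 0" if z: "A z = 0" "f z \<ge> 0" for z
    proof -
      from f_ge[OF z(2,1)] have ge: "\<sigma> * D z \<ge> 0" "\<omega> * S z \<ge> 0" "G z > 0" by auto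
      have abs_sgn: "r * x = \<bar>x\<bar>" if "r \<in> {1, -1}" "r * sgn x \<ge> 0" for r x :: real
        using that by (auto simp: sgn_if split: if_splits)
      have "sgn (\<sigma> * D z) \<ge> 0" "sgn (\<omega> * S z) \<ge> 0" using ge by auto
      then have "\<delta> * \<sigma> * sgn (Aq z) \<ge> 0" "- \<omega> * sgn (Ap z) \<ge> 0"
        using sgn_A[OF z(1) ge(3)] assms(1,2) \<delta> by (auto simp: sgn_mult)
      then have "\<delta> * \<sigma> * Aq z = \<bar>Aq z\<bar>" "- \<omega> * Ap z = \<bar>Ap z\<bar>"
        using abs_sgn[of "\<delta> * \<sigma>" "Aq z"] abs_sgn[of "- \<omega>" "Ap z"] s assms(2) by auto
      moreover have "Aq z \<noteq> 0 \<or> Ap z \<noteq> 0"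
        using sgn_A[OF z(1) ge(3)] DS[OF z(1) ge(3)] \<delta> by (auto simp: sgn_0_0)
      ultimately show ?thesis by auto
    qed
    have ex: "\<exists>fp fq. (f has_derivative (\<lambda>h. fp * fst h + fq * snd h)) (at z) \<and>
        W z = fp * Aq z - fq * Ap z \<and> W z \<noteq> 0" if z: "A z = 0" "f z = 0" for z
    proof -
      have lift: "\<exists>fp fq. (f has_derivative (\<lambda>h. fp * fst h + fq * snd h)) (at z) \<and>
          \<eta> * V = fp * Aq z - fq * Ap z \<and> \<eta> * V \<noteq> 0"
        if "(F has_derivative (\<lambda>h. dp * fst h + dq * snd h)) (at z)" "V = dp * Aq z - dq * Ap z"
          "\<eta> * V \<noteq> 0"
          "((\<lambda>z. \<eta> * F z) has_derivative (\<lambda>h. \<eta> * (dp * fst h + dq * snd h))) (at z) \<Longrightarrow>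
            (f has_derivative (\<lambda>h. \<eta> * (dp * fst h + dq * snd h))) (at z)" for F dp dq V \<eta>
      proof (intro exI conjI)
        show "(f has_derivative (\<lambda>h. (\<eta> * dp) * fst h + (\<eta> * dq) * snd h)) (at z)"
          using that(4)[OF has_derivative_mult_right[OF that(1)]] by (simp add: algebra_simps)
        show "\<eta> * V = (\<eta> * dp) * Aq z - (\<eta> * dq) * Ap z"
          unfolding that(2) by (simp add: algebra_simps)
      qed (fact that(3))
      from z f_0[of z] consider
          (D) "G z > 0" "D z = 0" "\<omega> * S z > 0" "\<tau> * C z > 0"
        | (S) "G z > 0" "S z = 0" "\<sigma> * D z > 0" "\<tau> * C z > 0"
        | (C) "G z > 0" "C z = 0" "\<sigma> * D z > 0" "\<omega> * S z > 0" by auto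
      then show ?thesis
      proof cases
        case D
        have "sgn (VD z) \<noteq> 0" using sgn_VD[OF z(1) D(1,2)] D nz by (auto simp: sgn_0_0)
        then have nz: "\<sigma> * VD z \<noteq> 0" using nz by (auto simp: sgn_0_0)
        obtain dp dq where d: "(D has_derivative (\<lambda>h. dp * fst h + dq * snd h)) (at z)"
          "VD z = dp * Aq z - dq * Ap z" using dD by blast
        have W: "W z = \<sigma> * VD z" using D by (simp add: W_def)
        have f: "(f has_derivative f') (at z)" if "((\<lambda>z. \<sigma> * D z) has_derivative f') (at z)" for f'
          unfolding f_def
          by (intro has_derivative_min1[OF that] continuous_intros cont_all) (use D in auto)
        show ?thesis unfolding W by (rule lift[OF d nz f])
      next
        case S
        have "sgn (VS z) \<noteq> 0" using sgn_VS[OF z(1) S(1,2)] S nz by (auto simp: sgn_0_0)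
        then have nz: "\<omega> * VS z \<noteq> 0" using nz by (auto simp: sgn_0_0)
        obtain dp dq where d: "(S has_derivative (\<lambda>h. dp * fst h + dq * snd h)) (at z)"
          "VS z = dp * Aq z - dq * Ap z" using dS by blast
        have W: "W z = \<omega> * VS z" using S by (auto simp: W_def)
        have f: "(f has_derivative f') (at z)" if "((\<lambda>z. \<omega> * S z) has_derivative f') (at z)" for f'
          unfolding f_def
          by (intro has_derivative_min2[OF has_derivative_min1[OF that]] continuous_intros cont_all) (use S in auto)
        show ?thesis unfolding W by (rule lift[OF d nz f])
      next
        case C
        have nz: "\<tau> * VC z \<noteq> 0" using VC[OF z(1) C(1,2)] nz by auto
        obtain dp dq where d: "(C has_derivative (\<lambda>h. dp * fst h + dq * snd h)) (at z)"
          "VC z = dp * Aq z - dq * Ap z" using dC by blast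
        have W: "W z = \<tau> * VC z" using C by (auto simp: W_def)
        have f: "(f has_derivative f') (at z)" if "((\<lambda>z. \<tau> * C z) has_derivative f') (at z)" for f'
          unfolding f_def
          by (intro has_derivative_min2[OF has_derivative_min2[OF has_derivative_min1[OF that]]] continuous_intros cont_all)
            (use C in auto)
        show ?thesis unfolding W by (rule lift[OF d nz f])
      qed
    qed
    show "finite E" "(\<Sum>z\<in>E. sgn (W z)) = 0"
      unfolding E_def by (rule torus_flux[OF s assms(2) per(1) pf pW dA cont(1,2) cf tr ex]; assumption)+
  qed
  have E: "E = XD \<union> (ZS \<union> NC)"
    using f_0 by (auto simp: E_def XD_def ZS_def NC_def pairs_def)
  have fin: "finite XD" "finite ZS" "finite NC" using flux(1) unfolding E by auto
  have sg: "sgn x = r" if "r \<in> {1, -1}" "r * x > 0" for r x :: real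
    using that by auto
  \<comment> \<open>The crossing directions at the three kinds of boundary points share the factor
    \<open>\<sigma> * \<delta> * \<omega>\<close>; once it is cancelled, only \<open>\<tau>\<close>
    distinguishes the balances.\<close>
  have D: "sgn (W z) = \<sigma> * \<delta> * \<omega>" if "z \<in> XD" for z
  proof -
    have z: "A z = 0" "G z > 0" "D z = 0" "\<omega> * S z > 0" using that by (auto simp: XD_def pairs_def)
    then show ?thesis using sgn_VD[OF z(1-3)] sg[OF assms(2) z(4)] assms(1) by (auto simp: W_def sgn_mult)
  qed
  have S: "sgn (W z) = - (\<sigma> * \<delta> * \<omega> * \<tau>)" if "z \<in> ZS" for z
  proof -
    have z: "A z = 0" "G z > 0" "S z = 0" "\<sigma> * D z > 0" "\<tau> * C z > 0" using that by (auto simp: ZS_def pairs_def)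
    then have "D z \<noteq> 0" by auto
    then show ?thesis
      using sgn_VS[OF z(1-3)] sg[OF assms(1) z(4)] sg[OF assms(3) z(5)] assms(2) z(3)
      by (auto simp: W_def sgn_mult)
  qed
  have C: "sgn (W z) = \<sigma> * \<delta> * \<omega> * \<tau> * nt_sign z" if "z \<in> NC" for z
  proof -
    have z: "C z = 0" "\<sigma> * D z > 0" "\<omega> * S z > 0" using that by (auto simp: NC_def pairs_def)
    then have "D z \<noteq> 0" "S z \<noteq> 0" by auto
    then have "sgn (W z) = \<tau> * sgn (VC z)" using assms(3) by (auto simp: W_def sgn_mult)
    moreover have "sgn (D z) = \<sigma>" "sgn (S z) = \<omega>" using sg assms(1,2) z by auto
    moreover have "\<sigma> * \<sigma> = 1" "\<delta> * \<delta> = 1" "\<omega> * \<omega> = 1" using assms(1,2) \<delta> by auto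
    ultimately show ?thesis by (auto simp: nt_sign_def mult_ac)
  qed
  have dj: "XD \<inter> (ZS \<union> NC) = {}" "ZS \<inter> NC = {}"
    by (auto simp: XD_def ZS_def NC_def pairs_def)
  have "0 = (\<Sum>z\<in>XD. sgn (W z)) + ((\<Sum>z\<in>ZS. sgn (W z)) + (\<Sum>z\<in>NC. sgn (W z)))"
    using flux(2) dj fin by (simp add: E sum.union_disjoint)
  also have "\<dots> = (\<Sum>z\<in>XD. \<sigma> * \<delta> * \<omega>) + ((\<Sum>z\<in>ZS. - (\<sigma> * \<delta> * \<omega> * \<tau>)) + (\<Sum>z\<in>NC. \<sigma> * \<delta> * \<omega> * \<tau> * nt_sign z))"
    using D S C by (intro arg_cong2[of _ _ _ _ "(+)"] sum.cong) auto
  also have "\<dots> = \<sigma> * \<delta> * \<omega> * (real (card XD) - \<tau> * real (card ZS) + \<tau> * (\<Sum>z\<in>NC. nt_sign z))"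
    by (simp add: algebra_simps flip: sum_distrib_left)
  finally have "real (card XD) - \<tau> * real (card ZS) + \<tau> * (\<Sum>z\<in>NC. nt_sign z) = 0"
    using nz by simp
  then have "(\<Sum>z\<in>NC. nt_sign z) = real (card ZS) - \<tau> * real (card XD)"
    using assms(3) by auto
  with fin show ?thesis by blast
qed

text \<open>A zero of \<open>S\<close> has a definite sign of \<open>D\<close> but bounds the
  quadrants for both signs of \<open>S\<close>; for a zero of \<open>D\<close> the roles are
  exchanged. This is the factor 2. A zero of \<open>C\<close> bounds one quadrant for each
  \<open>\<tau>\<close>, and the left side is the same for both.\<close>

theorem pair_count:
  assumes "\<tau> \<in> {1, -1}"
  shows "finite (pairs (\<lambda>z. C z = 0))" "finite (pairs (\<lambda>z. S z = 0 \<and> \<tau> * C z > 0))"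
    "finite (pairs (\<lambda>z. D z = 0 \<and> \<tau> * C z > 0))"
    "(\<Sum>z\<in>pairs (\<lambda>z. C z = 0). nt_sign z) =
      2 * real (card (pairs (\<lambda>z. S z = 0 \<and> \<tau> * C z > 0))) - 2 * \<tau> * real (card (pairs (\<lambda>z. D z = 0 \<and> \<tau> * C z > 0)))"
proof -
  define X where "X \<omega> = pairs (\<lambda>z. D z = 0 \<and> \<omega> * S z > 0 \<and> \<tau> * C z > 0)" for \<omega>
  define Z where "Z \<sigma> = pairs (\<lambda>z. S z = 0 \<and> \<sigma> * D z > 0 \<and> \<tau> * C z > 0)" for \<sigma>
  define N where "N \<sigma> \<omega> = pairs (\<lambda>z. C z = 0 \<and> \<sigma> * D z > 0 \<and> \<omega> * S z > 0)" for \<sigma> \<omega>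
  have q: "finite (X \<omega>) \<and> finite (Z \<sigma>) \<and> finite (N \<sigma> \<omega>) \<and>
      (\<Sum>z\<in>N \<sigma> \<omega>. nt_sign z) = real (card (Z \<sigma>)) - \<tau> * real (card (X \<omega>))"
    if "\<sigma> \<in> {1, -1}" "\<omega> \<in> {1, -1}" for \<sigma> \<omega>
    unfolding X_def Z_def N_def by (rule quadrant_flux[OF that assms])
  have sgns: "(1::real) \<in> {1, -1}" "(-1::real) \<in> {1, -1}" by auto
  note fin = q[OF sgns(1,1)] q[OF sgns(1,2)] q[OF sgns(2,1)] q[OF sgns(2,2)]
  have X: "pairs (\<lambda>z. D z = 0 \<and> \<tau> * C z > 0) = X 1 \<union> X (-1)"
    using DS by (fastforce simp: X_def pairs_def)
  have Z: "pairs (\<lambda>z. S z = 0 \<and> \<tau> * C z > 0) = Z 1 \<union> Z (-1)"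
    using DS by (fastforce simp: Z_def pairs_def)
  have N: "pairs (\<lambda>z. C z = 0) = (N 1 1 \<union> N 1 (-1)) \<union> (N (-1) 1 \<union> N (-1) (-1))"
    using DC SC by (fastforce simp: N_def pairs_def)
  show "finite (pairs (\<lambda>z. C z = 0))" "finite (pairs (\<lambda>z. S z = 0 \<and> \<tau> * C z > 0))"
    "finite (pairs (\<lambda>z. D z = 0 \<and> \<tau> * C z > 0))"
    using fin by (auto simp: X Z N)
  have "X 1 \<inter> X (-1) = {}" "Z 1 \<inter> Z (-1) = {}" "N 1 1 \<inter> N 1 (-1) = {}" "N (-1) 1 \<inter> N (-1) (-1) = {}"
    "(N 1 1 \<union> N 1 (-1)) \<inter> (N (-1) 1 \<union> N (-1) (-1)) = {}"
    by (auto simp: X_def Z_def N_def pairs_def)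
  then show "(\<Sum>z\<in>pairs (\<lambda>z. C z = 0). nt_sign z) =
      2 * real (card (pairs (\<lambda>z. S z = 0 \<and> \<tau> * C z > 0))) - 2 * \<tau> * real (card (pairs (\<lambda>z. D z = 0 \<and> \<tau> * C z > 0)))"
    unfolding X Z N using fin by (simp add: sum.union_disjoint card_Un_disjoint algebra_simps)
qed

end

section \<open>Periodicity, second-order behaviour, branches at a crossing, ordered and unordered
  pairs\<close>

section \<open>Local and combinatorial lemmas for curves\<close>

lemma smooth_has_vector_derivative:
  "smooth f \<Longrightarrow> (nderiv n f has_vector_derivative nderiv (Suc n) f t) (at t)"
  by (simp add: smooth_def vector_derivative_works)

lemma smooth_derivs:
  assumes "smooth f"
  shows "(f has_vector_derivative nderiv 1 f t) (at t)"
    "(nderiv 1 f has_vector_derivative nderiv 2 f t) (at t)"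
    "continuous_on UNIV f" "continuous_on UNIV (nderiv 1 f)" "continuous_on UNIV (nderiv 2 f)"
proof -
  note d = smooth_has_vector_derivative[OF assms]
  have c: "continuous_on UNIV (nderiv n f)" for n
    using d by (meson has_vector_derivative_continuous continuous_at_imp_continuous_on)
  show "(f has_vector_derivative nderiv 1 f t) (at t)"
    "(nderiv 1 f has_vector_derivative nderiv 2 f t) (at t)"
    using d[of 0 t] d[of 1 t] by (simp_all add: numeral_2_eq_2)
  show "continuous_on UNIV f" "continuous_on UNIV (nderiv 1 f)" "continuous_on UNIV (nderiv 2 f)"
    using c[of 0] c[of 1] c[of 2] by simp_all
qed

text \<open>The factor \<open>c\<close> allows for a spherical lift that changes sign over a
  period.\<close>

lemma nderiv_shift:
  assumes "smooth f" "\<And>t. f (t + a) = c *\<^sub>R f t"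
  shows "nderiv n f (t + a) = c *\<^sub>R nderiv n f t"
proof (induction n arbitrary: t)
  case 0
  then show ?case using assms(2) by simp
next
  case (Suc n)
  note d = smooth_has_vector_derivative[OF assms(1)]
  have "((\<lambda>t. t + a) has_vector_derivative 1) (at t)"
    by (auto intro!: derivative_eq_intros)
  then have "((\<lambda>t. nderiv n f (t + a)) has_vector_derivative 1 *\<^sub>R nderiv (Suc n) f (t + a)) (at t)"
    using vector_diff_chain_at[OF _ d, of "\<lambda>t. t + a" 1 t n] by (simp add: o_def)
  moreover have "(\<lambda>t. nderiv n f (t + a)) = (\<lambda>t. c *\<^sub>R nderiv n f t)"
    using Suc by (simp add: fun_eq_iff)
  ultimately have "((\<lambda>t. c *\<^sub>R nderiv n f t) has_vector_derivative nderiv (Suc n) f (t + a)) (at t)"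
    by simp
  moreover have "((\<lambda>t. c *\<^sub>R nderiv n f t) has_vector_derivative c *\<^sub>R nderiv (Suc n) f t) (at t)"
    using has_vector_derivative_scaleR[OF DERIV_const d, of c] by simp
  ultimately show ?case by (rule vector_derivative_unique_at)
qed

lemma periodic_int:
  fixes f :: "real \<Rightarrow> 'a"
  assumes "\<And>t. f (t + 1) = f t"
  shows "f (t + of_int n) = f t"
proof (induction n rule: int_induct[where k = 0])
  case base
  then show ?case by simp
next
  case (step1 i)
  have "f (t + of_int (i + 1)) = f ((t + of_int i) + 1)" by (simp add: algebra_simps)
  then show ?case using assms step1 by simp
next
  case (step2 i)
  have "f (t + of_int i) = f ((t + of_int (i - 1)) + 1)" by (simp add: algebra_simps)
  then show ?case using assms step2 by metis
qed

lemma has_derivative_comp_fst_snd: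
  assumes "\<And>t. (a has_vector_derivative a' t) (at t)"
  shows "((\<lambda>z. a (fst z)) has_derivative (\<lambda>h. fst h *\<^sub>R a' (fst z))) (at z)"
    "((\<lambda>z. a (snd z)) has_derivative (\<lambda>h. snd h *\<^sub>R a' (snd z))) (at z)"
  by (rule has_derivative_compose[OF has_derivative_fst[OF has_derivative_ident] assms[unfolded has_vector_derivative_def]])
    (rule has_derivative_compose[OF has_derivative_snd[OF has_derivative_ident] assms[unfolded has_vector_derivative_def]])

lemma continuous_comp_fst_snd:
  assumes "continuous_on UNIV a"
  shows "continuous_on S (\<lambda>z. a (fst z))" "continuous_on S (\<lambda>z. a (snd z))"
  by (rule continuous_on_compose2[OF assms]; auto intro: continuous_intros)+

lemma sum_of_signs:
  fixes f :: "'a \<Rightarrow> real"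
  assumes "finite T" "\<And>z. z \<in> T \<Longrightarrow> f z = 1 \<or> f z = - 1"
  shows "(\<Sum>z\<in>T. f z) = real (card {z \<in> T. f z = 1}) - real (card {z \<in> T. f z = - 1})"
proof -
  have "T = {z \<in> T. f z = 1} \<union> {z \<in> T. f z = - 1}" using assms(2) by blast
  then have "(\<Sum>z\<in>T. f z) = (\<Sum>z\<in>{z \<in> T. f z = 1} \<union> {z \<in> T. f z = - 1}. f z)" by simp
  also have "\<dots> = (\<Sum>z\<in>{z \<in> T. f z = 1}. f z) + (\<Sum>z\<in>{z \<in> T. f z = - 1}. f z)"
    using assms(1) by (intro sum.union_disjoint) auto
  finally show ?thesis by simp
qed

lemma diff_Ints_params: "p \<in> params \<Longrightarrow> q \<in> params \<Longrightarrow> p - q \<in> \<int> \<longleftrightarrow> p = q"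
proof
  assume pq: "p \<in> params" "q \<in> params" "p - q \<in> \<int>"
  then obtain n where n: "p - q = of_int n" by (auto elim: Ints_cases)
  then have "\<bar>real_of_int n\<bar> < 1" using pq unfolding n[symmetric] by (auto simp: params_def)
  then have "\<bar>n\<bar> < 1" by linarith
  with n show "p = q" by simp
qed simp

text \<open>\<open>1 - cos (2 * pi * (p - q))\<close> is a smooth periodic measure of the distance
  from the diagonal, zero exactly when \<open>p - q\<close> is an integer.\<close>

lemma cos_diff_periodic2: "periodic2 (\<lambda>z. 1 - cos (2 * pi * (fst z - snd z)) - \<eta>)"
  unfolding periodic2_def
proof (intro allI)
  fix p q :: real and m n :: int
  have "cos (2 * pi * (p + of_int m - (q + of_int n))) = cos (2 * pi * (p - q) + 2 * pi * of_int (m - n))"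
    by (simp add: algebra_simps)
  also have "\<dots> = cos (2 * pi * (p - q))" by (simp only: cos_add cos_int_2pin sin_int_2pin)
  finally show "1 - cos (2 * pi * (fst (p + of_int m, q + of_int n) - snd (p + of_int m, q + of_int n))) - \<eta> =
    1 - cos (2 * pi * (fst (p, q) - snd (p, q))) - \<eta>" by simp
qed

lemma has_derivative_inner_fst_snd:
  fixes a b :: "real \<Rightarrow> 'a::real_inner"
  assumes "(a has_vector_derivative a') (at (fst z))" "(b has_vector_derivative b') (at (snd z))"
  shows "((\<lambda>z. a (fst z) \<bullet> b (snd z)) has_derivative
    (\<lambda>h. (a' \<bullet> b (snd z)) * fst h + (a (fst z) \<bullet> b') * snd h)) (at z)"
proof -
  have "((\<lambda>z. a (fst z)) has_derivative (\<lambda>h. fst h *\<^sub>R a')) (at z)"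
    "((\<lambda>z. b (snd z)) has_derivative (\<lambda>h. snd h *\<^sub>R b')) (at z)"
    using has_derivative_compose[OF has_derivative_fst[OF has_derivative_ident] assms(1)[unfolded has_vector_derivative_def]]
      has_derivative_compose[OF has_derivative_snd[OF has_derivative_ident] assms(2)[unfolded has_vector_derivative_def]]
    by simp_all
  from has_derivative_inner[OF this] show ?thesis
    by (rule has_derivative_eq_rhs) (simp add: fun_eq_iff algebra_simps)
qed

lemma sgn_constant:
  fixes f :: "real \<Rightarrow> real"
  assumes "continuous_on UNIV f" "\<And>t. f t \<noteq> 0"
  shows "sgn (f t) = sgn (f s)"
proof -
  have "connected (range f)" by (intro connected_continuous_image assms connected_UNIV)
  then have "\<not> (f a < 0 \<and> f b > 0)" for a b
    using connectedD_interval[of "range f" "f a" "f b" 0] assms(2) by fastforce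
  from this[of s t] this[of t s] show ?thesis
    using assms(2)[of s] assms(2)[of t] by (auto simp: sgn_if)
qed

lemma eventually_sgn_of_derivative_pos:
  fixes f :: "real \<Rightarrow> real"
  assumes "(f has_real_derivative l) (at s)" "f s = 0" "l > 0"
  shows "\<forall>\<^sub>F u in at s. sgn (f u) = sgn (u - s)"
proof -
  obtain d1 where d1: "d1 > 0" "\<And>h. h > 0 \<Longrightarrow> h < d1 \<Longrightarrow> f (s - h) < f s"
    using DERIV_pos_inc_left[OF assms(1,3)] by blast
  obtain d2 where d2: "d2 > 0" "\<And>h. h > 0 \<Longrightarrow> h < d2 \<Longrightarrow> f s < f (s + h)"
    using DERIV_pos_inc_right[OF assms(1,3)] by blast
  have "sgn (f u) = sgn (u - s)" if "u \<noteq> s" "dist u s < min d1 d2" for u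
    using d1(2)[of "s - u"] d2(2)[of "u - s"] that assms(2)
    by (cases "u < s") (auto simp: dist_real_def)
  then show ?thesis
    unfolding eventually_at using d1(1) d2(1) by (intro exI[of _ "min d1 d2"]) auto
qed

lemma eventually_pos_of_second_derivative_pos:
  fixes f f' :: "real \<Rightarrow> real"
  assumes "\<And>t. (f has_real_derivative f' t) (at t)" "(f' has_real_derivative c) (at s)"
    and "f s = 0" "f' s = 0" "c > 0"
  shows "\<forall>\<^sub>F u in at s. f u > 0"
proof -
  obtain d where d: "d > 0" "\<And>u. u \<noteq> s \<Longrightarrow> dist u s < d \<Longrightarrow> sgn (f' u) = sgn (u - s)"
    using eventually_sgn_of_derivative_pos[OF assms(2,4,5)] unfolding eventually_at by blast
  have "f u > 0" if u: "u \<noteq> s" "dist u s < d" for u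
  proof (cases "u < s")
    case True
    then obtain x where x: "u < x" "x < s" "f s - f u = (s - u) * f' x"
      using MVT2[of u s f f'] assms(1) by blast
    then have "sgn (f' x) = -1" using d(2)[of x] u by (auto simp: dist_real_def)
    then have "f' x < 0" by (simp add: sgn_1_neg)
    then show ?thesis using x True assms(3) mult_pos_neg[of "s - u" "f' x"] by simp
  next
    case False
    then have "s < u" using u by auto
    then obtain x where x: "s < x" "x < u" "f u - f s = (u - s) * f' x"
      using MVT2[of s u f f'] assms(1) by blast
    then have "sgn (f' x) = 1" using d(2)[of x] u by (auto simp: dist_real_def)
    then have "f' x > 0" by (simp add: sgn_1_pos)
    then show ?thesis using x \<open>s < u\<close> assms(3) mult_pos_pos[of "u - s" "f' x"] by simp
  qed
  then show ?thesis unfolding eventually_at using d(1) by blast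
qed

lemma has_real_derivative_inner:
  fixes a :: "real \<Rightarrow> 'a::real_inner"
  assumes "(a has_vector_derivative a') (at t)"
  shows "((\<lambda>u. (a u - x) \<bullet> n) has_real_derivative a' \<bullet> n) (at t)"
proof -
  have "((\<lambda>u. (a u - x) \<bullet> n) has_derivative (\<lambda>h. (h *\<^sub>R a' - 0) \<bullet> n)) (at t)"
    using assms unfolding has_vector_derivative_def
    by (intro has_derivative_inner_left has_derivative_diff has_derivative_const)
  then show ?thesis
    unfolding has_field_derivative_def by (rule has_derivative_eq_rhs) (simp add: fun_eq_iff)
qed

lemma eventually_second_order_inner_pos:
  fixes a :: "real \<Rightarrow> 'a::real_inner"
  assumes "\<And>t. (a has_vector_derivative a' t) (at t)" "(a' has_vector_derivative a'') (at s)"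
    and "(a s - x) \<bullet> n = 0" "a' s \<bullet> n = 0" "a'' \<bullet> n > 0"
  shows "\<forall>\<^sub>F u in at s. (a u - x) \<bullet> n > 0"
proof (rule eventually_pos_of_second_derivative_pos)
  show "((\<lambda>u. (a u - x) \<bullet> n) has_real_derivative a' t \<bullet> n) (at t)" for t
    by (rule has_real_derivative_inner[OF assms(1)])
  show "((\<lambda>u. a' u \<bullet> n) has_real_derivative a'' \<bullet> n) (at s)"
    using has_real_derivative_inner[OF assms(2), of 0] by simp
qed (use assms in auto)

text \<open>Tangent lines do not meet the curve again near their points of tangency; this separates the
  diagonal, where \<open>\<alpha> p \<bullet> \<beta> q\<close> vanishes to second order, from the other zeros.\<close>

lemma diagonal_isolated:
  fixes \<alpha> \<alpha>' \<alpha>'' \<beta> :: "real \<Rightarrow> 'a::real_inner"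
  assumes d: "\<And>t. (\<alpha> has_vector_derivative \<alpha>' t) (at t)" "\<And>t. (\<alpha>' has_vector_derivative \<alpha>'' t) (at t)"
    and c: "continuous_on UNIV \<alpha>''" "continuous_on UNIV \<beta>"
    and per: "\<And>t (n::int). \<alpha> (t + of_int n) = \<alpha> t" "\<And>t (n::int). \<alpha>'' (t + of_int n) = \<alpha>'' t"
      "\<And>t (n::int). \<beta> (t + of_int n) = \<beta> t"
    and z: "\<And>q. \<alpha> q \<bullet> \<beta> q = 0" "\<And>q. \<alpha>' q \<bullet> \<beta> q = 0" "\<And>q. \<alpha>'' q \<bullet> \<beta> q > 0"
  obtains \<eta> where "\<eta> > 0" "\<And>p q. \<alpha> p \<bullet> \<beta> q = 0 \<Longrightarrow> p - q \<notin> \<int> \<Longrightarrow> 1 - cos (2 * pi * (p - q)) > \<eta>"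
proof -
  \<comment> \<open>The second derivative is positive on the diagonal. Compactness of one period of
    \<open>q\<close> yields a uniform radius within which
    \<open>\<alpha> p \<bullet> \<beta> q\<close> is strictly convex in \<open>p\<close>, hence zero
    only at \<open>p = q\<close>.\<close>
  define W where "W = {(h, q). \<alpha>'' (q + h) \<bullet> \<beta> q > 0}"
  have "open W"
    unfolding W_def case_prod_unfold
    by (intro open_Collect_less continuous_intros continuous_on_compose2[OF c(1)] continuous_on_compose2[OF c(2)]) auto
  moreover have "{0} \<times> {0..1} \<subseteq> W" using z(3) by (auto simp: W_def)
  ultimately obtain X where X: "0 \<in> X" "open X" "X \<times> {0..1} \<subseteq> W"
    using Elementary_Topology.tube_lemma[of "{0..1::real}" W 0] by auto
  obtain r0 where r0: "r0 > 0" "ball 0 r0 \<subseteq> X" using X open_contains_ball by metis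
  \<comment> \<open>Rounding brings \<open>p - q\<close> to absolute value at most 1/2; with
    \<open>r \<le> 1 / 4\<close> all angles compared lie in \<open>[0, pi]\<close>, where the cosine
    decreases.\<close>
  define r where "r = min r0 (1 / 4)"
  have r: "r > 0" "r \<le> 1 / 4" "r \<le> r0" using r0 by (auto simp: r_def)
  have convex: "\<alpha>'' (q + h) \<bullet> \<beta> q > 0" if "\<bar>h\<bar> < r" for q h
  proof -
    have "(h, frac q) \<in> X \<times> {0..1}"
      using r0 that r(3) frac_lt_1[of q] by (auto simp: subset_iff dist_real_def)
    then have "(h, frac q) \<in> W" using X(3) by blast
    then have "\<alpha>'' (frac q + h) \<bullet> \<beta> (frac q) > 0" by (simp add: W_def)
    then show ?thesis
      using per(2)[of "q + h" "- \<lfloor>q\<rfloor>"] per(3)[of q "- \<lfloor>q\<rfloor>"] by (simp add: frac_def algebra_simps)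
  qed
  have pos: "\<alpha> p \<bullet> \<beta> q > 0" if pq: "p \<noteq> q" "\<bar>p - q\<bar> < r" for p q
  proof -
    have d1: "((\<lambda>p. \<alpha> p \<bullet> \<beta> q) has_real_derivative \<alpha>' t \<bullet> \<beta> q) (at t)" for t
      using has_real_derivative_inner[OF d(1), of 0] by simp
    have d2: "((\<lambda>p. \<alpha>' p \<bullet> \<beta> q) has_real_derivative \<alpha>'' t \<bullet> \<beta> q) (at t)" for t
      using has_real_derivative_inner[OF d(2), of 0] by simp
    have c2: "\<alpha>'' t \<bullet> \<beta> q > 0" if "\<bar>t - q\<bar> < r" for t
      using convex[of "t - q" q] that by simp
    show ?thesis
    proof (cases "p < q")
      case True
      then obtain x where x: "p < x" "x < q" "\<alpha> q \<bullet> \<beta> q - \<alpha> p \<bullet> \<beta> q = (q - p) * (\<alpha>' x \<bullet> \<beta> q)"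
        using MVT2[of p q "\<lambda>p. \<alpha> p \<bullet> \<beta> q" "\<lambda>p. \<alpha>' p \<bullet> \<beta> q"] d1 by blast
      obtain y where y: "x < y" "y < q" "\<alpha>' q \<bullet> \<beta> q - \<alpha>' x \<bullet> \<beta> q = (q - x) * (\<alpha>'' y \<bullet> \<beta> q)"
        using MVT2[of x q "\<lambda>p. \<alpha>' p \<bullet> \<beta> q" "\<lambda>p. \<alpha>'' p \<bullet> \<beta> q"] d2 x by blast
      have "\<alpha>'' y \<bullet> \<beta> q > 0" using x y pq by (intro c2) auto
      then have "\<alpha>' x \<bullet> \<beta> q < 0" using mult_pos_pos[of "q - x" "\<alpha>'' y \<bullet> \<beta> q"] y(3) x(2) z(2)[of q] by linarith
      then show ?thesis using mult_pos_neg[of "q - p" "\<alpha>' x \<bullet> \<beta> q"] x(3) True z(1)[of q] by linarith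
    next
      case False
      then have "q < p" using pq by auto
      then obtain x where x: "q < x" "x < p" "\<alpha> p \<bullet> \<beta> q - \<alpha> q \<bullet> \<beta> q = (p - q) * (\<alpha>' x \<bullet> \<beta> q)"
        using MVT2[of q p "\<lambda>p. \<alpha> p \<bullet> \<beta> q" "\<lambda>p. \<alpha>' p \<bullet> \<beta> q"] d1 by blast
      obtain y where y: "q < y" "y < x" "\<alpha>' x \<bullet> \<beta> q - \<alpha>' q \<bullet> \<beta> q = (x - q) * (\<alpha>'' y \<bullet> \<beta> q)"
        using MVT2[of q x "\<lambda>p. \<alpha>' p \<bullet> \<beta> q" "\<lambda>p. \<alpha>'' p \<bullet> \<beta> q"] d2 x by blast
      have "\<alpha>'' y \<bullet> \<beta> q > 0" using x y pq by (intro c2) auto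
      then have "\<alpha>' x \<bullet> \<beta> q > 0" using mult_pos_pos[of "x - q" "\<alpha>'' y \<bullet> \<beta> q"] y(3) x(1) z(2)[of q] by linarith
      then show ?thesis using mult_pos_pos[of "p - q" "\<alpha>' x \<bullet> \<beta> q"] x(3) \<open>q < p\<close> z(1)[of q] by linarith
    qed
  qed
  show thesis
  proof (rule that)
    have c_lt: "cos (2 * pi * r) < 1"
      using cos_monotone_0_pi[of 0 "2 * pi * r"] r pi_gt_zero by simp
    \<comment> \<open>Half of the lower bound valid outside radius \<open>r\<close>, so that the
      inequality becomes strict.\<close>
    then show "0 < (1 - cos (2 * pi * r)) / 2" by simp
    fix p q assume pq: "\<alpha> p \<bullet> \<beta> q = 0" "p - q \<notin> \<int>"
    define n where "n = round (p - q)"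
    define x where "x = p - q - of_int n"
    have "\<bar>x\<bar> \<le> 1 / 2"
      unfolding x_def n_def using of_int_round_abs_le[of "p - q"] by (simp add: abs_minus_commute)
    moreover have "p - of_int n \<noteq> q" using pq(2) by (metis Ints_of_int add_diff_cancel_left' diff_diff_eq2 diff_add_cancel)
    then have "\<not> \<bar>x\<bar> < r"
      using pos[of "p - of_int n" q] pq(1) per(1)[of p "- n"] by (auto simp: x_def algebra_simps)
    ultimately have "cos (2 * pi * \<bar>x\<bar>) \<le> cos (2 * pi * r)"
      using r by (intro cos_monotone_0_pi_le) auto
    moreover have "cos (2 * pi * (p - q)) = cos (2 * pi * \<bar>x\<bar>)"
    proof -
      have "cos (2 * pi * (p - q)) = cos (2 * pi * x + 2 * pi * of_int n)"
        by (simp add: x_def algebra_simps)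
      also have "\<dots> = cos (2 * pi * x)" by (simp add: cos_add)
      also have "\<dots> = cos (2 * pi * \<bar>x\<bar>)" by (cases "x \<ge> 0") auto
      finally show ?thesis .
    qed
    ultimately show "1 - cos (2 * pi * (p - q)) > (1 - cos (2 * pi * r)) / 2"
      using c_lt by simp
  qed
qed

lemma branch_inI:
  assumes "\<forall>\<^sub>F u in at s. sgn (u - s) = e \<longrightarrow> K u \<in> S" "e \<in> {1, -1}"
  shows "branch_in K (s, e) S"
proof -
  from assms(1) obtain d where d: "d > 0" "\<And>u. u \<noteq> s \<Longrightarrow> dist u s < d \<Longrightarrow> sgn (u - s) = e \<Longrightarrow> K u \<in> S"
    unfolding eventually_at by blast
  have "\<forall>\<^sub>F h in at_right 0. h < d"
    using d(1) by (rule eventually_at_right_real[THEN eventually_mono]) auto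
  moreover have "\<forall>\<^sub>F h in at_right (0::real). h > 0"
    by (simp add: eventually_at_filter)
  ultimately have "\<forall>\<^sub>F h in at_right 0. K (s + e * h) \<in> S"
  proof eventually_elim
    case (elim h)
    then show ?case
      using assms(2) by (intro d(2)) (auto simp: dist_real_def abs_mult sgn_mult)
  qed
  then show ?thesis by (simp add: branch_in_def)
qed

text \<open>Of the four sectors between the tangents, the branches at \<open>s\<close> occupy the
  two on the side of \<open>\<omega> *\<^sub>R w\<close>, those at \<open>t\<close> the two on the
  side of \<open>- \<omega> *\<^sub>R v\<close>. So one sector holds two branches, the opposite one
  none, and the other two hold one each: the type depends only on which opposite pair of sectors is
  acute. \<open>\<delta> = -1\<close> stands for a reversed parameter direction at
  \<open>t\<close>.\<close>

lemma crossing_branches: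
  fixes ang :: "'v::real_normed_vector \<Rightarrow> 'v \<Rightarrow> 'p set"
  assumes st: "s \<noteq> t" and sg: "\<omega> \<in> {1, -1::real}" "\<delta> \<in> {1, -1::real}"
    and s: "\<And>e. e \<in> {1, -1} \<Longrightarrow> branch_in K (s, e) (ang (e *\<^sub>R v) (\<omega> *\<^sub>R w))"
    and t: "\<And>e. e \<in> {1, -1} \<Longrightarrow> branch_in K (t, \<delta> * e) (ang (- \<omega> *\<^sub>R v) (e *\<^sub>R w))"
  shows "one_branch_in_each K s t (ang v w) (ang (- v) (- w))"
    "two_branches_in K s t (ang v (- w)) \<or> two_branches_in K s t (ang (- v) w)"
proof -
  have br: "(s, e) \<in> branches s t" "(t, \<delta> * e) \<in> branches s t" if "e \<in> {1, -1}" for e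
    using that sg by (auto simp: branches_def)
  have s': "branch_in K (s, \<omega>) (ang (\<omega> *\<^sub>R v) (\<omega> *\<^sub>R w))" "branch_in K (s, - \<omega>) (ang (- \<omega> *\<^sub>R v) (\<omega> *\<^sub>R w))"
    using s[of \<omega>] s[of "- \<omega>"] sg by auto
  have t': "branch_in K (t, \<delta> * \<omega>) (ang (- \<omega> *\<^sub>R v) (\<omega> *\<^sub>R w))" "branch_in K (t, \<delta> * - \<omega>) (ang (- \<omega> *\<^sub>R v) (- \<omega> *\<^sub>R w))"
    using t[of \<omega>] t[of "- \<omega>"] sg by auto
  show "one_branch_in_each K s t (ang v w) (ang (- v) (- w))"
  proof (cases "\<omega> = 1")
    case True
    then show ?thesis
      unfolding one_branch_in_each_def
      using s'(1) t'(2) br(1)[of 1] br(2)[of "- 1"] st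
      by (intro bexI[of _ "(s, 1)"] bexI[of _ "(t, \<delta> * - 1)"]) auto
  next
    case False
    then have "\<omega> = -1" using sg by auto
    then show ?thesis
      unfolding one_branch_in_each_def
      using s'(1) t'(2) br(1)[of "- 1"] br(2)[of 1] st
      by (intro bexI[of _ "(t, \<delta> * 1)"] bexI[of _ "(s, - 1)"]) auto
  qed
  have "two_branches_in K s t (ang (- \<omega> *\<^sub>R v) (\<omega> *\<^sub>R w))"
    unfolding two_branches_in_def
    using s'(2) t'(1) br(1)[of "- \<omega>"] br(2)[of \<omega>] st sg(1)
    by (intro bexI[of _ "(s, - \<omega>)"] bexI[of _ "(t, \<delta> * \<omega>)"]) auto
  then show "two_branches_in K s t (ang v (- w)) \<or> two_branches_in K s t (ang (- v) w)"
    using sg by auto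
qed

text \<open>By uniqueness of partners a pair is determined by its first entry, and each value of
  \<open>f\<close> is attained at exactly two first entries, a point and its partner.\<close>

lemma card_symmetric_pairs:
  assumes "finite P"
    and sym: "\<And>s t. (s, t) \<in> P \<Longrightarrow> (t, s) \<in> P" and irrefl: "\<And>s t. (s, t) \<in> P \<Longrightarrow> s \<noteq> t"
    and uniq: "\<And>s t u. (s, t) \<in> P \<Longrightarrow> (s, u) \<in> P \<Longrightarrow> t = u"
    and same: "\<And>s t. (s, t) \<in> P \<Longrightarrow> f s = f t"
    and fibre: "\<And>s t s' t'. (s, t) \<in> P \<Longrightarrow> (s', t') \<in> P \<Longrightarrow> f s = f s' \<Longrightarrow> s' = s \<or> s' = t"
  shows "card P = 2 * card {f s |s t. (s, t) \<in> P}"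
proof -
  have "inj_on fst P" using uniq by (auto simp: inj_on_def)
  then have "card P = card (fst ` P)" by (simp add: card_image)
  also have "\<dots> = (\<Sum>s\<in>fst ` P. 1)" by simp
  also have "\<dots> = (\<Sum>y\<in>f ` fst ` P. \<Sum>s\<in>{s \<in> fst ` P. f s = y}. 1)"
    using assms(1) by (intro sum.image_gen) auto
  also have "\<dots> = (\<Sum>y\<in>f ` fst ` P. 2)"
  proof (rule sum.cong[OF refl])
    fix y assume "y \<in> f ` fst ` P"
    then obtain s t where st: "(s, t) \<in> P" "y = f s" by auto
    have "{s' \<in> fst ` P. f s' = y} = {s, t}"
    proof (intro equalityI subsetI)
      fix s' assume "s' \<in> {s' \<in> fst ` P. f s' = y}"
      then obtain t' where "(s', t') \<in> P" "f s' = y" by auto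
      then show "s' \<in> {s, t}" using fibre[OF st(1), of s' t'] st(2) by auto
    qed (use st sym[OF st(1)] same[OF st(1)] in force)
    then show "(\<Sum>s\<in>{s \<in> fst ` P. f s = y}. 1) = 2" using irrefl[OF st(1)] by simp
  qed
  also have "\<dots> = 2 * card (f ` fst ` P)" by simp
  also have "f ` fst ` P = {f s |s t. (s, t) \<in> P}" by force
  finally show ?thesis .
qed

section \<open>Plane curves: frame, curvature and local position\<close>

section \<open>Plane curves\<close>

lemma rot90_simps:
  "rot90 (v + w) = rot90 v + rot90 w" "rot90 (c *\<^sub>R v) = c *\<^sub>R rot90 v" "rot90 (- v) = - rot90 v"
  "rot90 v \<bullet> v = 0" "v \<bullet> rot90 v = 0" "rot90 v \<bullet> rot90 w = v \<bullet> w" "rot90 (rot90 v) = - v"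
  by (simp_all add: rot90_def vec_eq_iff forall_2 inner_vec_def sum_2 algebra_simps)

lemma rot90_inner_swap: "rot90 v \<bullet> w = - (v \<bullet> rot90 w)"
  by (simp add: rot90_def inner_vec_def sum_2 algebra_simps)

lemma bounded_linear_rot90: "bounded_linear rot90"
proof -
  have "linear rot90" by (rule linearI) (simp_all add: rot90_simps)
  then show ?thesis by (simp add: linear_conv_bounded_linear)
qed

lemma norm_rot90 [simp]: "norm (rot90 v) = norm v"
  by (simp add: norm_eq_sqrt_inner rot90_simps)

lemma rot90_eq_0 [simp]: "rot90 v = 0 \<longleftrightarrow> v = 0"
  by (metis norm_eq_zero norm_rot90)

lemma sgn_rot90: "sgn (rot90 v) = rot90 (sgn v)"
  by (simp add: sgn_div_norm rot90_simps)

lemma plane_decomposition: "(v \<bullet> v) *\<^sub>R w = (w \<bullet> v) *\<^sub>R v + (w \<bullet> rot90 v) *\<^sub>R rot90 v"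
  by (simp add: rot90_def vec_eq_iff forall_2 inner_vec_def sum_2 algebra_simps)

lemma plane_orthogonal:
  assumes "w \<bullet> rot90 v = 0" "v \<noteq> 0"
  shows "w = (w \<bullet> v / (v \<bullet> v)) *\<^sub>R v"
proof -
  have "(v \<bullet> v) *\<^sub>R w = (w \<bullet> v) *\<^sub>R v" using plane_decomposition[of v w] assms by simp
  then have "inverse (v \<bullet> v) *\<^sub>R ((v \<bullet> v) *\<^sub>R w) = inverse (v \<bullet> v) *\<^sub>R ((w \<bullet> v) *\<^sub>R v)" by simp
  then show ?thesis using assms(2) by (simp add: field_simps)
qed

lemma plane_line_sgn:
  assumes "v \<noteq> 0"
  shows "plane_line x (sgn v) = {y. (y - x) \<bullet> rot90 v = 0}"
proof (intro equalityI subsetI)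
  fix y assume "y \<in> {y. (y - x) \<bullet> rot90 v = 0}"
  then have "y - x = ((y - x) \<bullet> v / (v \<bullet> v)) *\<^sub>R v" using plane_orthogonal assms by blast
  also have "\<dots> = ((y - x) \<bullet> v / (v \<bullet> v) * norm v) *\<^sub>R sgn v"
    using assms by (simp add: sgn_div_norm)
  finally have "y = x + ((y - x) \<bullet> v / (v \<bullet> v) * norm v) *\<^sub>R sgn v" by (simp add: algebra_simps)
  then show "y \<in> plane_line x (sgn v)" unfolding plane_line_def by blast
qed (auto simp: plane_line_def sgn_div_norm rot90_simps)

lemma plane_line_eq_iff:
  assumes "v \<noteq> 0" "w \<noteq> 0"
  shows "plane_line x (sgn v) = plane_line y (sgn w) \<longleftrightarrow> (x - y) \<bullet> rot90 w = 0 \<and> v \<bullet> rot90 w = 0"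
proof
  assume e: "plane_line x (sgn v) = plane_line y (sgn w)"
  have "x \<in> plane_line x (sgn v)" "x + v \<in> plane_line x (sgn v)"
    by (simp_all add: plane_line_sgn assms rot90_simps)
  then have "(x - y) \<bullet> rot90 w = 0" "(x + v - y) \<bullet> rot90 w = 0"
    unfolding e by (simp_all add: plane_line_sgn assms)
  then show "(x - y) \<bullet> rot90 w = 0 \<and> v \<bullet> rot90 w = 0" by (simp add: algebra_simps)
next
  assume h: "(x - y) \<bullet> rot90 w = 0 \<and> v \<bullet> rot90 w = 0"
  define c where "c = v \<bullet> w / (w \<bullet> w)"
  have v: "v = c *\<^sub>R w" using plane_orthogonal h assms unfolding c_def by blast
  then have "c \<noteq> 0" using assms by auto
  have "(z - x) \<bullet> rot90 v = 0 \<longleftrightarrow> (z - y) \<bullet> rot90 w = 0" for z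
  proof -
    have "(z - x) \<bullet> rot90 w = (z - y) \<bullet> rot90 w" using h by (simp add: algebra_simps)
    then show ?thesis using \<open>c \<noteq> 0\<close> by (simp add: v rot90_simps)
  qed
  then show "plane_line x (sgn v) = plane_line y (sgn w)"
    by (simp add: plane_line_sgn assms)
qed

locale locally_convex_plane_curve =
  fixes K :: "real \<Rightarrow> real^2"
  assumes closed: "plane_closed_curve K" and no_inflection: "plane_inflections K = {}"
begin

definition K1 where "K1 = nderiv 1 K"
definition K2 where "K2 = nderiv 2 K"
text \<open>The sign of the curvature, constant in the absence of inflection points. It makes
  \<open>N\<close> point to the side towards which the curve bends and \<open>k\<close> positive.
  Unit speed is not assumed: \<open>N\<close> has the length of \<open>K1\<close>.\<close>

definition \<epsilon> :: real where "\<epsilon> = sgn (K2 0 \<bullet> rot90 (K1 0))"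
definition N where "N t = \<epsilon> *\<^sub>R rot90 (K1 t)"
definition k where "k t = K2 t \<bullet> N t"

lemma smooth: "smooth K" and K1_nz: "K1 t \<noteq> 0" and per_1: "K (t + 1) = K t"
  using closed by (auto simp: plane_closed_curve_def K1_def)

lemma derivs: "(K has_vector_derivative K1 t) (at t)" "(K1 has_vector_derivative K2 t) (at t)"
  and continuous: "continuous_on UNIV K" "continuous_on UNIV K1" "continuous_on UNIV K2"
  using smooth_derivs[OF smooth] by (simp_all add: K1_def K2_def)

lemma periodic: "K (t + of_int n) = K t" "K1 (t + of_int n) = K1 t" "K2 (t + of_int n) = K2 t"
proof -
  have d: "nderiv m K (t + 1) = nderiv m K t" for m t
    using nderiv_shift[OF smooth, of 1 1] per_1 by simp
  show "K (t + of_int n) = K t" by (rule periodic_int[where f = K]) (rule per_1)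
  show "K1 (t + of_int n) = K1 t" "K2 (t + of_int n) = K2 t"
    unfolding K1_def K2_def
    by (rule periodic_int[where f = "nderiv 1 K"], rule d) (rule periodic_int[where f = "nderiv 2 K"], rule d)
qed

lemma tvec_eq: "plane_tvec K t = sgn (K1 t)"
  unfolding plane_tvec_def K1_def ..

lemma curvature_nz: "K2 t \<bullet> rot90 (K1 t) \<noteq> 0"
proof -
  have "frac t \<notin> plane_inflections K" using no_inflection by simp
  then have "K2 (frac t) \<bullet> rot90 (K1 (frac t)) \<noteq> 0"
    by (simp add: plane_inflections_def plane_inflection_def params_def frac_lt_1 K1_def K2_def)
  then show ?thesis using periodic(2,3)[of t "- \<lfloor>t\<rfloor>"] by (simp add: frac_def)
qed

lemma k_pos: "k t > 0"
proof -
  have c: "continuous_on UNIV (\<lambda>t. K2 t \<bullet> rot90 (K1 t))"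
    by (intro continuous_intros continuous bounded_linear.continuous_on[OF bounded_linear_rot90])
  have "sgn (K2 t \<bullet> rot90 (K1 t)) = \<epsilon>"
    unfolding \<epsilon>_def by (rule sgn_constant[OF c curvature_nz])
  then have "k t = \<bar>K2 t \<bullet> rot90 (K1 t)\<bar>" by (simp add: k_def N_def abs_sgn mult.commute)
  then show ?thesis using curvature_nz[of t] by simp
qed

lemma \<epsilon>: "\<epsilon> \<in> {1, -1}" and \<epsilon>_sq [simp]: "\<epsilon> * \<epsilon> = 1"
  using curvature_nz[of 0] by (auto simp: \<epsilon>_def sgn_if)

lemma \<epsilon>_nz [simp]: "\<epsilon> \<noteq> 0" using \<epsilon> by auto

lemma v_pos: "K1 t \<bullet> K1 t > 0" using K1_nz by simp

lemma N_simps: "K1 t \<bullet> N t = 0" "N t \<bullet> N s = K1 t \<bullet> K1 s" "K1 s \<bullet> N t = - (N s \<bullet> K1 t)"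
  using \<epsilon> by (auto simp: N_def rot90_simps rot90_inner_swap)

lemma N_nz: "N t \<noteq> 0" using K1_nz by (simp add: N_def)

lemma inner_N_eq_0 [simp]: "x \<bullet> N t = 0 \<longleftrightarrow> x \<bullet> rot90 (K1 t) = 0"
  by (simp add: N_def)

lemma parallel_K1: "x \<bullet> N t = 0 \<Longrightarrow> x = (x \<bullet> K1 t / (K1 t \<bullet> K1 t)) *\<^sub>R K1 t"
  using plane_orthogonal[OF _ K1_nz] by (simp add: N_def)

lemma parallel_N: "x \<bullet> K1 t = 0 \<Longrightarrow> x = (x \<bullet> N t / (K1 t \<bullet> K1 t)) *\<^sub>R N t"
proof -
  assume "x \<bullet> K1 t = 0"
  then have "x \<bullet> rot90 (N t) = 0" by (simp add: N_def rot90_simps)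
  from plane_orthogonal[OF this N_nz] show ?thesis by (simp add: N_simps)
qed

lemma tangent_eq_iff:
  "plane_tangent K s = plane_tangent K t \<longleftrightarrow> (K s - K t) \<bullet> N t = 0 \<and> K1 s \<bullet> N t = 0"
  unfolding plane_tangent_def tvec_eq
  by (subst plane_line_eq_iff) (use K1_nz in auto)

lemma normal_eq_iff:
  "plane_tangent K q = plane_normal K p \<longleftrightarrow> (K p - K q) \<bullet> N q = 0 \<and> K1 p \<bullet> K1 q = 0"
proof -
  have "plane_normal K p = plane_line (K p) (sgn (rot90 (K1 p)))"
    by (simp add: plane_normal_def tvec_eq sgn_rot90)
  moreover have "plane_tangent K q = plane_line (K q) (sgn (K1 q))"
    by (simp add: plane_tangent_def tvec_eq)
  moreover have "plane_line (K p) (sgn (rot90 (K1 p))) = plane_line (K q) (sgn (K1 q)) \<longleftrightarrow>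
      (K p - K q) \<bullet> N q = 0 \<and> K1 p \<bullet> K1 q = 0"
    by (subst plane_line_eq_iff) (use K1_nz in \<open>auto simp: rot90_simps\<close>)
  ultimately show ?thesis by auto
qed

lemma near_tangent_side:
  assumes "c > 0"
  shows "near_in K s {z. (z - K s) \<bullet> (c *\<^sub>R N s) > 0}"
proof -
  have "\<forall>\<^sub>F u in at s. (K u - K s) \<bullet> N s > 0"
    by (rule eventually_second_order_inner_pos[OF derivs])
       (use k_pos N_simps(1) in \<open>auto simp: k_def simp del: inner_N_eq_0\<close>)
  then show ?thesis
    unfolding near_in_def by eventually_elim (use assms in simp)
qed

text \<open>By local convexity the curve lies near each point on the side of its \<open>N\<close>.
  On a common tangent line the normals are parallel with
  \<open>N s \<bullet> N t = K1 s \<bullet> K1 t\<close>, so same side means same direction of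
  travel.\<close>

lemma plane_sidesI:
  assumes "K1 s \<bullet> N t = 0" "\<tau> \<in> {1, -1}" "\<tau> * (K1 s \<bullet> K1 t) > 0"
  shows "plane_sides K s t \<tau>"
proof -
  define n where "n = N s /\<^sub>R norm (N s)"
  have sn: "near_in K s {z. (z - K s) \<bullet> n > 0}"
    unfolding n_def by (rule near_tangent_side) (simp add: N_nz)
  have "N s \<bullet> K1 t = 0" using N_simps(3)[of s t] assms(1) by simp
  then have "N s = (N s \<bullet> N t / (K1 t \<bullet> K1 t)) *\<^sub>R N t" by (rule parallel_N)
  then have "\<tau> *\<^sub>R n = (\<tau> * (K1 s \<bullet> K1 t) / (K1 t \<bullet> K1 t) / norm (N s)) *\<^sub>R N t"
    unfolding n_def by (simp add: N_simps(2) field_simps)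
  moreover have "\<tau> * (K1 s \<bullet> K1 t) / (K1 t \<bullet> K1 t) / norm (N s) > 0"
    using assms(3) v_pos[of t] N_nz[of s] by simp
  ultimately have "near_in K t {z. (z - K t) \<bullet> (\<tau> *\<^sub>R n) > 0}"
    using near_tangent_side by presburger
  moreover have "norm n = 1" "plane_tvec K s \<bullet> n = 0"
    using N_nz[of s] N_simps(1)[of s] by (simp_all add: n_def tvec_eq sgn_div_norm del: inner_N_eq_0)
  ultimately show ?thesis using sn unfolding plane_sides_def by blast
qed

lemma branch_plane_angle:
  assumes w: "w \<bullet> N s > 0" and e: "e \<in> {1, -1}"
  shows "branch_in K (s, e) (plane_angle (K s) (e *\<^sub>R plane_tvec K s) w)"
proof (rule branch_inI[OF _ e])
  define T where "T = plane_tvec K s"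
  have T: "T = K1 s /\<^sub>R norm (K1 s)" "T \<bullet> T = 1" "K1 s \<bullet> T = norm (K1 s)" "T \<bullet> N s = 0"
    using K1_nz[of s] N_simps(1)[of s]
    by (simp_all add: T_def tvec_eq sgn_div_norm dot_square_norm power2_eq_square del: inner_N_eq_0)
  \<comment> \<open>\<open>a\<close> and \<open>b\<close> are the coordinates of
    \<open>K u - K s\<close> in the basis \<open>T\<close>, \<open>w\<close>. Convexity makes
    \<open>b\<close> positive on both sides of \<open>s\<close>; \<open>a\<close> has positive
    derivative at \<open>s\<close> and changes sign with \<open>u - s\<close>.\<close>
  define b where "b u = ((K u - K s) \<bullet> N s) / (w \<bullet> N s)" for u
  define a where "a u = (K u - K s) \<bullet> T - b u * (w \<bullet> T)" for u
  have "\<forall>\<^sub>F u in at s. (K u - K s) \<bullet> N s > 0"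
    by (rule eventually_second_order_inner_pos[OF derivs])
       (use k_pos N_simps(1) in \<open>auto simp: k_def simp del: inner_N_eq_0\<close>)
  moreover have "\<forall>\<^sub>F u in at s. sgn (a u) = sgn (u - s)"
  proof (rule eventually_sgn_of_derivative_pos)
    show "(a has_real_derivative K1 s \<bullet> T - (K1 s \<bullet> N s) / (w \<bullet> N s) * (w \<bullet> T)) (at s)"
      unfolding a_def b_def
      by (intro DERIV_diff DERIV_cmult_right DERIV_cdivide has_real_derivative_inner derivs)
    show "K1 s \<bullet> T - (K1 s \<bullet> N s) / (w \<bullet> N s) * (w \<bullet> T) > 0"
      using K1_nz[of s] N_simps(1)[of s] T(3) by (simp del: inner_N_eq_0)
  qed (simp add: a_def b_def)
  ultimately show "\<forall>\<^sub>F u in at s. sgn (u - s) = e \<longrightarrow> K u \<in> plane_angle (K s) (e *\<^sub>R plane_tvec K s) w"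
  proof eventually_elim
    case (elim u)
    have "(K u - K s - b u *\<^sub>R w) \<bullet> N s = 0" using w by (simp add: b_def inner_diff_left del: inner_N_eq_0)
    from parallel_K1[OF this] have "K u - K s - b u *\<^sub>R w = ((K u - K s - b u *\<^sub>R w) \<bullet> T) *\<^sub>R T"
      by (simp add: T(1) dot_square_norm power2_eq_square divide_inverse mult_ac)
    also have "(K u - K s - b u *\<^sub>R w) \<bullet> T = a u" by (simp add: a_def inner_diff_left)
    finally have X: "K u = K s + a u *\<^sub>R T + b u *\<^sub>R w" by (simp add: algebra_simps)
    have "b u > 0" using elim(1) w unfolding b_def by (rule divide_pos_pos)
    show ?case
    proof
      assume "sgn (u - s) = e"
      then have a: "a u *\<^sub>R T = \<bar>a u\<bar> *\<^sub>R (e *\<^sub>R T)" "\<bar>a u\<bar> > 0"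
        using elim(2) e by (auto simp: sgn_if split: if_splits)
      then show "K u \<in> plane_angle (K s) (e *\<^sub>R plane_tvec K s) w"
        unfolding plane_angle_def T_def[symmetric] using X \<open>b u > 0\<close> by (metis (mono_tags, lifting) mem_Collect_eq)
    qed
  qed
qed

lemma crossing_types:
  assumes x: "plane_crossing K s t" and \<tau>: "K1 s \<bullet> N t \<noteq> 0"
  shows "K1 s \<bullet> K1 t > 0 \<Longrightarrow> plane_crossing_type1 K s t"
    "K1 s \<bullet> K1 t < 0 \<Longrightarrow> plane_crossing_type2 K s t"
proof -
  define v where "v = plane_tvec K s"
  define w where "w = plane_tvec K t"
  have st: "s \<noteq> t" "K s = K t" using x by (auto simp: plane_crossing_def plane_self_intersection_def)
  have v: "v = K1 s /\<^sub>R norm (K1 s)" "w = K1 t /\<^sub>R norm (K1 t)" "norm v = 1" "norm w = 1"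
    using K1_nz by (simp_all add: v_def w_def tvec_eq sgn_div_norm)
  define \<omega> where "\<omega> = sgn (w \<bullet> N s)"
  have wN: "w \<bullet> N s = - (K1 s \<bullet> N t) / norm (K1 t)" "v \<bullet> N t = (K1 s \<bullet> N t) / norm (K1 s)"
    using N_simps(3)[of s t] by (simp_all add: v inner_commute divide_inverse mult.commute del: inner_N_eq_0)
  \<comment> \<open>Both arcs bend to the same side of their direction of travel. If
    \<open>w\<close> lies on that side of \<open>v\<close>, then \<open>v\<close> lies on the other
    side of \<open>w\<close>; hence the opposite signs \<open>\<omega>\<close> and
    \<open>- \<omega>\<close>.\<close>
  then have \<omega>: "\<omega> \<in> {1, -1}" "\<omega> * (w \<bullet> N s) > 0" "- \<omega> * (v \<bullet> N t) > 0"
    using \<tau> K1_nz[of s] K1_nz[of t]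
    by (auto simp: \<omega>_def sgn_if divide_less_0_iff zero_less_divide_iff simp del: inner_N_eq_0)
  have B1: "branch_in K (s, e) (plane_angle (K s) (e *\<^sub>R v) (\<omega> *\<^sub>R w))" if "e \<in> {1, -1}" for e
    unfolding v_def by (rule branch_plane_angle[OF _ that]) (use \<omega> in simp)
  have swap: "plane_angle x a b = plane_angle x b a" for x a b
    unfolding plane_angle_def by (force simp: add_ac)
  have B2: "branch_in K (t, 1 * e) (plane_angle (K s) (- \<omega> *\<^sub>R v) (e *\<^sub>R w))" if "e \<in> {1, -1}" for e
    using branch_plane_angle[OF _ that, of "- \<omega> *\<^sub>R v" t] \<omega>(3) by (simp add: swap[of "K t"] st(2) w_def)
  note br = crossing_branches[OF st(1) \<omega>(1) _ B1 B2, simplified]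
  have vw: "v \<bullet> w = (K1 s \<bullet> K1 t) / (norm (K1 s) * norm (K1 t))"
    by (simp add: v divide_inverse mult_ac)
  have le: "\<bar>v \<bullet> w\<bar> \<le> 1" using Cauchy_Schwarz_ineq2[of v w] v by simp
  have acos: "arccos y < pi / 2" if "0 < y" "y \<le> 1" for y :: real
    using arccos_less_arccos[of 0 y] that by (simp add: arccos_0)
  show "plane_crossing_type1 K s t" if "K1 s \<bullet> K1 t > 0"
  proof -
    have "v \<bullet> w > 0" using that K1_nz by (simp add: vw)
    then have "(plane_angle (K s) v w, plane_angle (K s) (- v) (- w)) \<in> plane_acute_angles K s t"
      unfolding plane_acute_angles_def using acos[of "v \<bullet> w"] le v_def w_def by force
    then show ?thesis unfolding plane_crossing_type1_def using br(1) by blast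
  qed
  show "plane_crossing_type2 K s t" if "K1 s \<bullet> K1 t < 0"
  proof -
    have "v \<bullet> w < 0" using that K1_nz by (simp add: vw divide_less_0_iff)
    then have "(plane_angle (K s) v (- w), plane_angle (K s) (- v) (- (- w))) \<in> plane_acute_angles K s t"
      unfolding plane_acute_angles_def using acos[of "- (v \<bullet> w)"] le v_def w_def by force
    then show ?thesis unfolding plane_crossing_type2_def using br(2) by force
  qed
qed

end

section \<open>Plane curves: the functions on pairs and their counts\<close>

locale generic_plane_curve = locally_convex_plane_curve +
  assumes generic: "plane_generic K"
begin

definition N1 where "N1 t = \<epsilon> *\<^sub>R rot90 (K2 t)"
text \<open>The data are not normalised: the speeds remain as positive factors, which affect neither
  the zeros nor the signs counted, and every function is a plain inner product.\<close>

definition A where "A z = (K (fst z) - K (snd z)) \<bullet> N (snd z)"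
definition D where "D z = (K (snd z) - K (fst z)) \<bullet> K1 (snd z)"
definition S where "S z = - (K1 (fst z) \<bullet> N (snd z))"
definition C where "C z = K1 (fst z) \<bullet> K1 (snd z)"
definition Ap where "Ap z = K1 (fst z) \<bullet> N (snd z)"
definition Aq where "Aq z = (K (fst z) - K (snd z)) \<bullet> N1 (snd z)"
definition VD where "VD z = - (K1 (fst z) \<bullet> K1 (snd z)) * Aq z -
  (K1 (snd z) \<bullet> K1 (snd z) + (K (snd z) - K (fst z)) \<bullet> K2 (snd z)) * Ap z"
definition VS where "VS z = - (K2 (fst z) \<bullet> N (snd z)) * Aq z - - (K1 (fst z) \<bullet> N1 (snd z)) * Ap z"
definition VC where "VC z = (K2 (fst z) \<bullet> K1 (snd z)) * Aq z - (K1 (fst z) \<bullet> K2 (snd z)) * Ap z"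

lemmas data_defs = A_def D_def S_def C_def Ap_def Aq_def VD_def VS_def VC_def

lemma N_deriv: "(N has_vector_derivative N1 t) (at t)"
  unfolding N_def N1_def
  using bounded_linear.has_vector_derivative[OF bounded_linear_rot90 derivs(2)]
  by (intro derivative_eq_intros) auto

lemma continuous_N: "continuous_on UNIV N" "continuous_on UNIV N1"
  unfolding N_def N1_def
  by (intro continuous_intros continuous bounded_linear.continuous_on[OF bounded_linear_rot90])+

lemma periodic_N: "N (t + of_int n) = N t" "N1 (t + of_int n) = N1 t"
  by (simp_all add: N_def N1_def periodic)

lemma N1_simps: "K1 t \<bullet> N1 t = - k t"
  by (simp add: N1_def k_def N_def rot90_inner_swap inner_commute[of "K1 t"])

text \<open>In homogeneous coordinates, with \<open>(K p, 1)\<close> for the point and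
  \<open>(N q, - (K q \<bullet> N q))\<close> for the tangent line, incidence is a single inner
  product, whose second derivative in \<open>p\<close> on the diagonal is \<open>k\<close>.\<close>

lemma separation:
  "\<exists>\<eta>>0. \<forall>z. A z = 0 \<longrightarrow> fst z - snd z \<notin> \<int> \<longrightarrow> 1 - cos (2 * pi * (fst z - snd z)) > \<eta>"
proof -
  have d: "((\<lambda>t. (K t, 1::real)) has_vector_derivative (K1 t, 0)) (at t)"
    "((\<lambda>t. (K1 t, 0::real)) has_vector_derivative (K2 t, 0)) (at t)" for t
    by (intro has_vector_derivative_Pair derivs has_vector_derivative_const)+
  obtain \<eta> where "\<eta> > 0" "\<And>p q. (K p, 1) \<bullet> (N q, - (K q \<bullet> N q)) = 0 \<Longrightarrow> p - q \<notin> \<int> \<Longrightarrow>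
      1 - cos (2 * pi * (p - q)) > \<eta>"
  proof (rule diagonal_isolated[OF d])
    show "continuous_on UNIV (\<lambda>t. (K2 t, 0::real))" "continuous_on UNIV (\<lambda>q. (N q, - (K q \<bullet> N q)))"
      by (intro continuous_intros continuous continuous_N)+
  qed (use k_pos N_simps(1) in \<open>auto simp: periodic periodic_N k_def simp del: inner_N_eq_0\<close>)
  then show ?thesis by (intro exI[of _ \<eta>]) (auto simp: A_def inner_diff_left)
qed

lemma double_tangency_iff:
  "plane_double_tangency K s t \<longleftrightarrow> s \<in> params \<and> t \<in> params \<and> s \<noteq> t \<and> A (s, t) = 0 \<and> S (s, t) = 0"
  by (auto simp: plane_double_tangency_def tangent_eq_iff A_def S_def)

lemma nt_pair_iff:
  "(p, q) \<in> plane_nt_pairs K \<longleftrightarrow> p \<in> params \<and> q \<in> params \<and> A (p, q) = 0 \<and> C (p, q) = 0"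
  by (auto simp: plane_nt_pairs_def normal_eq_iff A_def C_def simp del: inner_N_eq_0)

lemma meet_iff: "K p = K q \<longleftrightarrow> A (p, q) = 0 \<and> D (p, q) = 0"
proof
  assume h: "A (p, q) = 0 \<and> D (p, q) = 0"
  then have "K p - K q = ((K p - K q) \<bullet> K1 q / (K1 q \<bullet> K1 q)) *\<^sub>R K1 q"
    by (intro parallel_K1) (simp add: A_def del: inner_N_eq_0)
  moreover have "(K p - K q) \<bullet> K1 q = 0" using h by (simp add: D_def inner_diff_left)
  ultimately show "K p = K q" by simp
qed (simp add: A_def D_def)

lemma crossing_iff:
  "plane_crossing K s t \<longleftrightarrow> s \<in> params \<and> t \<in> params \<and> s \<noteq> t \<and> A (s, t) = 0 \<and> D (s, t) = 0"
  "plane_crossing K s t \<Longrightarrow> S (s, t) \<noteq> 0 \<and> C (s, t) \<noteq> 0"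
proof -
  have g: "plane_tangent K t \<noteq> plane_tangent K s \<and> plane_tangent K t \<noteq> plane_normal K s"
    if "plane_self_intersection K s t"
    using generic that unfolding plane_generic_def by blast
  then show "plane_crossing K s t \<longleftrightarrow> s \<in> params \<and> t \<in> params \<and> s \<noteq> t \<and> A (s, t) = 0 \<and> D (s, t) = 0"
    using meet_iff[of s t] by (auto simp: plane_crossing_def plane_self_intersection_def)
  show "S (s, t) \<noteq> 0 \<and> C (s, t) \<noteq> 0" if x: "plane_crossing K s t"
  proof -
    have "plane_self_intersection K s t" "K s = K t"
      using x by (auto simp: plane_crossing_def plane_self_intersection_def)
    then show ?thesis using g tangent_eq_iff[of s t] normal_eq_iff[of t s]
      by (auto simp: S_def C_def simp del: inner_N_eq_0)
  qed
qed

text \<open>With \<open>q\<close> at position \<open>y\<close> on the normal of \<open>p\<close>,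
  both changes of type become visible: \<open>D / S\<close> changes sign when \<open>q\<close>
  passes \<open>p\<close>, and \<open>VC\<close> when \<open>q\<close> passes
  \<open>y = (K1 p \<bullet> K1 p) / k p\<close>, the center of curvature.\<close>

lemma nt_pair_data:
  assumes "A (p, q) = 0" "C (p, q) = 0"
  obtains y where "K q = K p + y *\<^sub>R N p" "S (p, q) \<noteq> 0" "D (p, q) = y * S (p, q)"
    "VC (p, q) = k q * (y * k p - K1 p \<bullet> K1 p)"
proof -
  define a b s where "a = K1 p \<bullet> K1 p" and "b = K1 q \<bullet> K1 q" and "s = S (p, q)"
  have ab: "a > 0" "b > 0" using v_pos by (auto simp: a_def b_def)
  have "K1 q \<bullet> K1 p = 0" using assms(2) by (simp add: C_def inner_commute)
  from parallel_N[OF this] have K1q: "K1 q = (s / a) *\<^sub>R N p"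
    using N_simps(3)[of p q] by (simp add: s_def S_def a_def inner_commute del: inner_N_eq_0)
  have "K1 p \<bullet> K1 q = 0" using assms(2) by (simp add: C_def)
  from parallel_N[OF this] have K1p: "K1 p = (- s / b) *\<^sub>R N q"
    by (simp add: s_def S_def b_def del: inner_N_eq_0)
  \<comment> \<open>The tangents are perpendicular, so the sine is 1 or -1 and \<open>s * s\<close>
    is the product of the squared speeds.\<close>
  have "b = s * s / a"
    unfolding b_def by (subst (1 2) K1q) (use ab in \<open>simp add: N_simps(2) a_def[symmetric]\<close>)
  then have s2: "s * s = a * b" using ab by simp
  then have s: "s \<noteq> 0" using ab by auto
  define x where "x = (K q - K p) \<bullet> K1 q / b"
  have "(K q - K p) \<bullet> N q = 0" using assms(1) by (simp add: A_def inner_diff_left del: inner_N_eq_0)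
  from parallel_K1[OF this] have "K q - K p = x *\<^sub>R K1 q" by (simp add: x_def b_def)
  also have "\<dots> = (x * (s / a)) *\<^sub>R N p" by (subst K1q) simp
  finally obtain y where y: "K q - K p = y *\<^sub>R N p" by blast
  have Np: "N p = (a / s) *\<^sub>R K1 q" using ab s by (simp add: K1q)
  have D: "D (p, q) = y * s"
    using N_simps(3)[of p q] by (simp add: D_def y s_def S_def del: inner_N_eq_0)
  have "K p - K q = (- (y * a / s)) *\<^sub>R K1 q" using y by (simp add: Np algebra_simps)
  then have "Aq (p, q) = y * a * k q / s" by (simp add: Aq_def N1_simps)
  moreover have "Ap (p, q) = - s" by (simp add: Ap_def s_def S_def)
  moreover have "K2 p \<bullet> K1 q = s / a * k p" by (simp add: K1q k_def)
  moreover have "K1 p \<bullet> K2 q = - s / b * k q"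
    by (subst K1p) (simp add: k_def inner_commute)
  ultimately have "VC (p, q) = (s / a * k p) * (y * a * k q / s) - (- s / b * k q) * (- s)"
    unfolding VC_def by simp
  also have "\<dots> = y * k p * k q - (s * s) / b * k q" using ab s by (simp add: field_simps)
  also have "\<dots> = k q * (y * k p - a)" unfolding s2 using ab by (simp add: algebra_simps)
  finally have VC: "VC (p, q) = k q * (y * k p - a)" .
  have "K q = K p + y *\<^sub>R N p" using y by (simp add: algebra_simps)
  from that[OF this _ D[unfolded s_def] VC[unfolded a_def]] s show thesis by (simp add: s_def)
qed

lemma center: "plane_is_center K p (K p + (K1 p \<bullet> K1 p / k p) *\<^sub>R N p)"
  unfolding plane_is_center_def K1_def[symmetric] K2_def[symmetric]
  using k_pos[of p] N_simps(1)[of p] by (simp add: k_def inner_commute del: inner_N_eq_0)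

lemma nt_types:
  assumes q: "K q = K p + y *\<^sub>R N p"
  shows "0 \<le> y \<Longrightarrow> y * k p \<le> K1 p \<bullet> K1 p \<Longrightarrow> K q \<in> plane_normal_plus K p"
    "y < 0 \<or> y * k p > K1 p \<bullet> K1 p \<Longrightarrow> K q \<in> plane_normal_minus K p"
proof -
  \<comment> \<open>The center of curvature in the coordinate \<open>y\<close>, in which
    \<open>p\<close> is at 0.\<close>
  define r where "r = K1 p \<bullet> K1 p / k p"
  define c where "c = K p + r *\<^sub>R N p"
  have c: "plane_is_center K p c" unfolding c_def r_def by (rule center)
  have r: "r > 0" using k_pos v_pos by (simp add: r_def)
  have yr: "y * k p \<le> K1 p \<bullet> K1 p \<longleftrightarrow> y \<le> r" using k_pos[of p] by (simp add: r_def field_simps)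
  have seg: "K q \<in> closed_segment (K p) c \<longleftrightarrow> 0 \<le> y \<and> y \<le> r"
  proof
    assume "K q \<in> closed_segment (K p) c"
    then obtain u where u: "0 \<le> u" "u \<le> 1" "K q = (1 - u) *\<^sub>R K p + u *\<^sub>R c" by (auto simp: closed_segment_def)
    then have "y *\<^sub>R N p = (u * r) *\<^sub>R N p" by (simp add: q c_def algebra_simps)
    then have "y = u * r" using N_nz by simp
    then show "0 \<le> y \<and> y \<le> r" using u r mult_right_mono[of u 1 r] by simp
  next
    assume "0 \<le> y \<and> y \<le> r"
    then show "K q \<in> closed_segment (K p) c"
      unfolding closed_segment_def using r
      by (intro CollectI exI[of _ "y / r"]) (simp add: q c_def algebra_simps)
  qed
  show "K q \<in> plane_normal_plus K p" if "0 \<le> y" "y * k p \<le> K1 p \<bullet> K1 p"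
    unfolding plane_normal_plus_def using c seg that yr by blast
  have "K q \<in> plane_normal K p"
    unfolding plane_normal_def tvec_eq sgn_rot90[symmetric]
    by (subst plane_line_sgn) (use K1_nz in \<open>auto simp: q rot90_simps N_def rot90_inner_swap\<close>)
  moreover assume "y < 0 \<or> y * k p > K1 p \<bullet> K1 p"
  then have "K q \<notin> closed_segment (K p) c" using seg yr by auto
  ultimately show "K q \<in> plane_normal_minus K p"
    unfolding plane_normal_minus_def using c by blast
qed

lemma Ap_eq: "Ap z = - S z"
  by (simp add: Ap_def S_def)

text \<open>Moving \<open>q\<close> turns its tangent line about the point of tangency, in the sense
  fixed by the positive curvature; so the change of \<open>A\<close> at \<open>p\<close> is governed
  by the signed distance of \<open>p\<close> from \<open>q\<close>.\<close>

lemma Aq_eq: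
  assumes "A z = 0"
  shows "Aq z = D z / (K1 (snd z) \<bullet> K1 (snd z)) * k (snd z)"
proof -
  define c where "c = (K (fst z) - K (snd z)) \<bullet> K1 (snd z) / (K1 (snd z) \<bullet> K1 (snd z))"
  have c: "K (fst z) - K (snd z) = c *\<^sub>R K1 (snd z)"
    using assms unfolding c_def by (intro parallel_K1) (simp add: A_def del: inner_N_eq_0)
  have "Aq z = - c * k (snd z)" by (simp add: Aq_def c N1_simps)
  moreover have "D z = - ((K (fst z) - K (snd z)) \<bullet> K1 (snd z))" by (simp add: D_def inner_diff_left)
  then have "D z = - c * (K1 (snd z) \<bullet> K1 (snd z))" by (simp add: c)
  ultimately show ?thesis using K1_nz by simp
qed

theorem counts:
  "4 * int (card (plane_double_tangents1 K)) - 4 * int (card (plane_crossings1 K))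
     = int (card (plane_nt_pairs1 K)) - int (card (plane_nt_pairs2 K))"
  "4 * int (card (plane_double_tangents2 K)) + 4 * int (card (plane_crossings2 K))
     = int (card (plane_nt_pairs1 K)) - int (card (plane_nt_pairs2 K))"
proof -
  obtain \<eta> where \<eta>: "\<eta> > 0" "\<And>z. A z = 0 \<Longrightarrow> fst z - snd z \<notin> \<int> \<Longrightarrow> 1 - cos (2 * pi * (fst z - snd z)) > \<eta>"
    using separation by blast
  \<comment> \<open>Subtracting \<open>\<eta>\<close> makes the function negative on the diagonal
    while the separation keeps it positive at every other zero of \<open>A\<close>.\<close>
  define G where "G z = 1 - cos (2 * pi * (fst z - snd z)) - \<eta>" for z
  have Gz: "G (p, q) > 0 \<longleftrightarrow> p \<noteq> q" "G (p, q) \<noteq> 0" if "p \<in> params" "q \<in> params" "A (p, q) = 0" for p q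
    using \<eta>(1) \<eta>(2)[of "(p, q)"] that diff_Ints_params[of p q] by (auto simp: G_def)
  have nt_nz: "VC (p, q) \<noteq> 0" if "p \<in> params" "q \<in> params" "A (p, q) = 0" "C (p, q) = 0" for p q
  proof -
    from nt_pair_data[OF that(3,4)] obtain y where y: "K q = K p + y *\<^sub>R N p"
      "VC (p, q) = k q * (y * k p - K1 p \<bullet> K1 p)" by metis
    have "(p, q) \<in> plane_nt_pairs K" using that by (simp add: nt_pair_iff)
    then have "\<not> plane_is_center K p (K q)" using generic unfolding plane_generic_def by fast
    then have "y \<noteq> K1 p \<bullet> K1 p / k p" using y(1) center[of p] by metis
    then show ?thesis using y(2) k_pos[of q] k_pos[of p] by (auto simp: field_simps)
  qed
  interpret P: pair_system A D S C G Ap Aq VD VS VC 1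
  proof
    show "periodic2 A" "periodic2 D" "periodic2 S" "periodic2 C" "periodic2 VD" "periodic2 VS" "periodic2 VC"
      by (simp_all add: periodic2_def data_defs periodic periodic_N del: inner_N_eq_0)
    show "periodic2 G" unfolding G_def by (rule cos_diff_periodic2)
    show "continuous_on UNIV Ap" "continuous_on UNIV Aq" "continuous_on UNIV G"
      unfolding Ap_def Aq_def G_def
      by (intro continuous_intros continuous_comp_fst_snd continuous continuous_N)+
    note dd = has_derivative_comp_fst_snd[OF derivs(1)] has_derivative_comp_fst_snd[OF derivs(2)]
      has_derivative_comp_fst_snd[OF N_deriv]
    show "(A has_derivative (\<lambda>h. Ap z * fst h + Aq z * snd h)) (at z)" for z
      unfolding A_def
      by (rule has_derivative_eq_rhs, (rule has_derivative_inner has_derivative_diff dd)+)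
         (simp add: fun_eq_iff Ap_def Aq_def inner_diff_left algebra_simps N_simps(1) del: inner_N_eq_0)
    show "\<exists>dp dq. (D has_derivative (\<lambda>h. dp * fst h + dq * snd h)) (at z) \<and> VD z = dp * Aq z - dq * Ap z" for z
      unfolding D_def VD_def
      by (intro exI[of _ "- (K1 (fst z) \<bullet> K1 (snd z))"] exI[of _ "K1 (snd z) \<bullet> K1 (snd z) + (K (snd z) - K (fst z)) \<bullet> K2 (snd z)"] conjI, rule has_derivative_eq_rhs, (rule has_derivative_inner has_derivative_diff dd)+, rule ext)
         (simp_all add: inner_diff_left algebra_simps)
    show "\<exists>dp dq. (S has_derivative (\<lambda>h. dp * fst h + dq * snd h)) (at z) \<and> VS z = dp * Aq z - dq * Ap z" for z
      unfolding S_def VS_def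
      by (intro exI[of _ "- (K2 (fst z) \<bullet> N (snd z))"] exI[of _ "- (K1 (fst z) \<bullet> N1 (snd z))"] conjI, rule has_derivative_eq_rhs, (rule has_derivative_inner has_derivative_minus dd)+, rule ext)
         (simp_all add: algebra_simps del: inner_N_eq_0)
    show "\<exists>dp dq. (C has_derivative (\<lambda>h. dp * fst h + dq * snd h)) (at z) \<and> VC z = dp * Aq z - dq * Ap z" for z
      unfolding C_def VC_def
      by (intro exI[of _ "K2 (fst z) \<bullet> K1 (snd z)"] exI[of _ "K1 (fst z) \<bullet> K2 (snd z)"] conjI, rule has_derivative_eq_rhs, (rule has_derivative_inner dd)+, rule ext)
         (simp_all add: algebra_simps)
    show "G z \<noteq> 0" if "z \<in> params \<times> params" "A z = 0" for z
      using Gz that by (cases z) auto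
    show "sgn (Ap z) = - sgn (S z)" for z by (simp add: Ap_eq sgn_minus)
    show "sgn (Aq z) = 1 * sgn (D z)" if "A z = 0" for z
      using k_pos[of "snd z"] v_pos[of "snd z"] by (simp add: Aq_eq[OF that] sgn_mult sgn_divide)
    \<comment> \<open>At a crossing \<open>Aq\<close> vanishes and the derivative of
      \<open>D\<close> in \<open>q\<close> is the squared speed, so only a positive multiple of
      \<open>- Ap\<close>, that is of \<open>S\<close>, remains.\<close>
    show "sgn (VD z) = 1 * sgn (S z)" if z: "A z = 0" "D z = 0" for z
    proof -
      have "K (fst z) = K (snd z)" using z meet_iff[of "fst z" "snd z"] by simp
      then have "VD z = (K1 (snd z) \<bullet> K1 (snd z)) * S z"
        by (simp add: VD_def Aq_eq[OF z(1)] z(2) Ap_eq)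
      then show ?thesis using v_pos[of "snd z"] by (simp add: sgn_mult)
    qed
    \<comment> \<open>At a double tangent \<open>Ap\<close> vanishes. The derivative of
      \<open>S\<close> in \<open>p\<close> is minus the curvature at \<open>p\<close> measured along
      \<open>N q\<close>; the normals being parallel, that component has the sign of
      \<open>C\<close>.\<close>
    show "sgn (VS z) = - 1 * sgn (C z) * sgn (D z)" if z: "A z = 0" "S z = 0" for z
    proof -
      have "N (snd z) \<bullet> K1 (fst z) = 0" using z(2) by (simp add: S_def inner_commute del: inner_N_eq_0)
      from parallel_N[OF this] have n: "N (snd z) = (C z / (K1 (fst z) \<bullet> K1 (fst z))) *\<^sub>R N (fst z)"
        by (simp add: C_def N_simps(2) inner_commute)
      have "K2 (fst z) \<bullet> N (snd z) = C z / (K1 (fst z) \<bullet> K1 (fst z)) * k (fst z)"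
        by (subst n) (simp add: k_def del: inner_N_eq_0)
      then have "VS z = - (C z / (K1 (fst z) \<bullet> K1 (fst z)) * k (fst z)) * (D z / (K1 (snd z) \<bullet> K1 (snd z)) * k (snd z))"
        by (simp add: VS_def Aq_eq[OF z(1)] Ap_eq z(2))
      then show ?thesis
        using v_pos[of "fst z"] v_pos[of "snd z"] k_pos[of "fst z"] k_pos[of "snd z"]
        by (simp add: sgn_mult sgn_divide sgn_minus)
    qed
    show "VC z \<noteq> 0" if "z \<in> params \<times> params" "A z = 0" "C z = 0" for z
      using nt_nz that by (cases z) auto
    have x: "S z \<noteq> 0 \<and> C z \<noteq> 0" if "z \<in> params \<times> params" "A z = 0" "G z > 0" "D z = 0" for z
      using that Gz(1) crossing_iff by (cases z) auto
    show "S z \<noteq> 0" "C z \<noteq> 0" if "z \<in> params \<times> params" "A z = 0" "G z > 0" "D z = 0" for z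
      using x[OF that] by auto
    show "C z \<noteq> 0" if z: "S z = 0" for z
    proof
      assume "C z = 0"
      have "K1 (fst z) \<bullet> N (snd z) = 0" using z by (simp add: S_def del: inner_N_eq_0)
      then show False
        using parallel_K1[of "K1 (fst z)" "snd z"] K1_nz[of "fst z"] \<open>C z = 0\<close> by (simp add: C_def)
    qed
  qed simp
  \<comment> \<open>\<open>S\<close> occurs in \<open>D\<close> and once more in
    \<open>nt_sign\<close>, so its sign cancels and the position \<open>y\<close> alone
    decides.\<close>
  have sign: "P.nt_sign (p, q) = sgn y * sgn (y * k p - K1 p \<bullet> K1 p)"
    if "S (p, q) \<noteq> 0" "D (p, q) = y * S (p, q)" "VC (p, q) = k q * (y * k p - K1 p \<bullet> K1 p)" for p q y
  proof -
    have "sgn (S (p, q)) * sgn (S (p, q)) = 1" using that(1) by (auto simp: sgn_if)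
    then show ?thesis
      unfolding P.nt_sign_def that(2,3) using k_pos[of q] by (simp add: sgn_mult mult_ac)
  qed
  have T: "P.pairs (\<lambda>z. C z = 0) = plane_nt_pairs K"
  proof (rule set_eqI, clarify)
    fix p q
    have "p \<noteq> q" if "C (p, q) = 0" using that K1_nz[of q] by (auto simp: C_def)
    then show "((p, q) \<in> P.pairs (\<lambda>z. C z = 0)) = ((p, q) \<in> plane_nt_pairs K)"
      using Gz(1)[of p q] by (auto simp: P.pairs_def nt_pair_iff)
  qed
  have nt: "P.nt_sign (p, q) = 1 \<and> K q \<in> plane_normal_minus K p \<or>
      P.nt_sign (p, q) = - 1 \<and> K q \<in> plane_normal_plus K p" if pq: "(p, q) \<in> plane_nt_pairs K" for p q
  proof -
    have z: "p \<in> params" "q \<in> params" "A (p, q) = 0" "C (p, q) = 0" using pq by (auto simp: nt_pair_iff)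
    from nt_pair_data[OF z(3,4)] obtain y where y: "K q = K p + y *\<^sub>R N p" "S (p, q) \<noteq> 0"
      "D (p, q) = y * S (p, q)" "VC (p, q) = k q * (y * k p - K1 p \<bullet> K1 p)" by metis
    have "p \<noteq> q" using z(4) K1_nz[of q] by (auto simp: C_def)
    then have "D (p, q) \<noteq> 0" using z crossing_iff[of p q] by auto
    then have "y \<noteq> 0" using y(3) by auto
    moreover have "y * k p \<noteq> K1 p \<bullet> K1 p" using nt_nz[OF z] y(4) by auto
    \<comment> \<open>Before \<open>p\<close>, beyond the center, or strictly between them: the
      product of the two signs is 1 in the first two cases and -1 in the third.\<close>
    ultimately consider "y < 0" | "y * k p > K1 p \<bullet> K1 p" | "y > 0" "y * k p < K1 p \<bullet> K1 p" by argo
    then show ?thesis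
    proof cases
      case 1
      then have "y * k p < K1 p \<bullet> K1 p" using k_pos[of p] v_pos[of p] mult_neg_pos[of y "k p"] by linarith
      then show ?thesis using 1 sign[OF y(2-4)] nt_types(2)[OF y(1)] by simp
    next
      case 2
      then have "y * k p > 0" using v_pos[of p] by linarith
      then have "y > 0" using k_pos[of p] by (simp add: zero_less_mult_iff)
      then show ?thesis using 2 sign[OF y(2-4)] nt_types(2)[OF y(1)] by simp
    next
      case 3
      then show ?thesis using sign[OF y(2-4)] nt_types(1)[OF y(1)] by simp
    qed
  qed
  have xor: "plane_types_well_defined K" using generic unfolding plane_generic_def by blast
  have "plane_nt_pairs1 K = {z \<in> plane_nt_pairs K. P.nt_sign z = 1}"
    "plane_nt_pairs2 K = {z \<in> plane_nt_pairs K. P.nt_sign z = - 1}"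
    using nt xor unfolding plane_nt_pairs1_def plane_nt_pairs2_def plane_types_well_defined_def by fastforce+
  moreover have "finite (plane_nt_pairs K)" using generic unfolding plane_generic_def by blast
  ultimately have N: "(\<Sum>z\<in>plane_nt_pairs K. P.nt_sign z) = real (card (plane_nt_pairs1 K)) - real (card (plane_nt_pairs2 K))"
    using sum_of_signs[of "plane_nt_pairs K" P.nt_sign] nt by force
  have dt_uniq: "t = u" if "plane_double_tangency K s t" "plane_double_tangency K s u" for s t u
    using generic that unfolding plane_generic_def by blast
  have x_uniq: "t = u" if "plane_self_intersection K s t" "plane_self_intersection K s u" for s t u
    using generic that unfolding plane_generic_def by blast
  have Z: "card (P.pairs (\<lambda>z. S z = 0 \<and> \<tau> * C z > 0)) =
      2 * card {plane_tangent K s |s t. plane_double_tangency K s t \<and> plane_sides K s t \<tau>}" if \<tau>: "\<tau> \<in> {1, -1}" for \<tau>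
  proof -
    have sides: "plane_sides K s t \<tau> \<longleftrightarrow> \<tau> * C (s, t) > 0" if dt: "plane_double_tangency K s t" for s t
    proof -
      have st: "A (s, t) = 0" "K1 s \<bullet> N t = 0" using dt by (auto simp: double_tangency_iff S_def simp del: inner_N_eq_0)
      then have "C (s, t) \<noteq> 0" using P.SC[of "(s, t)"] dt Gz(1)[of s t] by (auto simp: double_tangency_iff)
      then have "C (s, t) > 0 \<or> C (s, t) < 0" by linarith
      then have "C (s, t) > 0 \<and> plane_sides K s t 1 \<or> C (s, t) < 0 \<and> plane_sides K s t (- 1)"
        using plane_sidesI[OF st(2), of 1] plane_sidesI[OF st(2), of "- 1"] by (auto simp: C_def)
      \<comment> \<open>So far only the sign of \<open>C\<close> implies the type; as exactly one
        type holds, the converse follows.\<close>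
      moreover have "plane_sides K s t 1 \<noteq> plane_sides K s t (- 1)"
        using xor dt unfolding plane_types_well_defined_def by blast
      ultimately show ?thesis using \<tau> by auto
    qed
    have P: "P.pairs (\<lambda>z. S z = 0 \<and> \<tau> * C z > 0) = {(s, t). plane_double_tangency K s t \<and> \<tau> * C (s, t) > 0}"
      using Gz(1) by (auto simp: P.pairs_def double_tangency_iff)
    have "card (P.pairs (\<lambda>z. S z = 0 \<and> \<tau> * C z > 0)) =
        2 * card {plane_tangent K s |s t. (s, t) \<in> P.pairs (\<lambda>z. S z = 0 \<and> \<tau> * C z > 0)}"
    proof (rule card_symmetric_pairs)
      show "finite (P.pairs (\<lambda>z. S z = 0 \<and> \<tau> * C z > 0))" by (rule P.pair_count(2)[OF \<tau>])
    next
      fix s t assume "(s, t) \<in> P.pairs (\<lambda>z. S z = 0 \<and> \<tau> * C z > 0)"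
      then show "(t, s) \<in> P.pairs (\<lambda>z. S z = 0 \<and> \<tau> * C z > 0)"
        unfolding P by (auto simp: plane_double_tangency_def C_def inner_commute)
    next
      fix s t s' t'
      assume "(s, t) \<in> P.pairs (\<lambda>z. S z = 0 \<and> \<tau> * C z > 0)" "(s', t') \<in> P.pairs (\<lambda>z. S z = 0 \<and> \<tau> * C z > 0)"
        "plane_tangent K s = plane_tangent K s'"
      then show "s' = s \<or> s' = t"
        unfolding P using dt_uniq[of s t s'] by (auto simp: plane_double_tangency_def)
    qed (use dt_uniq in \<open>auto simp: P plane_double_tangency_def\<close>)
    also have "{plane_tangent K s |s t. (s, t) \<in> P.pairs (\<lambda>z. S z = 0 \<and> \<tau> * C z > 0)} =
        {plane_tangent K s |s t. plane_double_tangency K s t \<and> plane_sides K s t \<tau>}"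
      unfolding P using sides by blast
    finally show ?thesis .
  qed
  have X: "card (P.pairs (\<lambda>z. D z = 0 \<and> \<tau> * C z > 0)) =
      2 * card {K s |s t. plane_crossing K s t \<and> (if \<tau> = 1 then plane_crossing_type1 K s t else plane_crossing_type2 K s t)}"
    if \<tau>: "\<tau> \<in> {1, -1}" for \<tau>
  proof -
    have type: "(if \<tau> = 1 then plane_crossing_type1 K s t else plane_crossing_type2 K s t) \<longleftrightarrow> \<tau> * C (s, t) > 0"
      if x: "plane_crossing K s t" for s t
    proof -
      have "S (s, t) \<noteq> 0" "C (s, t) \<noteq> 0" using crossing_iff(2)[OF x] by auto
      then have "S (s, t) \<noteq> 0" "C (s, t) > 0 \<or> C (s, t) < 0" by linarith+
      then have "C (s, t) > 0 \<and> plane_crossing_type1 K s t \<or> C (s, t) < 0 \<and> plane_crossing_type2 K s t"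
        using crossing_types[OF x] by (auto simp: S_def C_def simp del: inner_N_eq_0)
      moreover have "plane_crossing_type1 K s t \<noteq> plane_crossing_type2 K s t"
        using xor x unfolding plane_types_well_defined_def by blast
      ultimately show ?thesis using \<tau> by auto
    qed
    have P: "P.pairs (\<lambda>z. D z = 0 \<and> \<tau> * C z > 0) = {(s, t). plane_crossing K s t \<and> \<tau> * C (s, t) > 0}"
      using Gz(1) by (auto simp: P.pairs_def crossing_iff(1))
    have "card (P.pairs (\<lambda>z. D z = 0 \<and> \<tau> * C z > 0)) =
        2 * card {K s |s t. (s, t) \<in> P.pairs (\<lambda>z. D z = 0 \<and> \<tau> * C z > 0)}"
    proof (rule card_symmetric_pairs)
      show "finite (P.pairs (\<lambda>z. D z = 0 \<and> \<tau> * C z > 0))" by (rule P.pair_count(3)[OF \<tau>])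
    next
      fix s t assume "(s, t) \<in> P.pairs (\<lambda>z. D z = 0 \<and> \<tau> * C z > 0)"
      then show "(t, s) \<in> P.pairs (\<lambda>z. D z = 0 \<and> \<tau> * C z > 0)"
        unfolding P by (auto simp: plane_crossing_def plane_self_intersection_def C_def inner_commute)
    next
      fix s t s' t'
      assume "(s, t) \<in> P.pairs (\<lambda>z. D z = 0 \<and> \<tau> * C z > 0)" "(s', t') \<in> P.pairs (\<lambda>z. D z = 0 \<and> \<tau> * C z > 0)"
        "K s = K s'"
      then show "s' = s \<or> s' = t"
        unfolding P using x_uniq[of s t s'] by (auto simp: plane_crossing_def plane_self_intersection_def)
    qed (use x_uniq in \<open>auto simp: P plane_crossing_def plane_self_intersection_def\<close>)
    also have "{K s |s t. (s, t) \<in> P.pairs (\<lambda>z. D z = 0 \<and> \<tau> * C z > 0)} =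
        {K s |s t. plane_crossing K s t \<and> (if \<tau> = 1 then plane_crossing_type1 K s t else plane_crossing_type2 K s t)}"
      unfolding P using type by blast
    finally show ?thesis .
  qed
  have "real (card (plane_nt_pairs1 K)) - real (card (plane_nt_pairs2 K)) =
      4 * real (card (plane_double_tangents1 K)) - 4 * real (card (plane_crossings1 K))"
    using P.pair_count(4)[of 1] Z[of 1] X[of 1] N
    by (simp add: T plane_double_tangents1_def plane_crossings1_def)
  then show "4 * int (card (plane_double_tangents1 K)) - 4 * int (card (plane_crossings1 K))
     = int (card (plane_nt_pairs1 K)) - int (card (plane_nt_pairs2 K))" by linarith
  have "real (card (plane_nt_pairs1 K)) - real (card (plane_nt_pairs2 K)) =
      4 * real (card (plane_double_tangents2 K)) + 4 * real (card (plane_crossings2 K))"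
    using P.pair_count(4)[of "- 1"] Z[of "- 1"] X[of "- 1"] N
    by (simp add: T plane_double_tangents2_def plane_crossings2_def)
  then show "4 * int (card (plane_double_tangents2 K)) + 4 * int (card (plane_crossings2 K))
     = int (card (plane_nt_pairs1 K)) - int (card (plane_nt_pairs2 K))" by linarith
qed

end

section \<open>Projective plane: polarity between points and geodesics\<close>

section \<open>Curves in the projective plane\<close>

lemma bounded_bilinear_cross3: "bounded_bilinear cross3"
  using bilinear_cross by (simp add: bilinear_conv_bounded_bilinear)

lemma orthogonal_to_frame:
  fixes a b y :: "real^3"
  assumes "y \<bullet> a = 0" "y \<bullet> b = 0" "y \<bullet> cross3 a b = 0" "cross3 a b \<noteq> 0"
  shows "y = 0"
proof -
  have "cross3 y (cross3 a b) = 0" using assms by (simp add: Lagrange)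
  then show ?thesis using norm_and_cross_eq_0[of y "cross3 a b"] assms by auto
qed

lemma rp2_proj_minus: "rp2_proj (- x) = rp2_proj x"
  by (simp add: rp2_proj_def insert_commute)

lemma rp2_proj_sign: "\<delta> \<in> {1, -1::real} \<Longrightarrow> rp2_proj (\<delta> *\<^sub>R x) = rp2_proj x"
  by (auto simp: rp2_proj_minus)

lemma rp2_proj_eq_iff:
  assumes "norm x = 1" "norm y = 1"
  shows "rp2_proj x = rp2_proj y \<longleftrightarrow> x = y \<or> x = - y"
proof
  assume "rp2_proj x = rp2_proj y"
  then have "{x, - x} = {y, - y}" using assms reps_rp2_proj by metis
  then show "x = y \<or> x = - y" by auto
qed (auto simp: rp2_proj_minus)

lemma reps_proj: "y \<in> reps q \<Longrightarrow> norm y = 1 \<and> q = rp2_proj y"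
proof -
  assume y: "y \<in> reps q"
  obtain x where x: "reps q = {x, - x}" "norm x = 1" using reps[of q] by auto
  then have "q = rp2_proj x" unfolding rp2_proj_def by (metis reps_inverse)
  then show ?thesis using x y rp2_proj_minus by auto
qed

text \<open>The geodesic dual to \<open>[m]\<close>.\<close>

definition polar :: "real^3 \<Rightarrow> rp2 set" where
  "polar m = {rp2_proj y |y. norm y = 1 \<and> y \<bullet> m = 0}"

lemma polar_scale: "c \<noteq> 0 \<Longrightarrow> polar (c *\<^sub>R m) = polar m"
  by (simp add: polar_def)

lemma proj_in_polar: "norm y = 1 \<Longrightarrow> rp2_proj y \<in> polar m \<longleftrightarrow> y \<bullet> m = 0"
  unfolding polar_def by (auto simp: rp2_proj_eq_iff)

text \<open>A pole turns incidence with a geodesic into an inner product, and equality of geodesics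
  into proportionality of poles.\<close>

lemma rp2_geodesic_eq_polar:
  assumes "norm x = 1" "norm v = 1" "x \<bullet> v = 0"
  shows "rp2_geodesic x v = polar (cross3 x v)"
proof -
  have x: "x \<bullet> x = 1" "v \<bullet> v = 1" using assms by (simp_all add: dot_square_norm)
  have nz: "cross3 x v \<noteq> 0"
    using dot_cross[of x v x v] x assms(3) by (metis inner_zero_left mult_1 mult_zero_left diff_0_right zero_neq_one)
  show ?thesis
  proof (intro equalityI subsetI)
    fix q assume "q \<in> rp2_geodesic x v"
    then obtain r where r: "q = rp2_proj (cos r *\<^sub>R x + sin r *\<^sub>R v)" by (auto simp: rp2_geodesic_def)
    have "(cos r *\<^sub>R x + sin r *\<^sub>R v) \<bullet> (cos r *\<^sub>R x + sin r *\<^sub>R v) = (cos r)\<^sup>2 + (sin r)\<^sup>2"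
      using x assms(3) by (simp add: inner_add_left inner_add_right inner_commute power2_eq_square)
    then have "norm (cos r *\<^sub>R x + sin r *\<^sub>R v) = 1" by (simp add: norm_eq_sqrt_inner)
    then show "q \<in> polar (cross3 x v)" using r by (simp add: proj_in_polar inner_add_left dot_cross_self)
  next
    fix q assume "q \<in> polar (cross3 x v)"
    then obtain y where y: "q = rp2_proj y" "norm y = 1" "y \<bullet> cross3 x v = 0" by (auto simp: polar_def)
    have "y - ((y \<bullet> x) *\<^sub>R x + (y \<bullet> v) *\<^sub>R v) = 0"
      by (rule orthogonal_to_frame[OF _ _ _ nz])
         (use x assms(3) y in \<open>simp_all add: inner_diff_left inner_add_left dot_cross_self inner_commute[of v x]\<close>)
    then have Y: "y = (y \<bullet> x) *\<^sub>R x + (y \<bullet> v) *\<^sub>R v" by simp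
    have "y \<bullet> y = (y \<bullet> x)\<^sup>2 + (y \<bullet> v)\<^sup>2"
      by (subst (2) Y) (simp add: inner_add_right power2_eq_square)
    then have "(y \<bullet> x)\<^sup>2 + (y \<bullet> v)\<^sup>2 = 1" using y(2) by (simp add: dot_square_norm)
    then obtain r where "y \<bullet> x = cos r" "y \<bullet> v = sin r" by (metis sincos_total_2pi_le)
    then show "q \<in> rp2_geodesic x v" using Y y(1) by (auto simp: rp2_geodesic_def)
  qed
qed

text \<open>The rest \<open>u\<close> of \<open>Y\<close> is orthogonal to \<open>x\<close>, so
  \<open>\<alpha>\<close> and \<open>norm u\<close> are cosine and sine of the distance
  \<open>r\<close> from \<open>x\<close>; positive \<open>\<alpha>\<close> keeps \<open>r\<close>
  below \<open>pi / 2\<close>.\<close>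

lemma rp2_angleI:
  assumes Y: "Y = \<alpha> *\<^sub>R x + a *\<^sub>R v + b *\<^sub>R w" "norm Y = 1" "norm x = 1"
    and perp: "v \<bullet> x = 0" "w \<bullet> x = 0" and pos: "\<alpha> > 0" "a > 0" "b > 0"
    and nz: "a *\<^sub>R v + b *\<^sub>R w \<noteq> 0"
  shows "rp2_proj Y \<in> rp2_angle x v w"
proof -
  define u where "u = a *\<^sub>R v + b *\<^sub>R w"
  have Yu: "Y = \<alpha> *\<^sub>R x + u" using Y by (simp add: u_def)
  have "u \<bullet> x = 0" using perp by (simp add: u_def inner_add_left)
  moreover have "x \<bullet> x = 1" "Y \<bullet> Y = 1" using Y(2,3) by (simp_all add: dot_square_norm)
  ultimately have sq: "\<alpha>\<^sup>2 + (norm u)\<^sup>2 = 1"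
    by (simp add: Yu inner_add_left inner_add_right inner_commute[of x u] power2_norm_eq_inner power2_eq_square[of \<alpha>])
  then obtain r where r: "0 \<le> r" "r \<le> pi / 2" "\<alpha> = cos r" "norm u = sin r"
    using sincos_total_pi_half[of \<alpha> "norm u"] pos by auto
  have "r \<noteq> 0" using r(4) nz by (auto simp: u_def)
  moreover have "r \<noteq> pi / 2"
  proof
    assume "r = pi / 2"
    then show False using r(3) pos(1) by (simp only: cos_pi_half)
  qed
  moreover have "sin r *\<^sub>R sgn u = u"
    unfolding r(4)[symmetric] using nz by (simp add: sgn_div_norm u_def[symmetric])
  then have "rp2_proj Y = rp2_proj (cos r *\<^sub>R x + sin r *\<^sub>R sgn (a *\<^sub>R v + b *\<^sub>R w))"
    unfolding Yu r(3) u_def[symmetric] by simp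
  ultimately show ?thesis
    unfolding rp2_angle_def using r(1,2) pos(2,3) by (intro CollectI exI[of _ r] exI[of _ a] exI[of _ b]) auto
qed

section \<open>Moving frame of the spherical lift, centers of curvature, sides and branches\<close>

locale locally_convex_rp2_curve =
  fixes K :: "real \<Rightarrow> rp2"
  assumes closed: "rp2_closed_curve K" and no_inflection: "rp2_inflections K = {}"
begin

definition \<gamma> where "\<gamma> = lift_of K"
definition \<gamma>1 where "\<gamma>1 = nderiv 1 \<gamma>"
definition \<gamma>2 where "\<gamma>2 = nderiv 2 \<gamma>"
definition \<epsilon> :: real where "\<epsilon> = sgn (\<gamma>2 0 \<bullet> cross3 (\<gamma> 0) (\<gamma>1 0))"
definition N where "N t = \<epsilon> *\<^sub>R cross3 (\<gamma> t) (\<gamma>1 t)"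
text \<open>The derivative of \<open>N\<close>: the other term of the product rule is the cross
  product of \<open>\<gamma>1\<close> with itself.\<close>

definition N1 where "N1 t = \<epsilon> *\<^sub>R cross3 (\<gamma> t) (\<gamma>2 t)"
definition k where "k t = \<gamma>2 t \<bullet> N t"

lemma lift: "is_lift K \<gamma>"
  using closed unfolding \<gamma>_def lift_of_def rp2_closed_curve_def by (metis someI_ex)

lemma smooth: "smooth \<gamma>" and norm_\<gamma> [simp]: "norm (\<gamma> t) = 1" and \<gamma>1_nz: "\<gamma>1 t \<noteq> 0"
  and K_eq: "K t = rp2_proj (\<gamma> t)"
  using lift unfolding is_lift_def \<gamma>1_def by blast+

lemma derivs: "(\<gamma> has_vector_derivative \<gamma>1 t) (at t)" "(\<gamma>1 has_vector_derivative \<gamma>2 t) (at t)"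
  and continuous: "continuous_on UNIV \<gamma>" "continuous_on UNIV \<gamma>1" "continuous_on UNIV \<gamma>2"
  unfolding \<gamma>1_def \<gamma>2_def using smooth_derivs[OF smooth] by blast+

lemma v_pos: "\<gamma>1 t \<bullet> \<gamma>1 t > 0" using \<gamma>1_nz by simp

lemma \<gamma>_simps: "\<gamma> t \<bullet> \<gamma> t = 1" "\<gamma> t \<bullet> \<gamma>1 t = 0" "\<gamma>1 t \<bullet> \<gamma> t = 0"
  "\<gamma> t \<bullet> \<gamma>2 t = - (\<gamma>1 t \<bullet> \<gamma>1 t)" "\<gamma>2 t \<bullet> \<gamma> t = - (\<gamma>1 t \<bullet> \<gamma>1 t)"
proof -
  show g: "\<gamma> t \<bullet> \<gamma> t = 1" for t by (simp add: dot_square_norm)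
  have d: "((\<lambda>t. a t \<bullet> b t) has_real_derivative (a' \<bullet> b t + a t \<bullet> b')) (at t)"
    if "(a has_vector_derivative a') (at t)" "(b has_vector_derivative b') (at t)"
    for a b :: "real \<Rightarrow> real^3" and a' b' t
    using has_derivative_inner[OF that[unfolded has_vector_derivative_def]]
    unfolding has_field_derivative_def by (rule has_derivative_eq_rhs) (simp add: fun_eq_iff algebra_simps)
  have "((\<lambda>t. 1) has_real_derivative (\<gamma>1 t \<bullet> \<gamma> t + \<gamma> t \<bullet> \<gamma>1 t)) (at t)" for t
    using d[OF derivs(1) derivs(1), of t] by (simp add: g)
  then have "\<gamma>1 t \<bullet> \<gamma> t + \<gamma> t \<bullet> \<gamma>1 t = 0" for t using DERIV_unique DERIV_const by metis
  then show o: "\<gamma> t \<bullet> \<gamma>1 t = 0" for t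
    using inner_commute[of "\<gamma> t" "\<gamma>1 t"] by (metis add_cancel_right_right add_eq_0_iff minus_equation_iff neg_equal_zero)
  then show o': "\<gamma>1 t \<bullet> \<gamma> t = 0" for t by (simp add: inner_commute)
  have "((\<lambda>t. 0) has_real_derivative (\<gamma>1 t \<bullet> \<gamma>1 t + \<gamma> t \<bullet> \<gamma>2 t)) (at t)"
    using d[OF derivs(1) derivs(2), of t] by (simp add: o)
  then have "\<gamma>1 t \<bullet> \<gamma>1 t + \<gamma> t \<bullet> \<gamma>2 t = 0" using DERIV_unique DERIV_const by metis
  then show "\<gamma> t \<bullet> \<gamma>2 t = - (\<gamma>1 t \<bullet> \<gamma>1 t)" "\<gamma>2 t \<bullet> \<gamma> t = - (\<gamma>1 t \<bullet> \<gamma>1 t)"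
    by (simp_all add: inner_commute)
qed

lemma curvature_continuous: "continuous_on UNIV (\<lambda>t. \<gamma>2 t \<bullet> cross3 (\<gamma> t) (\<gamma>1 t))"
  by (intro continuous_intros continuous_on_cross continuous)

text \<open>Continuing the lift once around \<open>K\<close> multiplies it by a sign, and its geodesic curvature by the
  same sign. As the curvature never vanishes, the lift is periodic.\<close>

lemma lift_shift:
  obtains s :: real where "s \<in> {1, -1}" "\<And>n t. nderiv n \<gamma> (t + 1) = s *\<^sub>R nderiv n \<gamma> t"
proof -
  have pm: "\<gamma> (t + 1) = \<gamma> t \<or> \<gamma> (t + 1) = - \<gamma> t" for t
  proof -
    have "rp2_proj (\<gamma> (t + 1)) = rp2_proj (\<gamma> t)"
      using closed K_eq by (metis rp2_closed_curve_def)
    then show ?thesis by (simp add: rp2_proj_eq_iff)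
  qed
  define f where "f t = \<gamma> (t + 1) \<bullet> \<gamma> t" for t
  have f: "\<gamma> (t + 1) = f t *\<^sub>R \<gamma> t" "f t \<in> {1, -1}" for t
    using pm[of t] by (auto simp: f_def \<gamma>_simps)
  have "continuous_on UNIV f"
    unfolding f_def by (intro continuous_intros continuous_on_compose2[OF continuous(1)] continuous) auto
  moreover have "f t \<noteq> 0" for t using f(2)[of t] by auto
  ultimately have sg: "sgn (f t) = sgn (f 0)" for t by (rule sgn_constant)
  have "f t = f 0" for t using sg[of t] f(2)[of t] f(2)[of 0] by auto
  then have "\<gamma> (t + 1) = f 0 *\<^sub>R \<gamma> t" for t using f(1) by metis
  then show thesis using that[OF f(2)[of 0]] nderiv_shift[OF smooth] by blast
qed

lemma curvature_nz: "\<gamma>2 t \<bullet> cross3 (\<gamma> t) (\<gamma>1 t) \<noteq> 0"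
proof -
  \<comment> \<open>Once around \<open>K\<close> the curvature is multiplied by the cube of the sign
    \<open>s\<close>. Its absolute value is periodic for either sign, which carries non-vanishing
    from \<open>params\<close> to all parameters.\<close>
  define \<kappa> where "\<kappa> t = \<bar>\<gamma>2 t \<bullet> cross3 (\<gamma> t) (\<gamma>1 t)\<bar>" for t
  obtain s :: real where s: "s \<in> {1, -1}" "\<And>n t. nderiv n \<gamma> (t + 1) = s *\<^sub>R nderiv n \<gamma> t"
    by (rule lift_shift) blast
  have "\<kappa> (t + 1) = \<kappa> t" for t
  proof -
    have "\<gamma> (t + 1) = s *\<^sub>R \<gamma> t" "\<gamma>1 (t + 1) = s *\<^sub>R \<gamma>1 t" "\<gamma>2 (t + 1) = s *\<^sub>R \<gamma>2 t"
      using s(2)[of 0 t] s(2)[of 1 t] s(2)[of 2 t] unfolding \<gamma>1_def \<gamma>2_def by simp_all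
    then show ?thesis using s(1) by (auto simp: \<kappa>_def cross_mult_left cross_mult_right)
  qed
  then have "\<kappa> (t + of_int n) = \<kappa> t" for n by (rule periodic_int[where f = \<kappa>])
  from this[of "- \<lfloor>t\<rfloor>"] have "\<kappa> t = \<kappa> (frac t)" by (simp add: frac_def)
  moreover have "\<kappa> (frac t) \<noteq> 0"
  proof -
    have "frac t \<notin> rp2_inflections K" using no_inflection by simp
    then have "\<not> rp2_inflection K (frac t)" by (simp add: rp2_inflections_def params_def frac_lt_1)
    then show ?thesis unfolding rp2_inflection_def \<kappa>_def \<gamma>1_def \<gamma>2_def \<gamma>_def by simp
  qed
  ultimately show ?thesis by (simp add: \<kappa>_def)
qed

lemma k_pos: "k t > 0"
proof -
  have "sgn (\<gamma>2 t \<bullet> cross3 (\<gamma> t) (\<gamma>1 t)) = \<epsilon>"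
    unfolding \<epsilon>_def by (rule sgn_constant[OF curvature_continuous curvature_nz])
  then have "k t = \<bar>\<gamma>2 t \<bullet> cross3 (\<gamma> t) (\<gamma>1 t)\<bar>" by (simp add: k_def N_def abs_sgn mult.commute)
  then show ?thesis using curvature_nz[of t] by simp
qed

lemma \<epsilon>: "\<epsilon> \<in> {1, -1}" and \<epsilon>_sq [simp]: "\<epsilon> * \<epsilon> = 1"
  using curvature_nz[of 0] by (auto simp: \<epsilon>_def sgn_if)

lemma \<epsilon>_nz [simp]: "\<epsilon> \<noteq> 0" using \<epsilon> by auto

lemma periodic:
  "\<gamma> (t + of_int n) = \<gamma> t" "\<gamma>1 (t + of_int n) = \<gamma>1 t" "\<gamma>2 (t + of_int n) = \<gamma>2 t"
proof -
  obtain s :: real where s: "s \<in> {1, -1}" "\<And>n t. nderiv n \<gamma> (t + 1) = s *\<^sub>R nderiv n \<gamma> t"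
    by (rule lift_shift) blast
  have sh: "\<gamma> (t + 1) = s *\<^sub>R \<gamma> t" "\<gamma>1 (t + 1) = s *\<^sub>R \<gamma>1 t" "\<gamma>2 (t + 1) = s *\<^sub>R \<gamma>2 t" for t
    using s(2)[of 0 t] s(2)[of 1 t] s(2)[of 2 t] unfolding \<gamma>1_def \<gamma>2_def by simp_all
  have "s = 1"
  proof (rule ccontr)
    assume "s \<noteq> 1"
    then have "s = -1" using s(1) by auto
    then have "\<gamma>2 (0 + 1) \<bullet> cross3 (\<gamma> (0 + 1)) (\<gamma>1 (0 + 1)) = - (\<gamma>2 0 \<bullet> cross3 (\<gamma> 0) (\<gamma>1 0))"
      unfolding sh by simp
    moreover have "sgn (\<gamma>2 (0 + 1) \<bullet> cross3 (\<gamma> (0 + 1)) (\<gamma>1 (0 + 1))) = sgn (\<gamma>2 0 \<bullet> cross3 (\<gamma> 0) (\<gamma>1 0))"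
      by (rule sgn_constant[OF curvature_continuous curvature_nz])
    ultimately show False using curvature_nz[of 0] by (simp add: sgn_if split: if_splits)
  qed
  then have sh: "\<gamma> (t + 1) = \<gamma> t" "\<gamma>1 (t + 1) = \<gamma>1 t" "\<gamma>2 (t + 1) = \<gamma>2 t" for t
    using sh by simp_all
  show "\<gamma> (t + of_int n) = \<gamma> t" "\<gamma>1 (t + of_int n) = \<gamma>1 t" "\<gamma>2 (t + of_int n) = \<gamma>2 t"
    by (rule periodic_int[where f = \<gamma>], rule sh) (rule periodic_int[where f = \<gamma>1], rule sh,
        rule periodic_int[where f = \<gamma>2], rule sh)
qed

lemma periodic_N: "N (t + of_int n) = N t" "N1 (t + of_int n) = N1 t"
  by (simp_all add: N_def N1_def periodic)

lemma N_deriv: "(N has_vector_derivative N1 t) (at t)"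
proof -
  have "((\<lambda>t. cross3 (\<gamma> t) (\<gamma>1 t)) has_vector_derivative cross3 (\<gamma> t) (\<gamma>2 t) + cross3 (\<gamma>1 t) (\<gamma>1 t)) (at t)"
    by (rule bounded_bilinear.has_vector_derivative[OF bounded_bilinear_cross3 derivs])
  then have "((\<lambda>t. \<epsilon> *\<^sub>R cross3 (\<gamma> t) (\<gamma>1 t)) has_vector_derivative \<epsilon> *\<^sub>R (cross3 (\<gamma> t) (\<gamma>2 t))) (at t)"
    using bounded_linear.has_vector_derivative[OF bounded_linear_scaleR_right] by fastforce
  then show ?thesis unfolding N_def N1_def .
qed

lemma continuous_N: "continuous_on UNIV N" "continuous_on UNIV N1"
  unfolding N_def N1_def by (intro continuous_intros continuous_on_cross continuous)+

lemma N_simps: "N t \<bullet> \<gamma> t = 0" "\<gamma> t \<bullet> N t = 0" "N t \<bullet> \<gamma>1 t = 0" "\<gamma>1 t \<bullet> N t = 0"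
  "N t \<bullet> N t = \<gamma>1 t \<bullet> \<gamma>1 t"
proof -
  show "N t \<bullet> \<gamma> t = 0" "\<gamma> t \<bullet> N t = 0" "N t \<bullet> \<gamma>1 t = 0" "\<gamma>1 t \<bullet> N t = 0"
    by (simp_all add: N_def dot_cross_self)
  have "N t \<bullet> N t = (\<epsilon> * \<epsilon>) * (cross3 (\<gamma> t) (\<gamma>1 t) \<bullet> cross3 (\<gamma> t) (\<gamma>1 t))"
    unfolding N_def by (simp only: inner_scaleR_left inner_scaleR_right mult_ac)
  then show "N t \<bullet> N t = \<gamma>1 t \<bullet> \<gamma>1 t" by (simp add: dot_cross \<gamma>_simps)
qed

lemma N_nz: "N t \<noteq> 0" using N_simps(5)[of t] v_pos[of t] by auto

lemma N1_simps: "N1 t \<bullet> \<gamma> t = 0" "\<gamma> t \<bullet> N1 t = 0" "N1 t \<bullet> \<gamma>1 t = - k t" "\<gamma>1 t \<bullet> N1 t = - k t" "N1 t \<bullet> N t = \<gamma>1 t \<bullet> \<gamma>2 t"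
proof -
  show g: "N1 t \<bullet> \<gamma> t = 0" "\<gamma> t \<bullet> N1 t = 0"
    by (simp_all add: N1_def dot_cross_self inner_commute[of "cross3 _ _"])
  have "cross3 (\<gamma> t) (\<gamma>2 t) \<bullet> \<gamma>1 t = - (\<gamma>2 t \<bullet> cross3 (\<gamma> t) (\<gamma>1 t))"
    using cross_triple[of "\<gamma> t" "\<gamma>2 t" "\<gamma>1 t"] cross_triple[of "\<gamma>2 t" "\<gamma>1 t" "\<gamma> t"] cross_skew[of "\<gamma>1 t" "\<gamma> t"]
    by (simp add: inner_commute)
  then show a: "N1 t \<bullet> \<gamma>1 t = - k t" by (simp add: N1_def k_def N_def)
  then show "\<gamma>1 t \<bullet> N1 t = - k t" by (simp add: inner_commute)
  have "N1 t \<bullet> N t = (\<epsilon> * \<epsilon>) * (cross3 (\<gamma> t) (\<gamma>2 t) \<bullet> cross3 (\<gamma> t) (\<gamma>1 t))"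
    unfolding N1_def N_def by (simp only: inner_scaleR_left inner_scaleR_right mult_ac)
  then show "N1 t \<bullet> N t = \<gamma>1 t \<bullet> \<gamma>2 t" by (simp add: dot_cross \<gamma>_simps inner_commute)
qed

lemma frame_zero: "y \<bullet> \<gamma> t = 0 \<Longrightarrow> y \<bullet> \<gamma>1 t = 0 \<Longrightarrow> y \<bullet> N t = 0 \<Longrightarrow> y = 0"
  by (rule orthogonal_to_frame[of _ "\<gamma> t" "\<gamma>1 t"]) (use N_nz[of t] in \<open>auto simp: N_def\<close>)

lemma frame:
  "x = (x \<bullet> \<gamma> t) *\<^sub>R \<gamma> t + (x \<bullet> \<gamma>1 t / (\<gamma>1 t \<bullet> \<gamma>1 t)) *\<^sub>R \<gamma>1 t + (x \<bullet> N t / (\<gamma>1 t \<bullet> \<gamma>1 t)) *\<^sub>R N t"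
proof -
  have "x - ((x \<bullet> \<gamma> t) *\<^sub>R \<gamma> t + (x \<bullet> \<gamma>1 t / (\<gamma>1 t \<bullet> \<gamma>1 t)) *\<^sub>R \<gamma>1 t + (x \<bullet> N t / (\<gamma>1 t \<bullet> \<gamma>1 t)) *\<^sub>R N t) = 0"
    by (rule frame_zero[of _ t])
       (use \<gamma>1_nz[of t] in \<open>simp_all add: inner_diff_left inner_add_left \<gamma>_simps N_simps\<close>)
  then show ?thesis by simp
qed

lemma N1_frame: "N1 t = (\<gamma>1 t \<bullet> \<gamma>2 t / (\<gamma>1 t \<bullet> \<gamma>1 t)) *\<^sub>R N t - (k t / (\<gamma>1 t \<bullet> \<gamma>1 t)) *\<^sub>R \<gamma>1 t"
  using frame[of "N1 t" t] by (simp add: N1_simps)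

lemma N_cross: "cross3 (\<gamma> t) (\<gamma>1 t) = \<epsilon> *\<^sub>R N t" "cross3 (\<gamma>1 t) (N t) = (\<epsilon> * (\<gamma>1 t \<bullet> \<gamma>1 t)) *\<^sub>R \<gamma> t"
  "cross3 (N t) (\<gamma> t) = \<epsilon> *\<^sub>R \<gamma>1 t"
proof -
  show "cross3 (\<gamma> t) (\<gamma>1 t) = \<epsilon> *\<^sub>R N t" by (simp add: N_def)
  show "cross3 (\<gamma>1 t) (N t) = (\<epsilon> * (\<gamma>1 t \<bullet> \<gamma>1 t)) *\<^sub>R \<gamma> t"
    by (simp add: N_def cross_mult_right Lagrange \<gamma>_simps)
  have "cross3 (cross3 (\<gamma> t) (\<gamma>1 t)) (\<gamma> t) = \<gamma>1 t"
    using Lagrange[of "\<gamma> t" "\<gamma> t" "\<gamma>1 t"] by (subst cross_skew) (simp add: \<gamma>_simps)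
  then show "cross3 (N t) (\<gamma> t) = \<epsilon> *\<^sub>R \<gamma>1 t" by (simp add: N_def cross_mult_left)
qed

lemma tvec_eq: "rp2_tvec K t = sgn (\<gamma>1 t)"
  unfolding rp2_tvec_def \<gamma>1_def \<gamma>_def ..

lemma sgn_\<gamma>1: "sgn (\<gamma>1 t) = \<gamma>1 t /\<^sub>R norm (\<gamma>1 t)" "norm (sgn (\<gamma>1 t)) = 1"
  using \<gamma>1_nz by (simp_all add: sgn_div_norm)

lemma tangent_polar: "rp2_tangent K t = polar (N t)"
proof -
  have "rp2_tangent K t = polar (cross3 (\<gamma> t) (sgn (\<gamma>1 t)))"
    unfolding rp2_tangent_def tvec_eq \<gamma>_def[symmetric]
    by (rule rp2_geodesic_eq_polar) (simp_all add: sgn_\<gamma>1 \<gamma>_simps \<gamma>1_nz)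
  also have "cross3 (\<gamma> t) (sgn (\<gamma>1 t)) = (\<epsilon> / norm (\<gamma>1 t)) *\<^sub>R N t"
    by (simp add: sgn_\<gamma>1 cross_mult_right N_cross divide_inverse mult.commute)
  finally show ?thesis by (simp add: polar_scale \<gamma>1_nz)
qed

lemma normal_polar: "rp2_normal K t = polar (\<gamma>1 t)"
proof -
  have c: "cross3 (\<gamma> t) (sgn (\<gamma>1 t)) = (\<epsilon> / norm (\<gamma>1 t)) *\<^sub>R N t"
    by (simp add: sgn_\<gamma>1 cross_mult_right N_cross divide_inverse mult.commute)
  have nn: "norm (N t) = norm (\<gamma>1 t)" by (simp add: norm_eq_sqrt_inner N_simps)
  have "rp2_normal K t = polar (cross3 (\<gamma> t) ((\<epsilon> / norm (\<gamma>1 t)) *\<^sub>R N t))"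
    unfolding rp2_normal_def tvec_eq \<gamma>_def[symmetric] c
    by (rule rp2_geodesic_eq_polar) (use \<epsilon> in \<open>auto simp: N_simps nn \<gamma>1_nz\<close>)
  also have "cross3 (\<gamma> t) ((\<epsilon> / norm (\<gamma>1 t)) *\<^sub>R N t) = (- 1 / norm (\<gamma>1 t)) *\<^sub>R \<gamma>1 t"
    by (subst cross_skew) (simp add: cross_mult_left N_cross)
  finally show ?thesis using \<gamma>1_nz polar_scale[of "- 1 / norm (\<gamma>1 t)" "\<gamma>1 t"] by simp
qed

lemma tangent_eq_iff: "rp2_tangent K s = rp2_tangent K t \<longleftrightarrow> \<gamma> s \<bullet> N t = 0 \<and> \<gamma>1 s \<bullet> N t = 0"
proof
  assume e: "rp2_tangent K s = rp2_tangent K t"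
  have "rp2_proj (\<gamma> s) \<in> polar (N s)" "rp2_proj (sgn (\<gamma>1 s)) \<in> polar (N s)"
    by (simp_all add: proj_in_polar sgn_\<gamma>1 N_simps \<gamma>1_nz)
  then have "rp2_proj (\<gamma> s) \<in> polar (N t)" "rp2_proj (sgn (\<gamma>1 s)) \<in> polar (N t)"
    using e by (simp_all add: tangent_polar)
  then show "\<gamma> s \<bullet> N t = 0 \<and> \<gamma>1 s \<bullet> N t = 0"
    using \<gamma>1_nz[of s] by (simp add: proj_in_polar sgn_\<gamma>1)
next
  assume h: "\<gamma> s \<bullet> N t = 0 \<and> \<gamma>1 s \<bullet> N t = 0"
  then have n: "N t = (N t \<bullet> N s / (\<gamma>1 s \<bullet> \<gamma>1 s)) *\<^sub>R N s"
    using frame[of "N t" s] by (simp add: inner_commute)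
  then have "N t \<bullet> N s / (\<gamma>1 s \<bullet> \<gamma>1 s) \<noteq> 0" using N_nz[of t] by (metis scaleR_zero_left)
  then show "rp2_tangent K s = rp2_tangent K t" using n polar_scale tangent_polar by metis
qed

lemma normal_eq_iff: "rp2_tangent K q = rp2_normal K p \<longleftrightarrow> \<gamma> p \<bullet> N q = 0 \<and> N p \<bullet> N q = 0"
proof
  assume e: "rp2_tangent K q = rp2_normal K p"
  have "rp2_proj (\<gamma> p) \<in> polar (\<gamma>1 p)" "rp2_proj (sgn (N p)) \<in> polar (\<gamma>1 p)"
    using N_nz[of p] by (simp_all add: proj_in_polar sgn_div_norm N_simps \<gamma>_simps)
  then have "rp2_proj (\<gamma> p) \<in> polar (N q)" "rp2_proj (sgn (N p)) \<in> polar (N q)"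
    using e by (simp_all add: tangent_polar normal_polar)
  then show "\<gamma> p \<bullet> N q = 0 \<and> N p \<bullet> N q = 0"
    using N_nz[of p] by (simp add: proj_in_polar sgn_div_norm)
next
  assume h: "\<gamma> p \<bullet> N q = 0 \<and> N p \<bullet> N q = 0"
  then have n: "N q = (N q \<bullet> \<gamma>1 p / (\<gamma>1 p \<bullet> \<gamma>1 p)) *\<^sub>R \<gamma>1 p"
    using frame[of "N q" p] by (simp add: inner_commute)
  then have "N q \<bullet> \<gamma>1 p / (\<gamma>1 p \<bullet> \<gamma>1 p) \<noteq> 0" using N_nz[of q] by (metis scaleR_zero_left)
  then show "rp2_tangent K q = rp2_normal K p" using n polar_scale tangent_polar normal_polar by metis
qed

lemma reps_K: "reps (K t) = {\<gamma> t, - \<gamma> t}"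
  by (simp add: K_eq reps_rp2_proj)

lemma K_sign: "\<delta> \<in> {1, -1::real} \<Longrightarrow> K t = rp2_proj (\<delta> *\<^sub>R \<gamma> t)"
  by (simp add: K_eq rp2_proj_sign)

lemma antipode_eq: "rp2_antipode K t = rp2_proj (sgn (\<gamma>1 t))"
  unfolding rp2_antipode_def
proof (rule the_equality)
  have d: "rp2_dist (K t) (rp2_proj y) = pi / 2 \<longleftrightarrow> \<gamma> t \<bullet> y = 0" if "norm y = 1" for y
  proof -
    have "\<bar>\<gamma> t \<bullet> y\<bar> \<le> 1" using Cauchy_Schwarz_ineq2[of "\<gamma> t" y] that by simp
    then have "arccos \<bar>\<gamma> t \<bullet> y\<bar> = pi / 2 \<longleftrightarrow> \<bar>\<gamma> t \<bullet> y\<bar> = 0"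
      by (metis abs_ge_zero abs_idempotent arccos_0 arccos_eq_iff abs_zero zero_le_one)
    then show ?thesis using that by (simp add: K_eq rp2_dist_proj)
  qed
  show "rp2_proj (sgn (\<gamma>1 t)) \<in> rp2_tangent K t \<and> rp2_dist (K t) (rp2_proj (sgn (\<gamma>1 t))) = pi / 2"
    using d[OF sgn_\<gamma>1(2)] by (simp add: tangent_polar proj_in_polar sgn_\<gamma>1 N_simps \<gamma>_simps \<gamma>1_nz)
  fix q assume q: "q \<in> rp2_tangent K t \<and> rp2_dist (K t) q = pi / 2"
  then obtain y where y: "q = rp2_proj y" "norm y = 1" "y \<bullet> N t = 0" by (auto simp: tangent_polar polar_def)
  have "\<gamma> t \<bullet> y = 0" using q d[OF y(2)] y(1) by simp
  then have Y: "y = (y \<bullet> \<gamma>1 t / (\<gamma>1 t \<bullet> \<gamma>1 t)) *\<^sub>R \<gamma>1 t"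
    using frame[of y t] y(3) by (simp add: inner_commute)
  have "\<gamma>1 t = norm (\<gamma>1 t) *\<^sub>R sgn (\<gamma>1 t)" using \<gamma>1_nz[of t] by (simp add: sgn_\<gamma>1)
  then obtain c where c: "y = c *\<^sub>R sgn (\<gamma>1 t)" using Y by (metis scaleR_scaleR)
  then have "c \<in> {1, -1}" using y(2) sgn_\<gamma>1(2)[of t] by (auto simp: abs_if split: if_splits)
  then show "q = rp2_proj (sgn (\<gamma>1 t))" using y(1) c rp2_proj_sign by metis
qed

text \<open>It is orthogonal to \<open>\<gamma>1\<close> and to \<open>\<gamma>2\<close>, since
  \<open>\<gamma>2\<close> has inner products \<open>- (\<gamma>1 t \<bullet> \<gamma>1 t)\<close>
  with \<open>\<gamma>\<close> and \<open>k t\<close> with \<open>N\<close>. Its positive component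
  along \<open>\<gamma> t\<close> selects the representative of the center nearer to
  \<open>\<gamma> t\<close>.\<close>

definition center_vec where "center_vec t = k t *\<^sub>R \<gamma> t + (\<gamma>1 t \<bullet> \<gamma>1 t) *\<^sub>R N t"

lemma center_vec_nz: "center_vec t \<noteq> 0"
proof
  assume "center_vec t = 0"
  then have "center_vec t \<bullet> \<gamma> t = 0" by simp
  then show False using k_pos[of t] by (simp add: center_vec_def inner_add_left \<gamma>_simps N_simps)
qed

lemma center_eq: "rp2_center K t = rp2_proj (sgn (center_vec t))"
  unfolding rp2_center_def \<gamma>_def[symmetric] \<gamma>1_def[symmetric] \<gamma>2_def[symmetric]
proof (rule the_equality)
  have n: "norm (sgn (center_vec t)) = 1" using center_vec_nz by (simp add: norm_sgn)
  have "\<gamma>1 t \<bullet> center_vec t = 0" "\<gamma>2 t \<bullet> center_vec t = 0"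
    by (simp_all add: center_vec_def inner_add_right \<gamma>_simps N_simps k_def[symmetric])
  then show "\<exists>y\<in>reps (rp2_proj (sgn (center_vec t))). \<gamma>1 t \<bullet> y = 0 \<and> \<gamma>2 t \<bullet> y = 0"
    using n by (simp add: reps_rp2_proj sgn_div_norm)
  fix c assume "\<exists>y\<in>reps c. \<gamma>1 t \<bullet> y = 0 \<and> \<gamma>2 t \<bullet> y = 0"
  then obtain y where y: "norm y = 1" "c = rp2_proj y" "\<gamma>1 t \<bullet> y = 0" "\<gamma>2 t \<bullet> y = 0"
    using reps_proj by metis
  have Y: "y = (y \<bullet> \<gamma> t) *\<^sub>R \<gamma> t + (y \<bullet> N t / (\<gamma>1 t \<bullet> \<gamma>1 t)) *\<^sub>R N t"
    using frame[of y t] y(3) by (simp add: inner_commute)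
  have "0 = \<gamma>2 t \<bullet> ((y \<bullet> \<gamma> t) *\<^sub>R \<gamma> t + (y \<bullet> N t / (\<gamma>1 t \<bullet> \<gamma>1 t)) *\<^sub>R N t)" using y(4) Y by simp
  also have "\<dots> = - (y \<bullet> \<gamma> t) * (\<gamma>1 t \<bullet> \<gamma>1 t) + (y \<bullet> N t / (\<gamma>1 t \<bullet> \<gamma>1 t)) * k t"
    by (simp add: inner_add_right \<gamma>_simps k_def)
  finally have "y \<bullet> N t / (\<gamma>1 t \<bullet> \<gamma>1 t) = (y \<bullet> \<gamma> t / k t) * (\<gamma>1 t \<bullet> \<gamma>1 t)"
    using k_pos[of t] by (simp add: field_simps)
  then have "y = (y \<bullet> \<gamma> t / k t) *\<^sub>R center_vec t"
    using Y k_pos[of t] by (simp add: center_vec_def scaleR_add_right)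
  also have "\<dots> = (y \<bullet> \<gamma> t / k t * norm (center_vec t)) *\<^sub>R sgn (center_vec t)"
    using center_vec_nz by (simp add: sgn_div_norm)
  finally obtain b where b: "y = b *\<^sub>R sgn (center_vec t)" by blast
  then have "b \<in> {1, -1}" using y(1) n by (auto simp: abs_if split: if_splits)
  then show "c = rp2_proj (sgn (center_vec t))" using y(2) b rp2_proj_sign by metis
qed

text \<open>In terms of \<open>\<gamma> p\<close> and the unit vector \<open>c\<close> of the
  center, \<open>\<delta> *\<^sub>R \<gamma> q\<close> has the coordinates
  \<open>g - y * k p / a\<close> and \<open>y * m / a\<close>. If neither is negative, it lies on
  the arc to \<open>c\<close>, the shorter one; with opposite signs it lies, up to sign, on the arc
  to \<open>- c\<close>; if the first vanishes, it represents the center.\<close>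

lemma nt_types:
  assumes q: "\<delta> \<in> {1, -1}" "\<delta> *\<^sub>R \<gamma> q = g *\<^sub>R \<gamma> p + y *\<^sub>R N p" "g > 0"
  shows "0 \<le> y \<Longrightarrow> y * k p \<le> g * (\<gamma>1 p \<bullet> \<gamma>1 p) \<Longrightarrow> K q \<in> rp2_normal_plus K p"
    "y < 0 \<or> y * k p > g * (\<gamma>1 p \<bullet> \<gamma>1 p) \<Longrightarrow> K q \<in> rp2_normal_minus K p"
    "y * k p = g * (\<gamma>1 p \<bullet> \<gamma>1 p) \<Longrightarrow> K q = rp2_center K p"
proof -
  define a where "a = \<gamma>1 p \<bullet> \<gamma>1 p"
  define m where "m = norm (center_vec p)"
  define c where "c = sgn (center_vec p)"
  have a: "a > 0" using v_pos by (simp add: a_def)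
  have m: "m > 0" using center_vec_nz by (simp add: m_def)
  have c: "norm c = 1" "center_vec p = m *\<^sub>R c"
    using center_vec_nz by (simp_all add: c_def m_def norm_sgn sgn_div_norm)
  have reps_c: "reps (rp2_center K p) = {c, - c}" unfolding center_eq c_def[symmetric] by (rule reps_rp2_proj[OF c(1)])
  have "m * (\<gamma> p \<bullet> c) = \<gamma> p \<bullet> center_vec p" by (simp add: c(2))
  also have "\<dots> = k p" by (simp add: center_vec_def inner_add_right \<gamma>_simps N_simps)
  finally have gc: "\<gamma> p \<bullet> c > 0" using m k_pos[of p] by (metis zero_less_mult_pos)
  have le: "\<bar>\<gamma> p \<bullet> c\<bar> \<le> 1" using Cauchy_Schwarz_ineq2[of "\<gamma> p" c] c(1) by simp
  have acos: "arccos (\<gamma> p \<bullet> c) < pi / 2" "arccos (\<gamma> p \<bullet> - c) > pi / 2"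
    using arccos_less_arccos[of 0 "\<gamma> p \<bullet> c"] arccos_less_arccos[of "\<gamma> p \<bullet> - c" 0] gc le by (simp_all add: arccos_0)
  have decomp: "\<delta> *\<^sub>R \<gamma> q = (g - y * k p / a) *\<^sub>R \<gamma> p + (y * m / a) *\<^sub>R c"
  proof -
    have "(y * m / a) *\<^sub>R c = (y / a) *\<^sub>R center_vec p" by (simp add: c(2))
    also have "\<dots> = (y * k p / a) *\<^sub>R \<gamma> p + y *\<^sub>R N p"
      using a by (simp add: center_vec_def scaleR_add_right a_def[symmetric])
    finally show ?thesis using q(2) by (simp add: algebra_simps)
  qed
  have norm_q: "norm (\<delta> *\<^sub>R \<gamma> q) = 1" using q(1) by auto
  have Kq: "K q = rp2_proj (sgn (\<delta> *\<^sub>R \<gamma> q))" "K q = rp2_proj (sgn (- (\<delta> *\<^sub>R \<gamma> q)))"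
    using norm_q K_sign[OF q(1), of q] by (simp_all add: sgn_div_norm rp2_proj_minus)
  have arc: "K q \<in> rp2_arc (\<gamma> p) z" if "r *\<^sub>R \<gamma> p + b *\<^sub>R z \<in> {\<delta> *\<^sub>R \<gamma> q, - (\<delta> *\<^sub>R \<gamma> q)}" "r \<ge> 0" "b \<ge> 0" for r b z
  proof -
    have "r + b > 0"
    proof (rule ccontr)
      assume "\<not> r + b > 0"
      then have "r = 0" "b = 0" using that by auto
      then have "\<delta> *\<^sub>R \<gamma> q = 0" using that(1) by auto
      then show False using norm_q by (metis norm_zero zero_neq_one)
    qed
    moreover have "K q = rp2_proj (sgn (r *\<^sub>R \<gamma> p + b *\<^sub>R z))" using that(1) Kq by auto
    ultimately show ?thesis unfolding rp2_arc_def using that by blast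
  qed
  have x: "\<gamma> p \<in> reps (K p)" by (simp add: reps_K)
  have cmp: "y * k p \<le> g * (\<gamma>1 p \<bullet> \<gamma>1 p) \<longleftrightarrow> y * k p / a \<le> g" using a by (simp add: a_def[symmetric] field_simps)
  show "K q \<in> rp2_normal_plus K p" if "0 \<le> y" "y * k p \<le> g * (\<gamma>1 p \<bullet> \<gamma>1 p)"
  proof -
    have "K q \<in> rp2_arc (\<gamma> p) c"
      by (rule arc[of "g - y * k p / a" "y * m / a"]) (use that cmp a m decomp in auto)
    then show ?thesis unfolding rp2_normal_plus_def using x reps_c acos(1) by blast
  qed
  show "K q \<in> rp2_normal_minus K p" if "y < 0 \<or> y * k p > g * (\<gamma>1 p \<bullet> \<gamma>1 p)"
  proof -
    have "K q \<in> rp2_arc (\<gamma> p) (- c)"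
    proof (cases "y < 0")
      case True
      then have "y * k p / a < 0" using k_pos[of p] a by (simp add: divide_neg_pos mult_neg_pos)
      moreover have "- (y * m / a) \<ge> 0" using True a m by (simp add: mult_nonpos_nonneg divide_nonpos_pos)
      ultimately show ?thesis
        using q(3) decomp by (intro arc[of "g - y * k p / a" "- (y * m / a)"]) auto
    next
      case False
      then have "- (g - y * k p / a) \<ge> 0" "y * m / a \<ge> 0" using that cmp a m by auto
      then show ?thesis
        using decomp by (intro arc[of "- (g - y * k p / a)" "y * m / a"]) (auto simp: algebra_simps)
    qed
    then show ?thesis unfolding rp2_normal_minus_def using x reps_c acos(2) by blast
  qed
  show "K q = rp2_center K p" if e: "y * k p = g * (\<gamma>1 p \<bullet> \<gamma>1 p)"
  proof -
    have "g - y * k p / a = 0" using a unfolding e by (simp add: a_def)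
    then have d: "\<delta> *\<^sub>R \<gamma> q = (y * m / a) *\<^sub>R c" using decomp by simp
    then have "\<bar>y * m / a\<bar> = 1" using norm_q c(1) by (metis mult.right_neutral norm_scaleR)
    then have "y * m / a \<in> {1, -1}" by (auto simp: abs_if split: if_splits)
    then have "rp2_proj (\<delta> *\<^sub>R \<gamma> q) = rp2_proj c" unfolding d by (rule rp2_proj_sign)
    then show ?thesis using K_sign[OF q(1), of q] by (simp add: center_eq c_def)
  qed
qed

lemma near_tangent_side:
  assumes "c > 0" "\<delta> \<in> {1, -1}"
  shows "near_in K s (rp2_half_disk (\<delta> *\<^sub>R \<gamma> s) (c *\<^sub>R \<delta> *\<^sub>R N s))"
proof -
  have dd: "\<delta> * \<delta> = 1" using assms(2) by auto
  have "\<forall>\<^sub>F u in at s. (\<gamma> u - 0) \<bullet> N s > 0"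
    by (rule eventually_second_order_inner_pos[OF derivs]) (use k_pos in \<open>auto simp: k_def N_simps\<close>)
  moreover have "\<forall>\<^sub>F u in at s. \<gamma> u \<bullet> \<gamma> s > 0"
  proof (rule order_tendstoD(1))
    show "((\<lambda>u. \<gamma> u \<bullet> \<gamma> s) \<longlongrightarrow> \<gamma> s \<bullet> \<gamma> s) (at s)"
      by (intro tendsto_intros) (metis continuous(1) continuous_on_eq_continuous_at isCont_def open_UNIV UNIV_I)
  qed (simp add: \<gamma>_simps)
  ultimately show ?thesis
    unfolding near_in_def
  proof eventually_elim
    case (elim u)
    have "(\<delta> *\<^sub>R \<gamma> u) \<bullet> (\<delta> *\<^sub>R \<gamma> s) = (\<delta> * \<delta>) * (\<gamma> u \<bullet> \<gamma> s)"
      "(\<delta> *\<^sub>R \<gamma> u) \<bullet> (c *\<^sub>R \<delta> *\<^sub>R N s) = c * (\<delta> * \<delta>) * (\<gamma> u \<bullet> N s)"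
      by (simp_all add: mult_ac)
    then have "(\<delta> *\<^sub>R \<gamma> u) \<bullet> (\<delta> *\<^sub>R \<gamma> s) > 0" "(\<delta> *\<^sub>R \<gamma> u) \<bullet> (c *\<^sub>R \<delta> *\<^sub>R N s) > 0"
      using elim assms(1) by (simp_all only: dd) simp_all
    moreover have "norm (\<delta> *\<^sub>R \<gamma> u) = 1" using assms(2) by auto
    ultimately show ?case unfolding rp2_half_disk_def using K_sign[OF assms(2), of u] by blast
  qed
qed

text \<open>The representatives \<open>\<gamma> s\<close> and
  \<open>\<delta> *\<^sub>R \<gamma> t\<close> are less than \<open>pi / 2\<close> apart, hence
  joined by a lift of the short segment. Passing to the antipodal curve reverses the normal towards
  which it bends, so the sides are compared by the sign of
  \<open>\<delta> * (N s \<bullet> N t)\<close>.\<close>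

lemma rp2_sidesI:
  assumes st: "\<gamma> s \<bullet> N t = 0" "\<gamma>1 s \<bullet> N t = 0" and \<delta>: "\<delta> \<in> {1, -1}" "\<delta> * (\<gamma> s \<bullet> \<gamma> t) > 0"
    and \<tau>: "\<tau> \<in> {1, -1}" "\<tau> * (\<delta> * (N s \<bullet> N t)) > 0"
  shows "rp2_sides K s t \<tau>"
proof -
  define n where "n = (1 / norm (N s)) *\<^sub>R 1 *\<^sub>R N s"
  have n: "norm n = 1" "n = (1 / norm (N s)) *\<^sub>R N s" using N_nz[of s] by (simp_all add: n_def)
  have "near_in K s (rp2_half_disk (1 *\<^sub>R \<gamma> s) n)"
    unfolding n_def by (rule near_tangent_side) (use N_nz in auto)
  then have sn: "near_in K s (rp2_half_disk (\<gamma> s) n)" by simp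
  have "N t = (N t \<bullet> N s / (\<gamma>1 s \<bullet> \<gamma>1 s)) *\<^sub>R N s" using frame[of "N t" s] st by (simp add: inner_commute)
  then obtain b where b: "N t = b *\<^sub>R N s" by blast
  have "b \<noteq> 0" using b N_nz[of t] by auto
  have "\<tau> * (\<delta> * (N s \<bullet> N t)) = (\<tau> * \<delta> * b) * (\<gamma>1 s \<bullet> \<gamma>1 s)" by (simp add: b N_simps)
  then have pos: "\<tau> * \<delta> * b > 0" using \<tau>(2) v_pos[of s] zero_less_mult_pos2 by metis
  define d where "d = \<tau> * \<delta> / (b * norm (N s))"
  have "b * b > 0" using \<open>b \<noteq> 0\<close> by (metis not_real_square_gt_zero)
  with pos have "(\<tau> * \<delta> * b) / (b * b) > 0" by (rule divide_pos_pos)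
  then have "\<tau> * \<delta> / b > 0" using \<open>b \<noteq> 0\<close> by simp
  moreover have "d = \<tau> * \<delta> / b / norm (N s)" by (simp add: d_def)
  ultimately have d: "d > 0" using N_nz[of s] divide_pos_pos zero_less_norm_iff by metis
  have "\<tau> *\<^sub>R n = d *\<^sub>R \<delta> *\<^sub>R N t"
    using \<delta>(1) \<open>b \<noteq> 0\<close> by (auto simp: n(2) d_def b)
  then have tn: "near_in K t (rp2_half_disk (\<delta> *\<^sub>R \<gamma> t) (\<tau> *\<^sub>R n))"
    using near_tangent_side[OF d \<delta>(1), of t] by simp
  have "\<bar>\<gamma> s \<bullet> (\<delta> *\<^sub>R \<gamma> t)\<bar> \<le> 1" using Cauchy_Schwarz_ineq2[of "\<gamma> s" "\<delta> *\<^sub>R \<gamma> t"] \<delta>(1) by auto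
  then have acos: "arccos (\<gamma> s \<bullet> (\<delta> *\<^sub>R \<gamma> t)) < pi / 2"
    using arccos_less_arccos[of 0 "\<gamma> s \<bullet> (\<delta> *\<^sub>R \<gamma> t)"] \<delta>(2) by (simp add: arccos_0)
  have "\<forall>q\<in>rp2_tangent K s. \<forall>z\<in>reps q. z \<bullet> n = 0"
    by (auto simp: tangent_polar polar_def reps_rp2_proj n(2))
  moreover have "\<gamma> s \<in> reps (K s)" "\<delta> *\<^sub>R \<gamma> t \<in> reps (K t)" using \<delta>(1) by (auto simp: reps_K)
  ultimately show ?thesis unfolding rp2_sides_def using acos sn tn n(1) by blast
qed

text \<open>As in the plane with a radial coordinate added:
  \<open>\<delta> *\<^sub>R \<gamma> u\<close> is expanded along the base point, the tangent and
  \<open>w\<close>. The first coefficient is positive by continuity, that of \<open>w\<close> by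
  convexity, and that of the tangent changes sign with \<open>u - s\<close>.\<close>

lemma branch_rp2_angle:
  assumes \<delta>: "\<delta> \<in> {1, -1}" and e: "e \<in> {1, -1}" and w: "w \<bullet> \<gamma> s = 0" "w \<bullet> (\<delta> *\<^sub>R N s) > 0"
  shows "branch_in K (s, e) (rp2_angle (\<delta> *\<^sub>R \<gamma> s) ((e * \<delta>) *\<^sub>R rp2_tvec K s) w)"
proof (rule branch_inI[OF _ e])
  have dd: "\<delta> * \<delta> = 1" using \<delta> by auto
  define x where "x = \<delta> *\<^sub>R \<gamma> s"
  define T where "T = \<delta> *\<^sub>R rp2_tvec K s"
  define M where "M = \<delta> *\<^sub>R N s"
  define Y where "Y u = \<delta> *\<^sub>R \<gamma> u" for u
  have norm_Y: "norm (Y u) = 1" for u using \<delta> by (auto simp: Y_def)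
  have T: "T = (\<delta> / norm (\<gamma>1 s)) *\<^sub>R \<gamma>1 s" by (simp add: T_def tvec_eq sgn_\<gamma>1 divide_inverse)
  have dY: "(Y has_vector_derivative \<delta> *\<^sub>R \<gamma>1 t) (at t)" "((\<lambda>t. \<delta> *\<^sub>R \<gamma>1 t) has_vector_derivative \<delta> *\<^sub>R \<gamma>2 t) (at t)" for t
    unfolding Y_def by (rule bounded_linear.has_vector_derivative[OF bounded_linear_scaleR_right derivs(1)]
        bounded_linear.has_vector_derivative[OF bounded_linear_scaleR_right derivs(2)])+
  have frame_simps: "x \<bullet> x = 1" "x \<bullet> T = 0" "T \<bullet> x = 0" "T \<bullet> T = 1" "T \<bullet> M = 0" "x \<bullet> M = 0"
    "(\<delta> *\<^sub>R \<gamma>1 s) \<bullet> M = 0" "(\<delta> *\<^sub>R \<gamma>1 s) \<bullet> T = norm (\<gamma>1 s)" "(\<delta> *\<^sub>R \<gamma>2 s) \<bullet> M = k s"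
    using dd \<gamma>1_nz[of s]
    by (auto simp: x_def T M_def \<gamma>_simps N_simps k_def power2_eq_square dot_square_norm mult.assoc[symmetric])
  have wx: "w \<bullet> x = 0" "w \<bullet> M > 0" using w by (simp_all add: x_def M_def)
  define b where "b u = ((Y u - x) \<bullet> M) / (w \<bullet> M)" for u
  define a where "a u = (Y u - x) \<bullet> T - b u * (w \<bullet> T)" for u
  have "\<forall>\<^sub>F u in at s. (Y u - x) \<bullet> M > 0"
    by (rule eventually_second_order_inner_pos[OF dY]) (use k_pos frame_simps in \<open>auto simp: Y_def x_def\<close>)
  moreover have "\<forall>\<^sub>F u in at s. Y u \<bullet> x > 0"
  proof (rule order_tendstoD(1))
    show "((\<lambda>u. Y u \<bullet> x) \<longlongrightarrow> Y s \<bullet> x) (at s)"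
      unfolding Y_def
      by (intro tendsto_intros) (metis continuous(1) continuous_on_eq_continuous_at isCont_def open_UNIV UNIV_I)
    show "0 < Y s \<bullet> x" using frame_simps(1) by (simp add: Y_def x_def)
  qed
  moreover have "\<forall>\<^sub>F u in at s. sgn (a u) = sgn (u - s)"
  proof (rule eventually_sgn_of_derivative_pos)
    show "(a has_real_derivative (\<delta> *\<^sub>R \<gamma>1 s) \<bullet> T - ((\<delta> *\<^sub>R \<gamma>1 s) \<bullet> M) / (w \<bullet> M) * (w \<bullet> T)) (at s)"
      unfolding a_def b_def
      by (intro DERIV_diff DERIV_cmult_right DERIV_cdivide has_real_derivative_inner dY)
    show "(\<delta> *\<^sub>R \<gamma>1 s) \<bullet> T - ((\<delta> *\<^sub>R \<gamma>1 s) \<bullet> M) / (w \<bullet> M) * (w \<bullet> T) > 0"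
      unfolding frame_simps using \<gamma>1_nz[of s] by simp
  qed (simp add: a_def b_def Y_def x_def)
  ultimately show "\<forall>\<^sub>F u in at s. sgn (u - s) = e \<longrightarrow> K u \<in> rp2_angle (\<delta> *\<^sub>R \<gamma> s) ((e * \<delta>) *\<^sub>R rp2_tvec K s) w"
  proof eventually_elim
    case (elim u)
    define y where "y = Y u - ((Y u \<bullet> x) *\<^sub>R x + a u *\<^sub>R T + b u *\<^sub>R w)"
    have b: "b u = (Y u \<bullet> M) / (w \<bullet> M)" "a u = Y u \<bullet> T - b u * (w \<bullet> T)"
      using frame_simps by (simp_all add: b_def a_def inner_diff_left)
    have "y \<bullet> x = 0" "y \<bullet> T = 0" "y \<bullet> M = 0"
      using frame_simps wx by (simp_all add: y_def inner_diff_left inner_add_left b)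
    then have "y = 0" using \<delta> \<gamma>1_nz[of s] by (intro frame_zero[of y s]) (auto simp: x_def T M_def)
    then have X: "Y u = (Y u \<bullet> x) *\<^sub>R x + a u *\<^sub>R T + b u *\<^sub>R w" by (simp add: y_def)
    have bu: "b u > 0" using elim(1) wx(2) unfolding b_def by (rule divide_pos_pos)
    show ?case
    proof
      assume "sgn (u - s) = e"
      then have a: "a u *\<^sub>R T = \<bar>a u\<bar> *\<^sub>R (e *\<^sub>R T)" "\<bar>a u\<bar> > 0"
        using elim(3) e by (auto simp: sgn_if split: if_splits)
      have "(\<bar>a u\<bar> *\<^sub>R (e *\<^sub>R T) + b u *\<^sub>R w) \<bullet> M = b u * (w \<bullet> M)"
        using frame_simps by (simp add: inner_add_left)
      then have nz: "\<bar>a u\<bar> *\<^sub>R (e *\<^sub>R T) + b u *\<^sub>R w \<noteq> 0" using bu wx(2) by auto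
      have "rp2_proj (Y u) \<in> rp2_angle x (e *\<^sub>R T) w"
      proof (rule rp2_angleI[OF _ norm_Y _ _ wx(1) elim(2) a(2) bu nz])
        show "Y u = (Y u \<bullet> x) *\<^sub>R x + \<bar>a u\<bar> *\<^sub>R e *\<^sub>R T + b u *\<^sub>R w" using X a(1) by simp
        show "norm x = 1" using frame_simps(1) by (simp add: norm_eq_sqrt_inner)
        show "(e *\<^sub>R T) \<bullet> x = 0" using frame_simps by simp
      qed
      moreover have "K u = rp2_proj (Y u)" unfolding Y_def by (rule K_sign[OF \<delta>])
      ultimately show "K u \<in> rp2_angle (\<delta> *\<^sub>R \<gamma> s) ((e * \<delta>) *\<^sub>R rp2_tvec K s) w"
        by (simp add: T_def x_def)
    qed
  qed
qed

lemma crossing_types: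
  assumes x: "rp2_crossing K s t" and \<delta>: "\<delta> \<in> {1, -1}" "\<gamma> t = \<delta> *\<^sub>R \<gamma> s" and nz: "\<gamma>1 s \<bullet> N t \<noteq> 0"
  shows "\<delta> * (N s \<bullet> N t) > 0 \<Longrightarrow> rp2_crossing_type1 K s t"
    "\<delta> * (N s \<bullet> N t) < 0 \<Longrightarrow> rp2_crossing_type2 K s t"
proof -
  define v where "v = rp2_tvec K s"
  define w where "w = rp2_tvec K t"
  have dd: "\<delta> * \<delta> = 1" using \<delta>(1) by auto
  have x0: "\<gamma> s = \<delta> *\<^sub>R \<gamma> t" using \<delta> dd by simp
  have st: "s \<noteq> t" using x by (auto simp: rp2_crossing_def rp2_self_intersection_def)
  have v: "v = \<gamma>1 s /\<^sub>R norm (\<gamma>1 s)" "w = \<gamma>1 t /\<^sub>R norm (\<gamma>1 t)" "norm v = 1" "norm w = 1"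
    using \<gamma>1_nz by (simp_all add: v_def w_def tvec_eq sgn_\<gamma>1)
  have perp: "\<gamma>1 s \<bullet> \<gamma> t = 0" "\<gamma> t \<bullet> \<gamma>1 s = 0" "\<gamma> s \<bullet> \<gamma> t = \<delta>"
    by (simp_all add: \<delta>(2) \<gamma>_simps)
  have perp': "\<gamma>1 t \<bullet> \<gamma> s = 0" "\<gamma> s \<bullet> \<gamma>1 t = 0"
    by (subst x0, simp add: \<gamma>_simps)+
  note perp = perp perp'
  \<comment> \<open>Both tangents are orthogonal to the common base line, so poles and tangents
    enclose the same angle; possibly antipodal base points account for
    \<open>\<delta>\<close>.\<close>
  have NN: "\<delta> * (N s \<bullet> N t) = \<gamma>1 s \<bullet> \<gamma>1 t"
  proof -
    have "N s \<bullet> N t = (\<epsilon> * \<epsilon>) * (cross3 (\<gamma> s) (\<gamma>1 s) \<bullet> cross3 (\<gamma> t) (\<gamma>1 t))"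
      unfolding N_def by (simp only: inner_scaleR_left inner_scaleR_right mult_ac)
    then show ?thesis using dd by (simp add: dot_cross perp mult.assoc[symmetric])
  qed
  have swapN: "\<gamma>1 t \<bullet> N s = - (\<delta> * (\<gamma>1 s \<bullet> N t))"
  proof -
    have "\<gamma>1 t \<bullet> cross3 (\<gamma> t) (\<gamma>1 s) = - (\<gamma>1 s \<bullet> cross3 (\<gamma> t) (\<gamma>1 t))"
      using cross_triple[of "\<gamma> t" "\<gamma>1 s" "\<gamma>1 t"] cross_triple[of "\<gamma>1 s" "\<gamma>1 t" "\<gamma> t"] cross_skew[of "\<gamma>1 t" "\<gamma> t"]
      by (simp add: inner_commute)
    then show ?thesis unfolding N_def x0 by (simp add: cross_mult_left)
  qed
  define \<omega> where "\<omega> = sgn (w \<bullet> N s)"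
  have wN: "w \<bullet> N s = - (\<delta> * (\<gamma>1 s \<bullet> N t)) / norm (\<gamma>1 t)" "v \<bullet> N t = (\<gamma>1 s \<bullet> N t) / norm (\<gamma>1 s)"
    using swapN by (simp_all add: v divide_inverse mult.commute)
  have \<omega>: "\<omega> \<in> {1, -1}" "\<omega> * (w \<bullet> N s) > 0" "- \<omega> * (v \<bullet> (\<delta> *\<^sub>R N t)) > 0"
  proof -
    define d where "d = \<delta> * (\<gamma>1 s \<bullet> N t)"
    have d: "d \<noteq> 0" using nz \<delta>(1) by (auto simp: d_def)
    have e: "w \<bullet> N s = - d / norm (\<gamma>1 t)" "v \<bullet> (\<delta> *\<^sub>R N t) = d / norm (\<gamma>1 s)" by (simp_all add: wN d_def)
    show "\<omega> \<in> {1, -1}" "\<omega> * (w \<bullet> N s) > 0" "- \<omega> * (v \<bullet> (\<delta> *\<^sub>R N t)) > 0"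
      using d \<gamma>1_nz[of s] \<gamma>1_nz[of t] unfolding \<omega>_def e
      by (auto simp: sgn_if divide_less_0_iff zero_less_divide_iff)
  qed
  have B1: "branch_in K (s, e) (rp2_angle (\<gamma> s) (e *\<^sub>R v) (\<omega> *\<^sub>R w))" if e: "e \<in> {1, -1}" for e
    using branch_rp2_angle[of 1 e "\<omega> *\<^sub>R w" s] e \<omega>(2) by (simp add: v_def v(2) perp)
  have swap: "rp2_angle x a b = rp2_angle x b a" for x a b
  proof -
    have "rp2_angle x a b \<subseteq> rp2_angle x b a" for a b
    proof
      fix q assume "q \<in> rp2_angle x a b"
      then obtain r c d where "0 < r" "r < pi / 2" "0 < c" "0 < d"
        "q = rp2_proj (cos r *\<^sub>R x + sin r *\<^sub>R sgn (d *\<^sub>R b + c *\<^sub>R a))"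
        unfolding rp2_angle_def by (auto simp: add.commute)
      then show "q \<in> rp2_angle x b a" unfolding rp2_angle_def by blast
    qed
    then show ?thesis by blast
  qed
  \<comment> \<open>If the lifts at \<open>s\<close> and \<open>t\<close> are antipodal, the
    antipodal map carries the branch at \<open>t\<close> to \<open>\<gamma> s\<close> and reverses
    the direction in which it leaves; the index \<open>\<delta> * e\<close> undoes this.\<close>
  have B2: "branch_in K (t, \<delta> * e) (rp2_angle (\<gamma> s) (- \<omega> *\<^sub>R v) (e *\<^sub>R w))" if e: "e \<in> {1, -1}" for e
  proof -
    have de: "\<delta> * e \<in> {1, -1}" using e \<delta>(1) by auto
    have "branch_in K (t, \<delta> * e) (rp2_angle (\<delta> *\<^sub>R \<gamma> t) ((\<delta> * e * \<delta>) *\<^sub>R rp2_tvec K t) (- \<omega> *\<^sub>R v))"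
    proof (rule branch_rp2_angle[OF \<delta>(1) de])
      show "(- \<omega> *\<^sub>R v) \<bullet> \<gamma> t = 0" by (simp add: v(1) perp)
      show "(- \<omega> *\<^sub>R v) \<bullet> (\<delta> *\<^sub>R N t) > 0" using \<omega>(3) by (simp only: inner_scaleR_left)
    qed
    moreover have "\<delta> * e * \<delta> = e" using \<delta>(1) by auto
    ultimately show ?thesis by (simp add: swap[of "\<gamma> s"] w_def x0[symmetric])
  qed
  note br = crossing_branches[OF st \<omega>(1) \<delta>(1) B1 B2]
  have vw: "v \<bullet> w = (\<gamma>1 s \<bullet> \<gamma>1 t) / (norm (\<gamma>1 s) * norm (\<gamma>1 t))"
    by (simp add: v divide_inverse mult_ac)
  have le: "\<bar>v \<bullet> w\<bar> \<le> 1" using Cauchy_Schwarz_ineq2[of v w] v by simp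
  have acos: "arccos y < pi / 2" if "0 < y" "y \<le> 1" for y :: real
    using arccos_less_arccos[of 0 y] that by (simp add: arccos_0)
  show "rp2_crossing_type1 K s t" if "\<delta> * (N s \<bullet> N t) > 0"
  proof -
    have "v \<bullet> w > 0" using that \<gamma>1_nz unfolding NN by (simp add: vw)
    then have "(rp2_angle (\<gamma> s) v w, rp2_angle (\<gamma> s) (- v) (- w)) \<in> rp2_acute_angles K s t"
      unfolding rp2_acute_angles_def \<gamma>_def[symmetric] using acos[of "v \<bullet> w"] le v_def w_def by force
    then show ?thesis unfolding rp2_crossing_type1_def using br(1) by blast
  qed
  show "rp2_crossing_type2 K s t" if "\<delta> * (N s \<bullet> N t) < 0"
  proof -
    have "v \<bullet> w < 0" using that \<gamma>1_nz unfolding NN by (simp add: vw divide_less_0_iff)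
    then have "(rp2_angle (\<gamma> s) v (- w), rp2_angle (\<gamma> s) (- v) (- (- w))) \<in> rp2_acute_angles K s t"
      unfolding rp2_acute_angles_def \<gamma>_def[symmetric] using acos[of "- (v \<bullet> w)"] le v_def w_def by force
    then show ?thesis unfolding rp2_crossing_type2_def using br(2) by force
  qed
qed

end

section \<open>Projective curves: pair conditions and signed counts\<close>

locale generic_rp2_curve = locally_convex_rp2_curve +
  assumes generic: "rp2_generic K" and no_antipodal: "rp2_antipodal_pairs K = {}"
begin

lemma separation:
  "\<exists>\<eta>>0. \<forall>p q. \<gamma> p \<bullet> N q = 0 \<longrightarrow> p - q \<notin> \<int> \<longrightarrow> 1 - cos (2 * pi * (p - q)) > \<eta>"
proof -
  obtain \<eta> where "\<eta> > 0" "\<And>p q. \<gamma> p \<bullet> N q = 0 \<Longrightarrow> p - q \<notin> \<int> \<Longrightarrow> 1 - cos (2 * pi * (p - q)) > \<eta>"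
    by (rule diagonal_isolated[OF derivs continuous(3) continuous_N(1)])
       (use k_pos in \<open>auto simp: periodic periodic_N N_simps k_def\<close>)
  then show ?thesis by blast
qed

lemma double_tangency_iff:
  "rp2_double_tangency K s t \<longleftrightarrow> s \<in> params \<and> t \<in> params \<and> s \<noteq> t \<and> \<gamma> s \<bullet> N t = 0 \<and> \<gamma>1 s \<bullet> N t = 0"
  by (simp add: rp2_double_tangency_def tangent_eq_iff)

lemma nt_pair_iff:
  "(p, q) \<in> rp2_nt_pairs K \<longleftrightarrow> p \<in> params \<and> q \<in> params \<and> \<gamma> p \<bullet> N q = 0 \<and> N p \<bullet> N q = 0"
  by (simp add: rp2_nt_pairs_def normal_eq_iff)

lemma meet_sign:
  assumes "\<gamma> p \<bullet> N q = 0" "\<gamma> p \<bullet> \<gamma>1 q = 0" "\<delta> \<in> {1, -1}" "\<delta> * (\<gamma> p \<bullet> \<gamma> q) > 0"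
  shows "\<gamma> p = \<delta> *\<^sub>R \<gamma> q"
proof -
  have g: "\<gamma> p = (\<gamma> p \<bullet> \<gamma> q) *\<^sub>R \<gamma> q" using frame[of "\<gamma> p" q] assms(1,2) by simp
  then have "\<bar>\<gamma> p \<bullet> \<gamma> q\<bar> = 1" by (metis norm_\<gamma> mult.right_neutral norm_scaleR)
  then have "\<gamma> p \<bullet> \<gamma> q = \<delta>" using assms(3,4) by (auto simp: abs_if split: if_splits)
  with g show ?thesis by simp
qed

lemma meet_iff: "K p = K q \<longleftrightarrow> \<gamma> p \<bullet> N q = 0 \<and> \<gamma> p \<bullet> \<gamma>1 q = 0"
proof
  assume "K p = K q"
  then have "\<gamma> p = \<gamma> q \<or> \<gamma> p = - \<gamma> q" by (simp add: K_eq rp2_proj_eq_iff)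
  then show "\<gamma> p \<bullet> N q = 0 \<and> \<gamma> p \<bullet> \<gamma>1 q = 0" by (auto simp: N_simps \<gamma>_simps)
next
  assume h: "\<gamma> p \<bullet> N q = 0 \<and> \<gamma> p \<bullet> \<gamma>1 q = 0"
  then have g: "\<gamma> p = (\<gamma> p \<bullet> \<gamma> q) *\<^sub>R \<gamma> q" using frame[of "\<gamma> p" q] by simp
  then have "\<bar>\<gamma> p \<bullet> \<gamma> q\<bar> = 1" by (metis norm_\<gamma> mult.right_neutral norm_scaleR)
  then have "\<gamma> p \<bullet> \<gamma> q \<in> {1, -1}" by (auto simp: abs_if split: if_splits)
  from K_sign[OF this, of q] g show "K p = K q" using K_eq[of p] by metis
qed

lemma crossing_iff:
  "rp2_crossing K s t \<longleftrightarrow> s \<in> params \<and> t \<in> params \<and> s \<noteq> t \<and> \<gamma> s \<bullet> N t = 0 \<and> \<gamma> s \<bullet> \<gamma>1 t = 0"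
  "rp2_crossing K s t \<Longrightarrow> \<gamma>1 s \<bullet> N t \<noteq> 0 \<and> N s \<bullet> N t \<noteq> 0"
proof -
  have g: "rp2_tangent K t \<noteq> rp2_tangent K s \<and> rp2_tangent K t \<noteq> rp2_normal K s"
    if "rp2_self_intersection K s t"
    using generic that unfolding rp2_generic_def by blast
  then show "rp2_crossing K s t \<longleftrightarrow> s \<in> params \<and> t \<in> params \<and> s \<noteq> t \<and> \<gamma> s \<bullet> N t = 0 \<and> \<gamma> s \<bullet> \<gamma>1 t = 0"
    using meet_iff[of s t] by (auto simp: rp2_crossing_def rp2_self_intersection_def)
  show "\<gamma>1 s \<bullet> N t \<noteq> 0 \<and> N s \<bullet> N t \<noteq> 0" if x: "rp2_crossing K s t"
  proof -
    have "rp2_self_intersection K s t" "K s = K t"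
      using x by (auto simp: rp2_crossing_def rp2_self_intersection_def)
    then show ?thesis using g tangent_eq_iff[of s t] normal_eq_iff[of t s] meet_iff[of s t] by auto
  qed
qed

text \<open>A point on the tangent geodesic of \<open>q\<close> that is orthogonal to
  \<open>\<gamma> q\<close> is the antipode of \<open>q\<close>, so \<open>(q, p)\<close> would be
  an antipodal pair. Hence \<open>\<gamma> p \<bullet> \<gamma> q\<close> keeps its sign along the
  incidence curve.\<close>

lemma not_antipodal:
  assumes "p \<in> params" "q \<in> params" "\<gamma> p \<bullet> N q = 0"
  shows "\<gamma> p \<bullet> \<gamma> q \<noteq> 0"
proof
  assume "\<gamma> p \<bullet> \<gamma> q = 0"
  then have g: "\<gamma> p = (\<gamma> p \<bullet> \<gamma>1 q / (\<gamma>1 q \<bullet> \<gamma>1 q)) *\<^sub>R \<gamma>1 q" using frame[of "\<gamma> p" q] assms(3) by simp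
  have "\<gamma>1 q = norm (\<gamma>1 q) *\<^sub>R sgn (\<gamma>1 q)" using \<gamma>1_nz[of q] by (simp add: sgn_\<gamma>1)
  then obtain c where c: "\<gamma> p = c *\<^sub>R sgn (\<gamma>1 q)" using g by (metis scaleR_scaleR)
  then have "\<bar>c\<bar> = 1" using norm_\<gamma>[of p] sgn_\<gamma>1(2)[of q] by (metis mult.right_neutral norm_scaleR)
  then have "c \<in> {1, -1}" by (auto simp: abs_if split: if_splits)
  then have "rp2_proj (c *\<^sub>R sgn (\<gamma>1 q)) = rp2_proj (sgn (\<gamma>1 q))" by (rule rp2_proj_sign)
  then have "K p = rp2_antipode K q" by (simp only: antipode_eq K_eq[of p] c)
  then have "(q, p) \<in> rp2_antipodal_pairs K" using assms by (simp add: rp2_antipodal_pairs_def)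
  then show False using no_antipodal by simp
qed

end

text \<open>The lift covers \<open>K\<close> by the two antipodal curves \<open>\<gamma>\<close> and \<open>-\<gamma>\<close>. The sign \<open>\<delta>\<close> selects the one on
  which the representative of \<open>K q\<close> nearest to \<open>\<gamma> p\<close> lies; since there are no antipodal pairs, the two
  families of pairs \<open>(p, q)\<close> never meet.\<close>

locale generic_rp2_curve_sign = generic_rp2_curve +
  fixes \<delta> :: real
  assumes \<delta>: "\<delta> \<in> {1, -1}"
begin

definition A where "A z = \<delta> * (\<gamma> (fst z) \<bullet> N (snd z))"
definition D where "D z = - (\<gamma> (fst z) \<bullet> \<gamma>1 (snd z))"
definition S where "S z = - (\<delta> * (\<gamma>1 (fst z) \<bullet> N (snd z)))"
text \<open>The angle of two geodesics is read off their poles: away from a crossing the tangent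
  vectors sit at different points of the sphere, and their inner product does not measure that
  angle.\<close>

definition C where "C z = \<delta> * (N (fst z) \<bullet> N (snd z))"
definition g where "g z = \<delta> * (\<gamma> (fst z) \<bullet> \<gamma> (snd z))"
definition Ap where "Ap z = \<delta> * (\<gamma>1 (fst z) \<bullet> N (snd z))"
definition Aq where "Aq z = \<delta> * (\<gamma> (fst z) \<bullet> N1 (snd z))"
definition VD where "VD z = - (\<gamma>1 (fst z) \<bullet> \<gamma>1 (snd z)) * Aq z - - (\<gamma> (fst z) \<bullet> \<gamma>2 (snd z)) * Ap z"
definition VS where "VS z = - (\<delta> * (\<gamma>2 (fst z) \<bullet> N (snd z))) * Aq z - - (\<delta> * (\<gamma>1 (fst z) \<bullet> N1 (snd z))) * Ap z"
definition VC where "VC z = (\<delta> * (N1 (fst z) \<bullet> N (snd z))) * Aq z - (\<delta> * (N (fst z) \<bullet> N1 (snd z))) * Ap z"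

lemmas data_defs = A_def D_def S_def C_def g_def Ap_def Aq_def VD_def VS_def VC_def

lemma \<delta>_sq [simp]: "\<delta> * \<delta> = 1" "\<delta> * (\<delta> * x) = x"
  using \<delta> by auto

lemma \<delta>_nz [simp]: "\<delta> \<noteq> 0" using \<delta> by auto

lemma sgn_\<delta> [simp]: "sgn \<delta> = \<delta>" using \<delta> by auto

lemma Ap_eq: "Ap z = - S z"
  by (simp add: Ap_def S_def)

lemma Aq_eq:
  assumes "A z = 0"
  shows "Aq z = \<delta> * (k (snd z) / (\<gamma>1 (snd z) \<bullet> \<gamma>1 (snd z))) * D z"
  using assms by (simp add: A_def Aq_def D_def N1_frame inner_diff_right)

text \<open>The pole of the tangent geodesic of \<open>q\<close> lies along
  \<open>\<gamma>1 p\<close>, so \<open>\<gamma> q\<close> lies in the plane of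
  \<open>\<gamma> p\<close> and \<open>N p\<close>. The last factor of \<open>VC\<close> vanishes
  exactly when \<open>\<delta> *\<^sub>R \<gamma> q\<close> is proportional to
  \<open>center_vec p\<close>.\<close>

lemma nt_pair_data:
  assumes "A (p, q) = 0" "C (p, q) = 0"
  obtains y c where "\<delta> *\<^sub>R \<gamma> q = g (p, q) *\<^sub>R \<gamma> p + y *\<^sub>R N p" "S (p, q) \<noteq> 0" "D (p, q) = y * S (p, q)"
    "VC (p, q) = \<delta> * c * (y * k p - g (p, q) * (\<gamma>1 p \<bullet> \<gamma>1 p))" "c > 0"
proof -
  define a b s G where "a = \<gamma>1 p \<bullet> \<gamma>1 p" and "b = \<gamma>1 q \<bullet> \<gamma>1 q" and "s = S (p, q)" and "G = g (p, q)"
  have ab: "a > 0" "b > 0" using v_pos by (auto simp: a_def b_def)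
  have z: "\<gamma> p \<bullet> N q = 0" "N p \<bullet> N q = 0" using assms by (simp_all add: A_def C_def)
  have Nq: "N q = (- (\<delta> * s) / a) *\<^sub>R \<gamma>1 p"
    using frame[of "N q" p] z by (simp add: s_def S_def a_def inner_commute)
  then have s: "s \<noteq> 0" using N_nz[of q] by auto
  have "\<gamma> q \<bullet> N q = 0" by (simp add: N_simps)
  then have gp: "\<gamma> q \<bullet> \<gamma>1 p = 0" using s ab unfolding Nq by simp
  define y where "y = \<delta> * (\<gamma> q \<bullet> N p) / a"
  have q: "\<delta> *\<^sub>R \<gamma> q = G *\<^sub>R \<gamma> p + y *\<^sub>R N p"
    using frame[of "\<delta> *\<^sub>R \<gamma> q" p] gp by (simp add: G_def g_def y_def a_def inner_commute)
  \<comment> \<open>Recovering the tangent at \<open>q\<close> from pole and base point expresses it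
    in the frame at \<open>p\<close>.\<close>
  have "\<gamma>1 q = \<epsilon> *\<^sub>R cross3 (N q) (\<gamma> q)" by (simp add: N_cross)
  also have "\<dots> = (\<epsilon> * (- s / a)) *\<^sub>R cross3 (\<gamma>1 p) (\<delta> *\<^sub>R \<gamma> q)"
    by (simp add: Nq cross_mult_left cross_mult_right mult_ac)
  also have "cross3 (\<gamma>1 p) (\<delta> *\<^sub>R \<gamma> q) = \<epsilon> *\<^sub>R (- G *\<^sub>R N p + (y * a) *\<^sub>R \<gamma> p)"
    unfolding q using N_cross(1,2)[of p] cross_skew[of "\<gamma>1 p" "\<gamma> p"]
    by (simp add: cross_add_right cross_mult_right a_def algebra_simps)
  finally have g1: "\<gamma>1 q = (- s / a) *\<^sub>R (- G *\<^sub>R N p + (y * a) *\<^sub>R \<gamma> p)"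
    by (simp add: mult.left_commute[of \<epsilon>] mult.assoc[symmetric])
  have D: "D (p, q) = y * s"
    unfolding D_def using ab by (simp add: g1 inner_diff_right inner_add_right \<gamma>_simps N_simps)
  have Ng: "N p \<bullet> \<gamma>1 q = s * G"
    using ab by (simp add: g1 inner_diff_right inner_add_right N_simps a_def[symmetric])
  have "Aq (p, q) = \<delta> * (k q / b) * (y * s)" using Aq_eq[OF assms(1)] D by (simp add: b_def)
  moreover have "Ap (p, q) = - s" by (simp add: Ap_eq s_def)
  moreover have "\<delta> * (N1 p \<bullet> N q) = s / a * k p" unfolding Nq by (simp add: N1_simps)
  moreover have "\<delta> * (N p \<bullet> N1 q) = - \<delta> * (k q / b) * (s * G)"
    using z(2) Ng by (simp add: N1_frame[of q] inner_diff_right b_def)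
  ultimately have "VC (p, q) = (s / a * k p) * (\<delta> * (k q / b) * (y * s)) - (- \<delta> * (k q / b) * (s * G)) * (- s)"
    unfolding VC_def by simp
  also have "\<dots> = \<delta> * (s * s * k q / (a * b)) * (y * k p - G * a)"
    using ab by (simp add: field_simps)
  finally have VC: "VC (p, q) = \<delta> * (s * s * k q / (a * b)) * (y * k p - G * a)" .
  have "s * s * k q / (a * b) > 0"
    using s by (intro divide_pos_pos[OF mult_pos_pos[OF _ k_pos] mult_pos_pos[OF ab]]) (metis not_real_square_gt_zero)
  from that[OF q[unfolded G_def] _ D[unfolded s_def] VC[unfolded G_def a_def] this[unfolded a_def]] s
  show thesis by (simp add: s_def)
qed

lemma symmetric: "g (t, s) = g (s, t)" "C (t, s) = C (s, t)"
  by (simp_all add: g_def C_def inner_commute)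

lemma sides_iff:
  assumes dt: "rp2_double_tangency K s t" "g (s, t) > 0" and \<tau>: "\<tau> \<in> {1, -1}"
  shows "rp2_sides K s t \<tau> \<longleftrightarrow> \<tau> * C (s, t) > 0"
proof -
  have st: "\<gamma> s \<bullet> N t = 0" "\<gamma>1 s \<bullet> N t = 0" using dt by (auto simp: double_tangency_iff)
  have "C (s, t) \<noteq> 0"
    using frame_zero[of "N t" s] st N_nz[of t] by (auto simp: C_def inner_commute)
  then have "C (s, t) > 0 \<or> C (s, t) < 0" by linarith
  then have "C (s, t) > 0 \<and> rp2_sides K s t 1 \<or> C (s, t) < 0 \<and> rp2_sides K s t (- 1)"
    using rp2_sidesI[OF st \<delta>, of 1] rp2_sidesI[OF st \<delta>, of "- 1"] dt(2)
    by (auto simp: C_def g_def)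
  \<comment> \<open>Exclusiveness of the types again turns the two implications into an
    equivalence.\<close>
  moreover have "rp2_sides K s t 1 \<noteq> rp2_sides K s t (- 1)"
    using generic dt unfolding rp2_generic_def rp2_types_well_defined_def by blast
  ultimately show ?thesis using \<tau> by auto
qed

lemma type_iff:
  assumes x: "rp2_crossing K s t" "g (s, t) > 0" and \<tau>: "\<tau> \<in> {1, -1}"
  shows "(if \<tau> = 1 then rp2_crossing_type1 K s t else rp2_crossing_type2 K s t) \<longleftrightarrow> \<tau> * C (s, t) > 0"
proof -
  have nz: "\<gamma>1 s \<bullet> N t \<noteq> 0" "C (s, t) \<noteq> 0" using crossing_iff(2)[OF x(1)] by (auto simp: C_def)
  have "\<gamma> s = \<delta> *\<^sub>R \<gamma> t" using x by (intro meet_sign \<delta>) (auto simp: crossing_iff(1) g_def)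
  then have "\<gamma> t = \<delta> *\<^sub>R \<gamma> s" by simp
  note types = crossing_types[OF x(1) \<delta> this nz(1)]
  from nz have "C (s, t) > 0 \<or> C (s, t) < 0" by linarith
  then have "C (s, t) > 0 \<and> rp2_crossing_type1 K s t \<or> C (s, t) < 0 \<and> rp2_crossing_type2 K s t"
    using types by (auto simp: C_def)
  moreover have "rp2_crossing_type1 K s t \<noteq> rp2_crossing_type2 K s t"
    using generic x unfolding rp2_generic_def rp2_types_well_defined_def by blast
  ultimately show ?thesis using \<tau> by auto
qed

theorem signed_count:
  assumes \<tau>: "\<tau> \<in> {1, -1}"
  defines "Z \<equiv> {(s, t). rp2_double_tangency K s t \<and> g (s, t) > 0 \<and> rp2_sides K s t \<tau>}"
    and "X \<equiv> {(s, t). rp2_crossing K s t \<and> g (s, t) > 0 \<and>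
      (if \<tau> = 1 then rp2_crossing_type1 K s t else rp2_crossing_type2 K s t)}"
  shows "finite Z" "finite X"
    "real (card {z \<in> rp2_nt_pairs1 K. g z > 0}) - real (card {z \<in> rp2_nt_pairs2 K. g z > 0}) =
      2 * real (card Z) - 2 * \<tau> * real (card X)"
proof -
  obtain \<eta> where \<eta>: "\<eta> > 0" "\<And>p q. \<gamma> p \<bullet> N q = 0 \<Longrightarrow> p - q \<notin> \<int> \<Longrightarrow> 1 - cos (2 * pi * (p - q)) > \<eta>"
    using separation by blast
  \<comment> \<open>The minimum keeps the pairs off the diagonal on the chosen sheet. On the zeros
    of \<open>A\<close> neither entry vanishes: the first because there are no antipodal pairs, the
    second by the separation.\<close>
  define G where "G z = min (g z) (1 - cos (2 * pi * (fst z - snd z)) - \<eta>)" for z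
  have Gz: "G (p, q) > 0 \<longleftrightarrow> p \<noteq> q \<and> g (p, q) > 0" "G (p, q) \<noteq> 0" if "p \<in> params" "q \<in> params" "A (p, q) = 0" for p q
  proof -
    have a: "\<gamma> p \<bullet> N q = 0" using that(3) by (simp add: A_def)
    then have "g (p, q) \<noteq> 0" using not_antipodal[OF that(1,2)] by (simp add: g_def)
    then show "G (p, q) > 0 \<longleftrightarrow> p \<noteq> q \<and> g (p, q) > 0" "G (p, q) \<noteq> 0"
      using \<eta>(1) \<eta>(2)[OF a] diff_Ints_params[OF that(1,2)] by (auto simp: G_def min_def)
  qed
  have G_le: "g z > 0" if "G z > 0" for z using that by (simp add: G_def)
  have nt_nz: "VC (p, q) \<noteq> 0" if z: "p \<in> params" "q \<in> params" "A (p, q) = 0" "C (p, q) = 0" "g (p, q) > 0" for p q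
  proof
    assume vc: "VC (p, q) = 0"
    from nt_pair_data[OF z(3,4)] obtain y c where y: "\<delta> *\<^sub>R \<gamma> q = g (p, q) *\<^sub>R \<gamma> p + y *\<^sub>R N p"
      "VC (p, q) = \<delta> * c * (y * k p - g (p, q) * (\<gamma>1 p \<bullet> \<gamma>1 p))" "c > 0" by metis
    have "y * k p = g (p, q) * (\<gamma>1 p \<bullet> \<gamma>1 p)" using vc y(2,3) by simp
    then have "K q = rp2_center K p" by (rule nt_types(3)[OF \<delta> y(1) z(5)])
    moreover have "(p, q) \<in> rp2_nt_pairs K" using z by (simp add: nt_pair_iff A_def C_def)
    ultimately show False using generic unfolding rp2_generic_def by fast
  qed
  interpret P: pair_system A D S C G Ap Aq VD VS VC \<delta>
  proof
    show "periodic2 A" "periodic2 D" "periodic2 S" "periodic2 C" "periodic2 VD" "periodic2 VS" "periodic2 VC"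
      by (simp_all add: periodic2_def data_defs periodic periodic_N)
    have "periodic2 g" by (simp add: periodic2_def g_def periodic)
    then show "periodic2 G"
      using cos_diff_periodic2[of \<eta>] unfolding periodic2_def G_def by metis
    show "continuous_on UNIV Ap" "continuous_on UNIV Aq" "continuous_on UNIV G"
      unfolding Ap_def Aq_def G_def g_def
      by (intro continuous_intros continuous_comp_fst_snd continuous continuous_N)+
    note dd = has_derivative_inner_fst_snd has_derivative_mult_right has_derivative_minus derivs N_deriv
    show "(A has_derivative (\<lambda>h. Ap z * fst h + Aq z * snd h)) (at z)" for z
      unfolding A_def
      by (rule has_derivative_eq_rhs, (rule dd)+) (simp add: fun_eq_iff Ap_def Aq_def algebra_simps)
    show "\<exists>dp dq. (D has_derivative (\<lambda>h. dp * fst h + dq * snd h)) (at z) \<and> VD z = dp * Aq z - dq * Ap z" for z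
      unfolding D_def VD_def
      by (intro exI[of _ "- (\<gamma>1 (fst z) \<bullet> \<gamma>1 (snd z))"] exI[of _ "- (\<gamma> (fst z) \<bullet> \<gamma>2 (snd z))"] conjI,
          rule has_derivative_eq_rhs, (rule dd)+) (simp_all add: fun_eq_iff algebra_simps)
    show "\<exists>dp dq. (S has_derivative (\<lambda>h. dp * fst h + dq * snd h)) (at z) \<and> VS z = dp * Aq z - dq * Ap z" for z
      unfolding S_def VS_def
      by (intro exI[of _ "- (\<delta> * (\<gamma>2 (fst z) \<bullet> N (snd z)))"] exI[of _ "- (\<delta> * (\<gamma>1 (fst z) \<bullet> N1 (snd z)))"] conjI,
          rule has_derivative_eq_rhs, (rule dd)+) (simp_all add: fun_eq_iff algebra_simps)
    show "\<exists>dp dq. (C has_derivative (\<lambda>h. dp * fst h + dq * snd h)) (at z) \<and> VC z = dp * Aq z - dq * Ap z" for z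
      unfolding C_def VC_def
      by (intro exI[of _ "\<delta> * (N1 (fst z) \<bullet> N (snd z))"] exI[of _ "\<delta> * (N (fst z) \<bullet> N1 (snd z))"] conjI,
          rule has_derivative_eq_rhs, (rule dd)+) (simp_all add: fun_eq_iff algebra_simps)
    show "\<delta> \<in> {1, -1}" by (rule \<delta>)
    show "G z \<noteq> 0" if "z \<in> params \<times> params" "A z = 0" for z
      using Gz that by (cases z) auto
    show "sgn (Ap z) = - sgn (S z)" for z by (simp add: Ap_eq sgn_minus)
    show "sgn (Aq z) = \<delta> * sgn (D z)" if "A z = 0" for z
      using k_pos[of "snd z"] v_pos[of "snd z"] by (simp add: Aq_eq[OF that] sgn_mult sgn_divide)
    \<comment> \<open>At a crossing on this sheet
      \<open>\<gamma> p = \<delta> *\<^sub>R \<gamma> q\<close>, so the derivative of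
      \<open>D\<close> in \<open>q\<close> is \<open>\<delta>\<close> times the squared speed, which
      brings \<open>\<delta>\<close> into the sign.\<close>
    show "sgn (VD z) = \<delta> * sgn (S z)" if z: "A z = 0" "G z > 0" "D z = 0" for z
    proof -
      have "\<gamma> (fst z) = \<delta> *\<^sub>R \<gamma> (snd z)"
        by (rule meet_sign) (use z \<delta> G_le[OF z(2)] in \<open>simp_all add: A_def D_def g_def\<close>)
      then have "VD z = \<delta> * (\<gamma>1 (snd z) \<bullet> \<gamma>1 (snd z)) * S z"
        by (simp add: VD_def Aq_eq[OF z(1)] z(3) Ap_eq \<gamma>_simps)
      then show ?thesis using v_pos[of "snd z"] by (simp add: sgn_mult)
    qed
    show "sgn (VS z) = - \<delta> * sgn (C z) * sgn (D z)" if z: "A z = 0" "S z = 0" for z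
    proof -
      have n: "N (snd z) = (\<delta> * C z / (\<gamma>1 (fst z) \<bullet> \<gamma>1 (fst z))) *\<^sub>R N (fst z)"
        using frame[of "N (snd z)" "fst z"] z by (simp add: A_def S_def C_def inner_commute)
      have "\<gamma>2 (fst z) \<bullet> N (snd z) = \<delta> * C z / (\<gamma>1 (fst z) \<bullet> \<gamma>1 (fst z)) * k (fst z)"
        by (subst n) (simp add: k_def)
      then have "VS z = - (C z / (\<gamma>1 (fst z) \<bullet> \<gamma>1 (fst z)) * k (fst z)) * (\<delta> * (k (snd z) / (\<gamma>1 (snd z) \<bullet> \<gamma>1 (snd z))) * D z)"
        by (simp add: VS_def Aq_eq[OF z(1)] Ap_eq z(2))
      then show ?thesis
        using v_pos[of "fst z"] v_pos[of "snd z"] k_pos[of "fst z"] k_pos[of "snd z"]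
        by (simp add: sgn_mult sgn_divide sgn_minus)
    qed
    show "VC z \<noteq> 0" if "z \<in> params \<times> params" "A z = 0" "G z > 0" "C z = 0" for z
      using nt_nz that G_le by (cases z) auto
    have x: "S z \<noteq> 0 \<and> C z \<noteq> 0" if "z \<in> params \<times> params" "A z = 0" "G z > 0" "D z = 0" for z
    proof -
      obtain p q where z: "z = (p, q)" by (cases z)
      have "rp2_crossing K p q" using that Gz(1)[of p q] unfolding z by (simp add: crossing_iff(1) A_def D_def)
      from crossing_iff(2)[OF this] show ?thesis by (simp add: z S_def C_def)
    qed
    show "S z \<noteq> 0" "C z \<noteq> 0" if "z \<in> params \<times> params" "A z = 0" "G z > 0" "D z = 0" for z
      using x[OF that] by auto
    show "C z \<noteq> 0" if z: "A z = 0" "S z = 0" for z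
    proof
      assume "C z = 0"
      then have "N (snd z) = 0" using z by (intro frame_zero[of _ "fst z"]) (simp_all add: A_def S_def C_def inner_commute)
      then show False using N_nz by simp
    qed
  qed
  have sign: "P.nt_sign (p, q) = sgn y * sgn (y * k p - g (p, q) * (\<gamma>1 p \<bullet> \<gamma>1 p))"
    if "S (p, q) \<noteq> 0" "D (p, q) = y * S (p, q)"
      "VC (p, q) = \<delta> * c * (y * k p - g (p, q) * (\<gamma>1 p \<bullet> \<gamma>1 p))" "c > 0" for p q y c
  proof -
    have "sgn (S (p, q)) * sgn (S (p, q)) = 1" using that(1) by (auto simp: sgn_if)
    then show ?thesis
      unfolding P.nt_sign_def that(2,3) using that(4) by (simp add: sgn_mult mult_ac)
  qed
  have T: "P.pairs (\<lambda>z. C z = 0) = {z \<in> rp2_nt_pairs K. g z > 0}"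
  proof (rule set_eqI, clarify)
    fix p q
    have "p \<noteq> q" if "C (p, q) = 0" using that N_nz[of q] by (auto simp: C_def)
    then show "((p, q) \<in> P.pairs (\<lambda>z. C z = 0)) = ((p, q) \<in> {z \<in> rp2_nt_pairs K. g z > 0})"
      using Gz(1)[of p q] by (auto simp: P.pairs_def nt_pair_iff A_def C_def)
  qed
  have nt: "P.nt_sign (p, q) = 1 \<and> K q \<in> rp2_normal_minus K p \<or>
      P.nt_sign (p, q) = - 1 \<and> K q \<in> rp2_normal_plus K p" if pq: "(p, q) \<in> rp2_nt_pairs K" "g (p, q) > 0" for p q
  proof -
    have z: "p \<in> params" "q \<in> params" "A (p, q) = 0" "C (p, q) = 0"
      using pq by (auto simp: nt_pair_iff A_def C_def)
    from nt_pair_data[OF z(3,4)] obtain y c where y: "\<delta> *\<^sub>R \<gamma> q = g (p, q) *\<^sub>R \<gamma> p + y *\<^sub>R N p" "S (p, q) \<noteq> 0"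
      "D (p, q) = y * S (p, q)" "VC (p, q) = \<delta> * c * (y * k p - g (p, q) * (\<gamma>1 p \<bullet> \<gamma>1 p))" "c > 0" by metis
    have "p \<noteq> q" using z(4) N_nz[of q] by (auto simp: C_def)
    have "D (p, q) \<noteq> 0"
    proof
      assume "D (p, q) = 0"
      then have "rp2_crossing K p q" using z \<open>p \<noteq> q\<close> by (simp add: crossing_iff(1) A_def D_def)
      from crossing_iff(2)[OF this] z(4) show False by (simp add: C_def)
    qed
    then have "y \<noteq> 0" using y(3) by auto
    moreover have "y * k p \<noteq> g (p, q) * (\<gamma>1 p \<bullet> \<gamma>1 p)" using nt_nz[OF z pq(2)] y(4) by auto
    ultimately consider "y < 0" | "y * k p > g (p, q) * (\<gamma>1 p \<bullet> \<gamma>1 p)" | "y > 0" "y * k p < g (p, q) * (\<gamma>1 p \<bullet> \<gamma>1 p)" by argo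
    then show ?thesis
    proof cases
      case 1
      then have "y * k p < g (p, q) * (\<gamma>1 p \<bullet> \<gamma>1 p)"
        using k_pos[of p] mult_pos_pos[OF pq(2) v_pos[of p]] mult_neg_pos[of y "k p"] by linarith
      then show ?thesis using 1 sign[OF y(2-5)] nt_types(2)[OF \<delta> y(1) pq(2)] by simp
    next
      case 2
      then have "y * k p > 0" using mult_pos_pos[OF pq(2) v_pos[of p]] by linarith
      then have "y > 0" using k_pos[of p] by (simp add: zero_less_mult_iff)
      then show ?thesis using 2 sign[OF y(2-5)] nt_types(2)[OF \<delta> y(1) pq(2)] by simp
    next
      case 3
      then show ?thesis using sign[OF y(2-5)] nt_types(1)[OF \<delta> y(1) pq(2)] by simp
    qed
  qed
  have xor: "rp2_types_well_defined K" using generic unfolding rp2_generic_def by blast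
  have "{z \<in> rp2_nt_pairs1 K. g z > 0} = {z \<in> {z \<in> rp2_nt_pairs K. g z > 0}. P.nt_sign z = 1}"
    "{z \<in> rp2_nt_pairs2 K. g z > 0} = {z \<in> {z \<in> rp2_nt_pairs K. g z > 0}. P.nt_sign z = - 1}"
    using nt xor unfolding rp2_nt_pairs1_def rp2_nt_pairs2_def rp2_types_well_defined_def by fastforce+
  moreover have "finite (rp2_nt_pairs K)" using generic unfolding rp2_generic_def by blast
  ultimately have N: "(\<Sum>z\<in>{z \<in> rp2_nt_pairs K. g z > 0}. P.nt_sign z) =
      real (card {z \<in> rp2_nt_pairs1 K. g z > 0}) - real (card {z \<in> rp2_nt_pairs2 K. g z > 0})"
    using sum_of_signs[of "{z \<in> rp2_nt_pairs K. g z > 0}" P.nt_sign] nt by force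
  have Z: "P.pairs (\<lambda>z. S z = 0 \<and> \<tau> * C z > 0) = Z"
    using Gz(1) sides_iff[OF _ _ \<tau>] by (auto simp: P.pairs_def Z_def double_tangency_iff A_def S_def)
  have X: "P.pairs (\<lambda>z. D z = 0 \<and> \<tau> * C z > 0) = X"
  proof -
    have "P.pairs (\<lambda>z. D z = 0 \<and> \<tau> * C z > 0) = {(s, t). rp2_crossing K s t \<and> g (s, t) > 0 \<and> \<tau> * C (s, t) > 0}"
      using Gz(1) by (auto simp: P.pairs_def crossing_iff(1) A_def D_def)
    also have "\<dots> = X" unfolding X_def using type_iff[OF _ _ \<tau>] by blast
    finally show ?thesis .
  qed
  show "finite Z" "finite X"
    "real (card {z \<in> rp2_nt_pairs1 K. g z > 0}) - real (card {z \<in> rp2_nt_pairs2 K. g z > 0}) =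
      2 * real (card Z) - 2 * \<tau> * real (card X)"
    using P.pair_count[OF \<tau>] N by (simp_all add: Z X T)
qed

end

section \<open>Adding the two sheets\<close>

context generic_rp2_curve
begin

theorem counts:
  "4 * int (card (rp2_double_tangents1 K)) - 4 * int (card (rp2_crossings1 K))
     = int (card (rp2_nt_pairs1 K)) - int (card (rp2_nt_pairs2 K))"
  "4 * int (card (rp2_double_tangents2 K)) + 4 * int (card (rp2_crossings2 K))
     = int (card (rp2_nt_pairs1 K)) - int (card (rp2_nt_pairs2 K))"
proof -
  \<comment> \<open>\<open>P\<close> counts the pairs whose lifts are less than
    \<open>pi / 2\<close> apart, \<open>M\<close> those for which this holds after replacing one
    lift by its antipode. Without antipodal pairs these are all pairs on the incidence
    curve.\<close>
  interpret P: generic_rp2_curve_sign K 1 by unfold_locales simp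
  interpret M: generic_rp2_curve_sign K "-1" by unfold_locales simp
  define f where "f z = \<gamma> (fst z) \<bullet> \<gamma> (snd z)" for z
  have g: "P.g z > 0 \<longleftrightarrow> f z > 0" "M.g z > 0 \<longleftrightarrow> f z < 0" for z by (simp_all add: P.g_def M.g_def f_def)
  define type where "type \<tau> s t = (if \<tau> = 1 then rp2_crossing_type1 K s t else rp2_crossing_type2 K s t)"
    for \<tau> :: real and s t
  define Z where "Z \<tau> = {(s, t). rp2_double_tangency K s t \<and> rp2_sides K s t \<tau>}" for \<tau>
  define X where "X \<tau> = {(s, t). rp2_crossing K s t \<and> type \<tau> s t}" for \<tau>
  have split: "finite B \<and> card B = card B1 + card B2"
    if "finite B1" "finite B2" "B1 = {z \<in> B. f z > 0}" "B2 = {z \<in> B. f z < 0}" "\<And>z. z \<in> B \<Longrightarrow> f z \<noteq> 0"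
    for B B1 B2
  proof -
    have B: "B = B1 \<union> B2" using that(3-5) by (auto simp: linorder_neq_iff)
    moreover have "B1 \<inter> B2 = {}" using that(3,4) by auto
    ultimately show ?thesis using card_Un_disjoint[OF that(1,2)] that(1,2) by (metis finite_Un)
  qed
  have "finite (rp2_nt_pairs K)" using generic unfolding rp2_generic_def by blast
  then have fin: "finite (rp2_nt_pairs1 K)" "finite (rp2_nt_pairs2 K)"
    by (auto simp: rp2_nt_pairs1_def rp2_nt_pairs2_def elim!: rev_finite_subset)
  have nt_f: "f z \<noteq> 0" if "z \<in> rp2_nt_pairs K" for z
    using that not_antipodal by (cases z) (auto simp: nt_pair_iff f_def)
  have nt1: "card (rp2_nt_pairs1 K) = card {z \<in> rp2_nt_pairs1 K. P.g z > 0} + card {z \<in> rp2_nt_pairs1 K. M.g z > 0}"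
    using fin(1) nt_f by (intro split[THEN conjunct2]) (auto simp: g rp2_nt_pairs1_def)
  have nt2: "card (rp2_nt_pairs2 K) = card {z \<in> rp2_nt_pairs2 K. P.g z > 0} + card {z \<in> rp2_nt_pairs2 K. M.g z > 0}"
    using fin(2) nt_f by (intro split[THEN conjunct2]) (auto simp: g rp2_nt_pairs2_def)
  have total: "finite (Z \<tau>)" "finite (X \<tau>)"
    "real (card (rp2_nt_pairs1 K)) - real (card (rp2_nt_pairs2 K)) = 2 * real (card (Z \<tau>)) - 2 * \<tau> * real (card (X \<tau>))"
    if \<tau>: "\<tau> \<in> {1, -1}" for \<tau>
  proof -
    note p = P.signed_count[OF \<tau>, folded type_def] and m = M.signed_count[OF \<tau>, folded type_def]
    have Zf: "f z \<noteq> 0" if "z \<in> Z \<tau>" for z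
      using that not_antipodal by (auto simp: Z_def double_tangency_iff f_def)
    have Xf: "f z \<noteq> 0" if "z \<in> X \<tau>" for z
      using that not_antipodal by (auto simp: X_def crossing_iff(1) f_def)
    have Z: "finite (Z \<tau>) \<and> card (Z \<tau>) =
        card {(s, t). rp2_double_tangency K s t \<and> P.g (s, t) > 0 \<and> rp2_sides K s t \<tau>} +
        card {(s, t). rp2_double_tangency K s t \<and> M.g (s, t) > 0 \<and> rp2_sides K s t \<tau>}"
      by (rule split[OF p(1) m(1) _ _ Zf]) (auto simp: g Z_def)
    have X: "finite (X \<tau>) \<and> card (X \<tau>) =
        card {(s, t). rp2_crossing K s t \<and> P.g (s, t) > 0 \<and> type \<tau> s t} +
        card {(s, t). rp2_crossing K s t \<and> M.g (s, t) > 0 \<and> type \<tau> s t}"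
      by (rule split[OF p(2) m(2) _ _ Xf]) (auto simp: g X_def)
    show "finite (Z \<tau>)" "finite (X \<tau>)" using Z X by auto
    show "real (card (rp2_nt_pairs1 K)) - real (card (rp2_nt_pairs2 K)) = 2 * real (card (Z \<tau>)) - 2 * \<tau> * real (card (X \<tau>))"
      using p(3) m(3) Z X unfolding nt1 nt2 by (simp add: algebra_simps)
  qed
  have dt_uniq: "t = u" if "rp2_double_tangency K s t" "rp2_double_tangency K s u" for s t u
    using generic that unfolding rp2_generic_def by blast
  have x_uniq: "t = u" if "rp2_self_intersection K s t" "rp2_self_intersection K s u" for s t u
    using generic that unfolding rp2_generic_def by blast
  have f_sym: "f (t, s) = f (s, t)" for s t by (simp add: f_def inner_commute)
  have Z_card: "card (Z \<tau>) = 2 * card {rp2_tangent K s |s t. rp2_double_tangency K s t \<and> rp2_sides K s t \<tau>}"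
    if \<tau>: "\<tau> \<in> {1, -1}" for \<tau>
  proof -
    have "card (Z \<tau>) = 2 * card {rp2_tangent K s |s t. (s, t) \<in> Z \<tau>}"
    proof (rule card_symmetric_pairs[OF total(1)[OF \<tau>]])
      fix s t assume "(s, t) \<in> Z \<tau>"
      then have dt: "rp2_double_tangency K s t" "rp2_sides K s t \<tau>" by (auto simp: Z_def)
      then have ts: "rp2_double_tangency K t s" by (auto simp: rp2_double_tangency_def)
      have "f (s, t) > 0 \<or> f (s, t) < 0"
        using dt not_antipodal[of s t] by (auto simp: double_tangency_iff f_def)
      \<comment> \<open>Exchanging \<open>s\<close> and \<open>t\<close> is harmless because the
        type is decided by the symmetric function \<open>C\<close>.\<close>
      then have "rp2_sides K t s \<tau>"
        using P.sides_iff[OF dt(1) _ \<tau>] P.sides_iff[OF ts _ \<tau>] M.sides_iff[OF dt(1) _ \<tau>] M.sides_iff[OF ts _ \<tau>]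
          dt(2) f_sym[of s t] by (auto simp: g P.symmetric(2)[of s t] M.symmetric(2)[of s t])
      with ts show "(t, s) \<in> Z \<tau>" by (simp add: Z_def)
    next
      fix s t s' t'
      assume "(s, t) \<in> Z \<tau>" "(s', t') \<in> Z \<tau>" "rp2_tangent K s = rp2_tangent K s'"
      then show "s' = s \<or> s' = t"
        using dt_uniq[of s t s'] by (auto simp: Z_def rp2_double_tangency_def)
    qed (use dt_uniq in \<open>auto simp: Z_def rp2_double_tangency_def\<close>)
    then show ?thesis by (simp add: Z_def)
  qed
  have X_card: "card (X \<tau>) = 2 * card {K s |s t. rp2_crossing K s t \<and> type \<tau> s t}"
    if \<tau>: "\<tau> \<in> {1, -1}" for \<tau>
  proof -
    have "card (X \<tau>) = 2 * card {K s |s t. (s, t) \<in> X \<tau>}"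
    proof (rule card_symmetric_pairs[OF total(2)[OF \<tau>]])
      fix s t assume "(s, t) \<in> X \<tau>"
      then have x: "rp2_crossing K s t" "type \<tau> s t" by (auto simp: X_def)
      then have ts: "rp2_crossing K t s" by (auto simp: rp2_crossing_def rp2_self_intersection_def)
      have "f (s, t) > 0 \<or> f (s, t) < 0"
        using x not_antipodal[of s t] by (auto simp: crossing_iff(1) f_def)
      then have "type \<tau> t s"
        using P.type_iff[OF x(1) _ \<tau>, folded type_def] P.type_iff[OF ts _ \<tau>, folded type_def]
          M.type_iff[OF x(1) _ \<tau>, folded type_def] M.type_iff[OF ts _ \<tau>, folded type_def]
          x(2) f_sym[of s t] by (auto simp: g P.symmetric(2)[of s t] M.symmetric(2)[of s t])
      with ts show "(t, s) \<in> X \<tau>" by (simp add: X_def)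
    next
      fix s t s' t'
      assume "(s, t) \<in> X \<tau>" "(s', t') \<in> X \<tau>" "K s = K s'"
      then show "s' = s \<or> s' = t"
        using x_uniq[of s t s'] by (auto simp: X_def rp2_crossing_def rp2_self_intersection_def)
    qed (use x_uniq in \<open>auto simp: X_def rp2_crossing_def rp2_self_intersection_def\<close>)
    then show ?thesis by (simp add: X_def)
  qed
  have "real (card (rp2_nt_pairs1 K)) - real (card (rp2_nt_pairs2 K)) =
      4 * real (card (rp2_double_tangents1 K)) - 4 * real (card (rp2_crossings1 K))"
    using total(3)[of 1] Z_card[of 1] X_card[of 1]
    by (simp add: type_def rp2_double_tangents1_def rp2_crossings1_def)
  then show "4 * int (card (rp2_double_tangents1 K)) - 4 * int (card (rp2_crossings1 K))
     = int (card (rp2_nt_pairs1 K)) - int (card (rp2_nt_pairs2 K))" by linarith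
  have "real (card (rp2_nt_pairs1 K)) - real (card (rp2_nt_pairs2 K)) =
      4 * real (card (rp2_double_tangents2 K)) + 4 * real (card (rp2_crossings2 K))"
    using total(3)[of "- 1"] Z_card[of "- 1"] X_card[of "- 1"]
    by (simp add: type_def rp2_double_tangents2_def rp2_crossings2_def)
  then show "4 * int (card (rp2_double_tangents2 K)) + 4 * int (card (rp2_crossings2 K))
     = int (card (rp2_nt_pairs1 K)) - int (card (rp2_nt_pairs2 K))" by linarith
qed

end

section \<open>The counting formulas\<close>

theorem corollary4p4:
  shows "(\<forall>K :: real \<Rightarrow> rp2.
      rp2_closed_curve K \<and> rp2_generic K \<and>
      rp2_inflections K = {} \<and> rp2_antipodal_pairs K = {} \<longrightarrow>
        4 * int (card (rp2_double_tangents1 K)) - 4 * int (card (rp2_crossings1 K))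
          = int (card (rp2_nt_pairs1 K)) - int (card (rp2_nt_pairs2 K)) \<and>
        4 * int (card (rp2_double_tangents2 K)) + 4 * int (card (rp2_crossings2 K))
          = int (card (rp2_nt_pairs1 K)) - int (card (rp2_nt_pairs2 K)))
    \<and> (\<forall>K :: real \<Rightarrow> real^2.
      plane_closed_curve K \<and> plane_generic K \<and> plane_inflections K = {} \<longrightarrow>
        4 * int (card (plane_double_tangents1 K)) - 4 * int (card (plane_crossings1 K))
          = int (card (plane_nt_pairs1 K)) - int (card (plane_nt_pairs2 K)) \<and>
        4 * int (card (plane_double_tangents2 K)) + 4 * int (card (plane_crossings2 K))
          = int (card (plane_nt_pairs1 K)) - int (card (plane_nt_pairs2 K)))"
proof (intro conjI allI impI, goal_cases)
  case (1 K)
  then interpret generic_rp2_curve K by unfold_locales auto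
  show ?case by (rule counts(1))
next
  case (2 K)
  then interpret generic_rp2_curve K by unfold_locales auto
  show ?case by (rule counts(2))
next
  case (3 K)
  then interpret generic_plane_curve K by unfold_locales auto
  show ?case by (rule counts(1))
next
  case (4 K)
  then interpret generic_plane_curve K by unfold_locales auto
  show ?case by (rule counts(2))
qed

end
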